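(* Let $N,k\ge1$ be integers, let $G$ be an $N\times N$ complex Ginibre matrix, and for $\bm z,\bm w\in\mathbb{C}^k$ set $$R_N(\bm z,\bm w)=\mathbb{E}\Big(\prod_{j=1}^{k}\det(G-z_jI_N)\det(G^\dagger-w_jI_N)\Big).$$ Then $$R_N(\bm z,\bm w)=\sum_{\eta:\ l(\eta)\le k,\ \eta_1\le N}s_\eta(\bm z)s_\eta(\bm w)\prod_{j=1}^{k}\frac{(N+j-1)!}{(\eta_j+k-j)!}.$$ If all entries of $\bm z$ and $\bm w$ are positive real numbers, then $$R_N(\bm z,\bm w)=\mathcal{Z}_k\Big(\prod_{j=1}^{k}(N+j-1)!\Big)\,\mathbb{P}(\eta_1\le N),$$ where $\mathbb{P}$ is the probability measure on the set $\mathcal{P}_k$ of partitions $\eta$ of length $l(\eta)\le k$ given by $$p(\eta)=\frac{1}{\mathcal{Z}_k}s_\eta(\bm z)s_\eta(\bm w)\prod_{j=1}^{k}\frac{1}{(\eta_j+k-j)!},$$ and $\mathcal{Z}_k$ is the normalization constant (so that $\sum_{\eta\in\mathcal{P}_k}p(\eta)=1$).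
   Context: An $N\times N$ complex Ginibre matrix has law $\pi^{-N^2}\exp(-\mathrm{Tr}(GG^\dagger))\,dG$ on $\mathbb{C}^{N\times N}$. A partition $\eta=(\eta_1\ge\eta_2\ge\dots\ge\eta_k\ge0)$ of length at most $k$ is a weakly decreasing sequence of nonnegative integers, padded with zeros to $k$ parts. $s_\eta(x_1,\dots,x_k)$ is the Schur polynomial, $s_\eta(\bm x)=\det\{x_i^{\eta_j+k-j}\}_{i,j=1}^k/\det\{x_i^{k-j}\}_{i,j=1}^k$ (extended as a polynomial to coinciding arguments). *)

theory Defs
  imports "HOL-Probability.Probability" "Jordan_Normal_Form.Determinant"
begin

(* HOL-Analysis matrices, of type complex^'n^'n, carry the random matrix, since that type has a
   Lebesgue measure; Jordan_Normal_Form matrices carry the k x k determinants in the Schur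
   polynomials, since their size is a natural number.  Clashing names are qualified:
   Determinants.det is the former determinant, Determinant.det the latter.
   Vectors of length k and partitions are functions on nat read at the indices 1, ..., k. *)

section \<open>Ginibre matrices\<close>

definition conj_transpose :: "complex^'n^'m \<Rightarrow> complex^'m^'n" where
  "conj_transpose A = (\<chi> i j. cnj (vec_nth (vec_nth A j) i))"

(* The trace is a nonnegative real number, so Re only changes its type. *)
definition ginibre_density :: "complex^'n^'n \<Rightarrow> real" where
  "ginibre_density A =
     exp (- Re (Determinants.trace (A ** conj_transpose A))) / pi ^ (CARD('n) ^ 2)"

(* lborel on complex^'n^'n is the product of the Lebesgue measures of the real and imaginary
   parts of all entries. *)
definition ginibre_matrix :: "'a measure \<Rightarrow> ('a \<Rightarrow> complex^'n^'n) \<Rightarrow> bool" where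
  "ginibre_matrix M G \<longleftrightarrow>
     prob_space M \<and> distributed M lborel G (\<lambda>A. ennreal (ginibre_density A))"

definition charpoly_product ::
    "nat \<Rightarrow> (nat \<Rightarrow> complex) \<Rightarrow> (nat \<Rightarrow> complex) \<Rightarrow> complex^'n^'n \<Rightarrow> complex" where
  "charpoly_product k z w A =
     (\<Prod>j=1..k. Determinants.det (A - Finite_Cartesian_Product.mat (z j)) *
              Determinants.det (conj_transpose A - Finite_Cartesian_Product.mat (w j)))"

definition R_N ::
    "'a measure \<Rightarrow> ('a \<Rightarrow> complex^'n^'n) \<Rightarrow> nat \<Rightarrow> (nat \<Rightarrow> complex) \<Rightarrow> (nat \<Rightarrow> complex) \<Rightarrow> complex"
  where "R_N M G k z w = prob_space.expectation M (\<lambda>\<omega>. charpoly_product k z w (G \<omega>))"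

section \<open>Partitions and Schur polynomials\<close>

definition partitions :: "nat \<Rightarrow> (nat \<Rightarrow> nat) set" where
  "partitions k =
     {\<eta>. (\<forall>i j. 1 \<le> i \<and> i \<le> j \<and> j \<le> k \<longrightarrow> \<eta> j \<le> \<eta> i) \<and> (\<forall>i. i \<notin> {1..k} \<longrightarrow> \<eta> i = 0)}"

(* Jordan_Normal_Form numbers rows and columns from 0, hence the Suc. *)
definition alternant :: "nat \<Rightarrow> (nat \<Rightarrow> nat) \<Rightarrow> (nat \<Rightarrow> 'a::comm_ring_1) \<Rightarrow> 'a" where
  "alternant k \<eta> x =
     Determinant.det (Matrix.mat k k (\<lambda>(i, j). x (Suc i) ^ (\<eta> (Suc j) + k - Suc j)))"

inductive polynomial_fun :: "nat \<Rightarrow> ((nat \<Rightarrow> 'a::comm_ring_1) \<Rightarrow> 'a) \<Rightarrow> bool" for k where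
  const: "polynomial_fun k (\<lambda>x. c)"
| var: "i \<in> {1..k} \<Longrightarrow> polynomial_fun k (\<lambda>x. x i)"
| add: "polynomial_fun k f \<Longrightarrow> polynomial_fun k g \<Longrightarrow> polynomial_fun k (\<lambda>x. f x + g x)"
| mult: "polynomial_fun k f \<Longrightarrow> polynomial_fun k g \<Longrightarrow> polynomial_fun k (\<lambda>x. f x * g x)"

(* The quotient of alternants at pairwise distinct arguments, extended to coinciding arguments
   by the unique polynomial function that agrees with it.  The field must be infinite for
   uniqueness, which field_char_0 ensures. *)
definition schur :: "nat \<Rightarrow> (nat \<Rightarrow> nat) \<Rightarrow> (nat \<Rightarrow> 'a::field_char_0) \<Rightarrow> 'a" where
  "schur k \<eta> = (THE f. polynomial_fun k f \<and>
     (\<forall>x. inj_on x {1..k} \<longrightarrow> f x = alternant k \<eta> x / alternant k (\<lambda>_. 0) x))"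

section \<open>The measure on partitions\<close>

definition schur_weight :: "nat \<Rightarrow> (nat \<Rightarrow> real) \<Rightarrow> (nat \<Rightarrow> real) \<Rightarrow> (nat \<Rightarrow> nat) \<Rightarrow> real" where
  "schur_weight k x y \<eta> =
     schur k \<eta> x * schur k \<eta> y * (\<Prod>j=1..k. 1 / fact (\<eta> j + k - j))"

definition schur_Z :: "nat \<Rightarrow> (nat \<Rightarrow> real) \<Rightarrow> (nat \<Rightarrow> real) \<Rightarrow> real" where
  "schur_Z k x y = infsum (schur_weight k x y) (partitions k)"

definition schur_p :: "nat \<Rightarrow> (nat \<Rightarrow> real) \<Rightarrow> (nat \<Rightarrow> real) \<Rightarrow> (nat \<Rightarrow> nat) \<Rightarrow> real" where
  "schur_p k x y \<eta> = 1 / schur_Z k x y * schur_weight k x y \<eta>"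

definition schur_measure :: "nat \<Rightarrow> (nat \<Rightarrow> real) \<Rightarrow> (nat \<Rightarrow> real) \<Rightarrow> (nat \<Rightarrow> nat) measure" where
  "schur_measure k x y = point_measure (partitions k) (\<lambda>\<eta>. ennreal (schur_p k x y \<eta>))"

end

theory Submission
  imports Defs
begin

text \<open>Let X and Y be jointly Gaussian matrices and let \<Delta> denote the Vandermonde product. As a function of
  z and w, the expectation of \<Delta>(z) \<Delta>(w) \<Prod> det (X - z j) det (Y - w j) depends only on the covariances of
  entries (i, j) and (j, i), and Gaussian integration by parts turns a change of the variance of X or Y
  into a heat equation in z or w. The Ginibre pair (G, G*) has variances 0 and covariance 1, and it can
  be moved to X = Y = G + G*/2 without changing the covariance. There the two products combine into a
  single one with 2k variables, which, by the heat equation once more, is a determinant of Hermite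
  polynomials. The claimed sum, with monomials replaced by Hermite polynomials, solves the same heat
  equations; for X = Y it is an integral of \<Delta>(x, z) \<Delta>(x, w) over real Gaussian x in N variables, and
  \<Delta>(x, z) \<Delta>(x, w) \<Prod> (w j - z i) = \<Delta>(x) \<Delta>(x, z, w) together with orthogonality gives the same
  determinant. By uniqueness the two sides agree for (G, G*). Schur polynomials enter through the
  branching rule, which also shows that their coefficients are nonnegative; this gives positivity of
  the measure and convergence of the normalization constant.\<close>

text \<open>Integration by parts produces, besides second derivatives of single determinants,
  products of cofactors of two different factors. If the two matrices differ by a scalar, a
  resolvent identity turns such a product into a difference quotient of first derivatives, and the
  Vandermonde product absorbs these first-order terms because it is harmonic. A matrix X - z and a
  matrix Y - w admit no such identity, so the covariance of X and Y has to stay constant along a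
  path, which makes the mixed terms cancel in pairs. This is why the pair of G and its adjoint is
  not simply scaled down to 0 but first moved to X = Y, where all 2k factors differ by scalars. The
  weight 1/2 is then forced: a G + b G* has variance 2 a b, which for X = Y must equal the preserved
  covariance 1, so a = 1 gives b = 1/2. The matrix X is not Hermitian; only this second moment
  enters. Two of the paths are used backwards in time, which is harmless because all functions are
  polynomials, for which the heat equation is uniquely solvable in both directions.\<close>

section \<open>Polynomial functions over an arbitrary set of variables\<close>

text \<open>Extends \<open>polynomial_fun\<close> to any index type, since matrix entries, real
  coordinates and parameters all occur as variables. Keeping functions instead of formal polynomials
  makes substitution and differentiation immediate.\<close>

inductive polyfun :: "'v set \<Rightarrow> (('v \<Rightarrow> 'a::comm_ring_1) \<Rightarrow> 'a) \<Rightarrow> bool" for V where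
  const: "polyfun V (\<lambda>x. c)"
| var: "v \<in> V \<Longrightarrow> polyfun V (\<lambda>x. x v)"
| add: "polyfun V f \<Longrightarrow> polyfun V g \<Longrightarrow> polyfun V (\<lambda>x. f x + g x)"
| mult: "polyfun V f \<Longrightarrow> polyfun V g \<Longrightarrow> polyfun V (\<lambda>x. f x * g x)"

lemma polyfun_cmult: "polyfun V f \<Longrightarrow> polyfun V (\<lambda>x. c * f x)"
  by (intro polyfun.mult polyfun.const)

lemma polyfun_minus: "polyfun V f \<Longrightarrow> polyfun V (\<lambda>x. - f x)"
  using polyfun_cmult[of V f "-1"] by simp

lemma polyfun_diff: "polyfun V f \<Longrightarrow> polyfun V g \<Longrightarrow> polyfun V (\<lambda>x. f x - g x)"
  using polyfun.add[OF _ polyfun_minus, of V f g] by simp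

lemma polyfun_sum: "(\<And>i. i \<in> S \<Longrightarrow> polyfun V (f i)) \<Longrightarrow> polyfun V (\<lambda>x. \<Sum>i\<in>S. f i x)"
  by (induction S rule: infinite_finite_induct) (auto intro: polyfun.intros)

lemma polyfun_prod: "(\<And>i. i \<in> S \<Longrightarrow> polyfun V (f i)) \<Longrightarrow> polyfun V (\<lambda>x. \<Prod>i\<in>S. f i x)"
  by (induction S rule: infinite_finite_induct) (auto intro: polyfun.intros)

lemma polyfun_power: "polyfun V f \<Longrightarrow> polyfun V (\<lambda>x. f x ^ n)"
  by (induction n) (auto intro: polyfun.intros)

lemma polyfun_if: "polyfun V f \<Longrightarrow> polyfun V g \<Longrightarrow> polyfun V (\<lambda>x. if b then f x else g x)"
  by (cases b) auto

lemmas polyfun_intros = polyfun.intros polyfun_minus polyfun_diff polyfun_sum polyfun_prod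
  polyfun_power polyfun_if

lemma polyfun_mono: "polyfun V f \<Longrightarrow> V \<subseteq> W \<Longrightarrow> polyfun W f"
  by (induction rule: polyfun.induct) (auto intro: polyfun.intros)

lemma polyfun_compose:
  "polyfun V f \<Longrightarrow> (\<And>v. v \<in> V \<Longrightarrow> polyfun W (\<lambda>y. h y v)) \<Longrightarrow> polyfun W (\<lambda>y. f (h y))"
  by (induction rule: polyfun.induct) (auto intro: polyfun.intros)

lemma polyfun_cong:
  assumes "polyfun V f" "\<And>v. v \<in> V \<Longrightarrow> x v = y v"
  shows "f x = f y"
  using assms by (induction rule: polyfun.induct) auto

lemma polyfun_on_line:
  assumes "polyfun V f"
  shows "\<exists>p. \<forall>t. f (\<lambda>v. a v + t * b v) = poly p t"
  using assms
proof (induction rule: polyfun.induct)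
  case (const c)
  show ?case by (rule exI[of _ "[:c:]"]) simp
next
  case (var v)
  show ?case by (rule exI[of _ "[:a v, b v:]"]) simp
next
  case (add f g)
  then obtain p q where "\<forall>t. f (\<lambda>v. a v + t * b v) = poly p t" "\<forall>t. g (\<lambda>v. a v + t * b v) = poly q t"
    by blast
  then show ?case by (intro exI[of _ "p + q"]) simp
next
  case (mult f g)
  then obtain p q where "\<forall>t. f (\<lambda>v. a v + t * b v) = poly p t" "\<forall>t. g (\<lambda>v. a v + t * b v) = poly q t"
    by blast
  then show ?case by (intro exI[of _ "p * q"]) simp
qed

text \<open>The points x + t (0, 1, 2, \<dots>) are injective on S for all but finitely many t.\<close>

lemma polyfun_eq_0_if_inj:
  fixes f :: "(nat \<Rightarrow> 'a::field_char_0) \<Rightarrow> 'a"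
  assumes f: "polyfun V f" and S: "finite S" and z: "\<And>x. inj_on x S \<Longrightarrow> f x = 0"
  shows "f x = 0"
proof -
  obtain p where p: "\<And>t. f (\<lambda>v. x v + t * of_nat v) = poly p t"
    using polyfun_on_line[OF f, of x of_nat] by blast
  define B where "B = (\<lambda>(i, j). (x i - x j) / (of_nat j - of_nat i)) ` (S \<times> S)"
  have "poly p t = 0" if "t \<notin> B" for t
  proof -
    have "inj_on (\<lambda>v. x v + t * of_nat v) S"
    proof (rule inj_onI, rule ccontr)
      fix i j assume ij: "i \<in> S" "j \<in> S" "x i + t * of_nat i = x j + t * of_nat j" "i \<noteq> j"
      then have "t * (of_nat j - of_nat i) = x i - x j" "of_nat j - of_nat i \<noteq> (0::'a)"
        by (simp_all add: algebra_simps)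
      then have "t = (x i - x j) / (of_nat j - of_nat i)" by (simp add: field_simps)
      then have "t \<in> B" unfolding B_def using ij by (intro image_eqI[of _ _ "(i, j)"]) auto
      then show False using that by simp
    qed
    then show ?thesis using z p by metis
  qed
  then have sub: "- B \<subseteq> {t. poly p t = 0}" by auto
  have "infinite (- B)"
    using S by (simp add: B_def infinite_UNIV_char_0 Compl_eq_Diff_UNIV Diff_infinite_finite)
  with sub have "p = 0" using poly_roots_finite finite_subset by blast
  then show ?thesis using p[of 0] by simp
qed

text \<open>Identities can thus be proved at distinct coordinates, where division by differences is
  possible, and extended to coinciding ones. The set \<open>S\<close> may leave out coordinates such
  as the time.\<close>

lemma polyfun_eq_if_eq_on_inj:
  fixes f :: "(nat \<Rightarrow> 'a::field_char_0) \<Rightarrow> 'a"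
  assumes f: "polyfun V f" "polyfun W g" and S: "finite S" and z: "\<And>x. inj_on x S \<Longrightarrow> f x = g x"
  shows "f x = g x"
proof -
  have "polyfun (V \<union> W) (\<lambda>x. f x - g x)"
    by (intro polyfun_diff polyfun_mono[OF f(1)] polyfun_mono[OF f(2)]) auto
  from polyfun_eq_0_if_inj[OF this S, of x] z show ?thesis by auto
qed

section \<open>Partial derivatives of polynomial functions\<close>

text \<open>\<open>deriv\<close> is a choice operator, so the rules for sums and products assume
  polynomial functions, whose slices are differentiable.\<close>

definition pd :: "'v \<Rightarrow> (('v \<Rightarrow> complex) \<Rightarrow> complex) \<Rightarrow> ('v \<Rightarrow> complex) \<Rightarrow> complex" where
  "pd v f x = deriv (\<lambda>t. f (x(v := t))) (x v)"

lemma pd_eqI: "((\<lambda>t. f (x(v := t))) has_field_derivative d) (at (x v)) \<Longrightarrow> pd v f x = d"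
  unfolding pd_def by (rule DERIV_imp_deriv)

lemma polyfun_differentiable:
  "polyfun V f \<Longrightarrow> (\<lambda>t. f (x(v := t))) field_differentiable (at s)"
proof (induction rule: polyfun.induct)
  case (var w)
  show ?case by (cases "w = v") auto
qed (auto intro: field_differentiable_add field_differentiable_mult)

lemma has_pd_at:
  assumes "polyfun V f"
  shows "((\<lambda>t. f (x(v := t))) has_field_derivative pd v f (x(v := s))) (at s)"
  using polyfun_differentiable[OF assms, of x v s]
  by (simp add: pd_def DERIV_deriv_iff_field_differentiable)

lemma has_pd:
  assumes "polyfun V f"
  shows "((\<lambda>t. f (x(v := t))) has_field_derivative pd v f x) (at (x v))"
  using has_pd_at[OF assms, of x v "x v"] by simp

lemma pd_const [simp]: "pd v (\<lambda>x. c) = (\<lambda>x. 0)"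
  by (rule ext, rule pd_eqI) auto

lemma pd_var: "pd v (\<lambda>x. x w) = (\<lambda>x. if v = w then 1 else 0)"
  by (rule ext, rule pd_eqI) (auto intro!: derivative_eq_intros)

lemma pd_add:
  assumes "polyfun V f" "polyfun W g"
  shows "pd v (\<lambda>x. f x + g x) = (\<lambda>x. pd v f x + pd v g x)"
  by (rule ext, rule pd_eqI) (intro DERIV_add has_pd[OF assms(1)] has_pd[OF assms(2)])

lemma pd_mult:
  assumes "polyfun V f" "polyfun W g"
  shows "pd v (\<lambda>x. f x * g x) = (\<lambda>x. pd v f x * g x + f x * pd v g x)"
proof (rule ext, rule pd_eqI)
  fix x
  show "((\<lambda>t. f (x(v := t)) * g (x(v := t))) has_field_derivative pd v f x * g x + f x * pd v g x) (at (x v))"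
    using DERIV_mult[OF has_pd[OF assms(1), of x v] has_pd[OF assms(2), of x v]]
    by (simp add: algebra_simps)
qed

lemma pd_cmult: "polyfun V f \<Longrightarrow> pd v (\<lambda>x. c * f x) = (\<lambda>x. c * pd v f x)"
  using pd_mult[OF polyfun.const, of V f v c] by simp

lemma pd_minus: "polyfun V f \<Longrightarrow> pd v (\<lambda>x. - f x) = (\<lambda>x. - pd v f x)"
  using pd_cmult[of V f v "-1"] by simp

lemma pd_diff: "polyfun V f \<Longrightarrow> polyfun W g \<Longrightarrow> pd v (\<lambda>x. f x - g x) = (\<lambda>x. pd v f x - pd v g x)"
  using pd_add[OF _ polyfun_minus, of V f W g v] by (simp add: pd_minus)

lemma pd_sum:
  "(\<And>i. i \<in> S \<Longrightarrow> polyfun V (f i)) \<Longrightarrow> pd v (\<lambda>x. \<Sum>i\<in>S. f i x) = (\<lambda>x. \<Sum>i\<in>S. pd v (f i) x)"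
proof (induction S rule: infinite_finite_induct)
  case (insert i S)
  then have *: "polyfun V (f i)" "polyfun V (\<lambda>x. \<Sum>i\<in>S. f i x)" by (auto intro: polyfun_sum)
  with insert show ?case by (simp add: pd_add[OF *])
qed auto

lemma pd_prod:
  assumes "finite S" "\<And>i. i \<in> S \<Longrightarrow> polyfun V (f i)"
  shows "pd v (\<lambda>x. \<Prod>i\<in>S. f i x) = (\<lambda>x. \<Sum>i\<in>S. pd v (f i) x * (\<Prod>j\<in>S - {i}. f j x))"
  using assms
proof (induction S rule: finite_induct)
  case (insert i S)
  then have *: "polyfun V (f i)" "polyfun V (\<lambda>x. \<Prod>i\<in>S. f i x)" by (auto intro: polyfun_prod)
  have "(\<Sum>k\<in>S. pd v (f k) x * (\<Prod>j\<in>insert i S - {k}. f j x))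
     = f i x * (\<Sum>k\<in>S. pd v (f k) x * (\<Prod>j\<in>S - {k}. f j x))" for x
    unfolding sum_distrib_left
  proof (rule sum.cong[OF refl])
    fix k assume k: "k \<in> S"
    then have "insert i S - {k} = insert i (S - {k})" using insert(2) by auto
    then show "pd v (f k) x * (\<Prod>j\<in>insert i S - {k}. f j x) = f i x * (pd v (f k) x * (\<Prod>j\<in>S - {k}. f j x))"
      using insert(1,2) by simp
  qed
  with insert * show ?case by (simp add: pd_mult[OF *] algebra_simps)
qed auto

lemma polyfun_pd: "polyfun V f \<Longrightarrow> polyfun V (pd v f)"
proof (induction rule: polyfun.induct)
  case (var w)
  then show ?case by (simp add: pd_var polyfun.const)
qed (auto simp: pd_add pd_mult intro: polyfun.intros)

lemma pd_notin: "polyfun V f \<Longrightarrow> v \<notin> V \<Longrightarrow> pd v f = (\<lambda>x. 0)"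
proof (induction rule: polyfun.induct)
  case (var w)
  then show ?case by (auto simp: pd_var)
qed (auto simp: pd_add pd_mult)

text \<open>Induction on the construction of the polynomial takes the place of the analytic theorem
  on mixed derivatives.\<close>

lemma pd_commute: "polyfun V f \<Longrightarrow> pd v (pd w f) = pd w (pd v f)"
proof (induction rule: polyfun.induct)
  case (var u)
  then show ?case by (auto simp: pd_var)
next
  case (add f g)
  note p = polyfun_pd[OF add(1)] polyfun_pd[OF add(2)]
  show ?case using add(3,4) by (simp add: pd_add[OF add(1,2)] pd_add[OF p])
next
  case (mult f g)
  note p = mult(1,2) polyfun_pd[OF mult(1)] polyfun_pd[OF mult(2)]
  have q: "polyfun V (\<lambda>x. pd v f x * g x)" "polyfun V (\<lambda>x. f x * pd v g x)"
    "polyfun V (\<lambda>x. pd w f x * g x)" "polyfun V (\<lambda>x. f x * pd w g x)"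
    using p by (auto intro: polyfun.mult)
  show ?case using mult(3,4)
    by (simp add: pd_mult[OF p(1,2)] pd_add[OF q(1,2)] pd_add[OF q(3,4)]
        pd_mult[OF p(3) p(2)] pd_mult[OF p(1) p(4)] pd_mult[OF polyfun_pd[OF mult(1)] p(2)]
        pd_mult[OF p(1) polyfun_pd[OF mult(2)]]) (simp add: algebra_simps)
qed auto

lemma polyfun_chain:
  assumes "polyfun V f" "finite V"
    and "\<And>v. v \<in> V \<Longrightarrow> ((\<lambda>t. g t v) has_field_derivative g' v) (at s)"
  shows "((\<lambda>t. f (g t)) has_field_derivative (\<Sum>v\<in>V. pd v f (g s) * g' v)) (at s)"
  using assms(1)
proof (induction rule: polyfun.induct)
  case (var w)
  have "(\<Sum>v\<in>V. pd v (\<lambda>x. x w) (g s) * g' v) = (\<Sum>v\<in>V. if v = w then g' v else 0)"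
    by (intro sum.cong) (auto simp: pd_var)
  also have "\<dots> = g' w" using var assms(2) by simp
  finally show ?case using assms(3)[OF var] by simp
next
  case (add p q)
  then show ?case using DERIV_add[OF add(3,4)] by (simp add: pd_add sum.distrib algebra_simps)
next
  case (mult p q)
  then show ?case using DERIV_mult[OF mult(3,4)]
    by (simp add: pd_mult sum.distrib algebra_simps sum_distrib_left sum_distrib_right)
qed auto

lemma pd_chain:
  assumes "polyfun V f" "finite V" "\<And>v. v \<in> V \<Longrightarrow> polyfun W (h v)"
  shows "pd w (\<lambda>y. f (\<lambda>v. h v y)) = (\<lambda>y. \<Sum>v\<in>V. pd v f (\<lambda>v. h v y) * pd w (h v) y)"
proof (rule ext, rule pd_eqI)
  fix y
  show "((\<lambda>t. f (\<lambda>v. h v (y(w := t)))) has_field_derivative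
      (\<Sum>v\<in>V. pd v f (\<lambda>v. h v y) * pd w (h v) y)) (at (y w))"
    using polyfun_chain[OF assms(1,2), of "\<lambda>t v. h v (y(w := t))" "\<lambda>v. pd w (h v) y" "y w"]
      has_pd[OF assms(3)] by simp
qed

lemma polyfun_slice_const:
  assumes f: "polyfun V f" and z: "\<And>x. pd t f x = 0"
  shows "f (x(t := a)) = f (x(t := b))"
proof -
  have "\<exists>c. \<forall>s\<in>UNIV. f (x(t := s)) = c"
    using has_pd_at[OF f, of x t] z
    by (intro has_field_derivative_zero_constant) auto
  then show ?thesis by auto
qed

subsection \<open>Uniqueness for the heat equation\<close>

text \<open>Total degree below n, expressed as vanishing of all derivatives of order n, which is the
  form that an induction through a differential equation can use.\<close>

primrec deglt :: "'v set \<Rightarrow> nat \<Rightarrow> (('v \<Rightarrow> complex) \<Rightarrow> complex) \<Rightarrow> bool" where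
  "deglt V 0 f \<longleftrightarrow> (\<forall>x. f x = 0)"
| "deglt V (Suc n) f \<longleftrightarrow> polyfun V f \<and> (\<forall>v. deglt V n (pd v f))"

lemma deglt_zero: "deglt V n (\<lambda>x. 0)"
  by (induction n) (auto intro: polyfun.const)

lemma deglt_polyfun: "deglt V n f \<Longrightarrow> polyfun V f"
proof (cases n)
  case 0
  moreover assume "deglt V n f"
  ultimately have "f = (\<lambda>x. 0)" by auto
  then show ?thesis by (simp add: polyfun.const)
qed simp

lemma deglt_Suc: "deglt V n f \<Longrightarrow> deglt V (Suc n) f"
proof (induction n arbitrary: f)
  case 0
  then have "f = (\<lambda>x. 0)" by auto
  then show ?case using deglt_zero[of V "Suc 0"] by simp
next
  case (Suc n)
  then show ?case by (metis deglt.simps(2))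
qed

lemma deglt_mono: "deglt V m f \<Longrightarrow> m \<le> n \<Longrightarrow> deglt V n f"
  by (induction n) (auto simp: le_Suc_eq intro: deglt_Suc simp del: deglt.simps)

lemma deglt_add: "deglt V n f \<Longrightarrow> deglt V n g \<Longrightarrow> deglt V n (\<lambda>x. f x + g x)"
  by (induction n arbitrary: f g) (auto simp: pd_add intro: polyfun.add)

lemma deglt_mult: "deglt V m f \<Longrightarrow> deglt V n g \<Longrightarrow> deglt V (m + n) (\<lambda>x. f x * g x)"
proof (induction "m + n" arbitrary: m n f g)
  case 0
  then show ?case by auto
next
  case (Suc k)
  consider "m = 0" | "n = 0" | m' n' where "m = Suc m'" "n = Suc n'" by (cases m; cases n) auto
  then show ?case
  proof cases
    case 1
    then have "(\<lambda>x. f x * g x) = (\<lambda>x. 0)" using Suc by auto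
    then show ?thesis using deglt_zero[of V "m + n"] by simp
  next
    case 2
    then have "(\<lambda>x. f x * g x) = (\<lambda>x. 0)" using Suc by auto
    then show ?thesis using deglt_zero[of V "m + n"] by simp
  next
    case 3
    have pf: "polyfun V f" "polyfun V g" using Suc.prems deglt_polyfun by blast+
    have "deglt V k (\<lambda>x. pd v f x * g x)" "deglt V k (\<lambda>x. f x * pd v g x)" for v
      using Suc.hyps(1)[of m' n "pd v f" g] Suc.hyps(1)[of m n' f "pd v g"] Suc.hyps(2) Suc.prems 3
      by simp_all
    then have "deglt V (Suc k) (\<lambda>x. f x * g x)"
      using pf by (auto simp: pd_mult intro: deglt_add polyfun.mult)
    then show ?thesis using Suc.hyps(2) by simp
  qed
qed

lemma polyfun_deglt: "polyfun V f \<Longrightarrow> \<exists>n. deglt V n f"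
proof (induction rule: polyfun.induct)
  case (const c)
  show ?case by (rule exI[of _ 1]) (auto intro: polyfun.const)
next
  case (var v)
  show ?case by (rule exI[of _ 2]) (auto simp: numeral_2_eq_2 pd_var intro: polyfun.intros var)
next
  case (add f g)
  then obtain m n where "deglt V m f" "deglt V n g" by blast
  then have "deglt V (max m n) f" "deglt V (max m n) g" by (auto intro: deglt_mono)
  then show ?case using deglt_add by blast
next
  case (mult f g)
  then show ?case using deglt_mult by blast
qed

text \<open>Induction on the degree. The coefficients \<rho> depend on time only, so every spatial
  derivative of f solves the same equation with zero data and vanishes by induction. Then the
  right-hand side is 0, f is constant in time, and it is 0 at time s. The argument makes no
  difference between past and future.\<close>

lemma heat_unique:
  assumes "polyfun V f" "finite Z" "t \<notin> Z"
    and rho: "\<And>v. v \<in> Z \<Longrightarrow> polyfun {t} (\<rho> v)"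
    and "pd t f = (\<lambda>x. \<Sum>v\<in>Z. \<rho> v x * pd v (pd v f) x)"
    and "\<And>x. x t = s \<Longrightarrow> f x = 0"
    and V: "V \<subseteq> insert t Z"
  shows "f x = 0"
proof -
  obtain n where "deglt V n f" using polyfun_deglt assms(1) by blast
  then show ?thesis using assms(5,6)
  proof (induction n arbitrary: f x)
    case (Suc n)
    have pf: "polyfun V f" using Suc.prems(1) by simp
    have dz: "pd w f x = 0" if w: "w \<in> Z" for w x
    proof (rule Suc.IH[of "pd w f"])
      show "deglt V n (pd w f)" using Suc.prems(1) by simp
      have "pd t (pd w f) = pd w (pd t f)" using pf by (rule pd_commute)
      also have "\<dots> = (\<lambda>x. \<Sum>v\<in>Z. pd w (\<lambda>x. \<rho> v x * pd v (pd v f) x) x)"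
        unfolding Suc.prems(2)
        by (rule pd_sum[where V = "insert t V"])
          (auto intro!: polyfun.mult polyfun_pd intro: polyfun_mono[OF rho] polyfun_mono[OF pf])
      also have "\<dots> = (\<lambda>x. \<Sum>v\<in>Z. \<rho> v x * pd v (pd v (pd w f)) x)"
      proof (intro ext sum.cong refl)
        fix x v assume v: "v \<in> Z"
        have "w \<noteq> t" using w assms(3) by auto
        then have "pd w (\<rho> v) = (\<lambda>x. 0)" using pd_notin[OF rho[OF v]] by simp
        moreover have "pd w (pd v (pd v f)) = pd v (pd v (pd w f))"
          using pd_commute[OF pf] pd_commute[OF polyfun_pd[OF pf]] by metis
        ultimately show "pd w (\<lambda>x. \<rho> v x * pd v (pd v f) x) x = \<rho> v x * pd v (pd v (pd w f)) x"
          using pd_mult[OF rho[OF v] polyfun_pd[OF polyfun_pd[OF pf]]] by simp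
      qed
      finally show "pd t (pd w f) = (\<lambda>x. \<Sum>v\<in>Z. \<rho> v x * pd v (pd v (pd w f)) x)" .
      fix y assume y: "y t = s"
      \<comment> \<open>The hyperplane where the time equals s is invariant under changes of the
        spatial coordinate w, so the zero data can be differentiated.\<close>
      have "w \<noteq> t" using w assms(3) by auto
      then have "f (y(w := r)) = 0" for r using Suc.prems(3) y by simp
      then have "pd w f y = 0" by (intro pd_eqI) simp
      then show "pd w f y = 0" .
    qed
    have "pd w (pd w f) x = 0" if "w \<in> Z" for w x
    proof -
      have "pd w f = (\<lambda>x. 0)" using dz[OF that] by auto
      then show ?thesis by simp
    qed
    then have "pd t f x = 0" for x using Suc.prems(2) by simp
    from polyfun_slice_const[OF pf this, of x "x t" s] Suc.prems(3)[of "x(t := s)"]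
    show ?case by simp
  qed simp
qed

subsection \<open>Polynomials with parameters under a linear functional\<close>

text \<open>The tensor product of polynomials in the random variables e and in the parameters p. An
  expectation over e acts on the first factor only, so polynomial dependence on p and
  differentiation in p reduce to linearity.\<close>

inductive sep :: "'v set \<Rightarrow> 'w set \<Rightarrow> (('v \<Rightarrow> complex) \<Rightarrow> ('w \<Rightarrow> complex) \<Rightarrow> complex) \<Rightarrow> bool" for V W where
  tensor: "polyfun V a \<Longrightarrow> polyfun W b \<Longrightarrow> sep V W (\<lambda>e p. a e * b p)"
| add: "sep V W f \<Longrightarrow> sep V W g \<Longrightarrow> sep V W (\<lambda>e p. f e p + g e p)"

lemma sep_left: "polyfun V a \<Longrightarrow> sep V W (\<lambda>e p. a e)"
  using sep.tensor[OF _ polyfun.const[of _ 1]] by fastforce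

lemma sep_right: "polyfun W b \<Longrightarrow> sep V W (\<lambda>e p. b p)"
  using sep.tensor[OF polyfun.const[of _ 1]] by fastforce

lemma sep_mult: "sep V W f \<Longrightarrow> sep V W g \<Longrightarrow> sep V W (\<lambda>e p. f e p * g e p)"
proof (induction rule: sep.induct)
  case (tensor a b)
  from tensor(3,1,2) show ?case
  proof (induction rule: sep.induct)
    case (tensor a' b')
    then have "sep V W (\<lambda>e p. (a e * a' e) * (b p * b' p))"
      by (intro sep.tensor polyfun.mult)
    then show ?case by (simp add: algebra_simps)
  next
    case (add f g)
    then have "sep V W (\<lambda>e p. a e * b p * f e p + a e * b p * g e p)" by (intro sep.add) auto
    then show ?case by (simp add: algebra_simps)
  qed
next
  case (add f g')
  then have "sep V W (\<lambda>e p. f e p * g e p + g' e p * g e p)" by (intro sep.add) auto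
  then show ?case by (simp add: algebra_simps)
qed

lemma sep_const: "sep V W (\<lambda>e p. c)"
  by (intro sep_left polyfun.const)

lemma sep_cmult: "sep V W f \<Longrightarrow> sep V W (\<lambda>e p. c * f e p)"
  by (intro sep_mult sep_const)

lemma sep_diff: "sep V W f \<Longrightarrow> sep V W g \<Longrightarrow> sep V W (\<lambda>e p. f e p - g e p)"
  using sep.add[OF _ sep_cmult[of V W g "-1"], of f] by simp

lemma sep_sum: "(\<And>i. i \<in> S \<Longrightarrow> sep V W (f i)) \<Longrightarrow> sep V W (\<lambda>e p. \<Sum>i\<in>S. f i e p)"
  by (induction S rule: infinite_finite_induct) (auto intro: sep.add sep_const)

lemma sep_prod: "(\<And>i. i \<in> S \<Longrightarrow> sep V W (f i)) \<Longrightarrow> sep V W (\<lambda>e p. \<Prod>i\<in>S. f i e p)"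
  by (induction S rule: infinite_finite_induct) (auto intro: sep_mult sep_const)

lemma sep_imp_polyfun_left: "sep V W f \<Longrightarrow> polyfun V (\<lambda>e. f e p)"
  by (induction rule: sep.induct) (auto intro: polyfun.intros)

lemma sep_imp_polyfun_right: "sep V W f \<Longrightarrow> polyfun W (f e)"
  by (induction rule: sep.induct) (auto intro: polyfun.intros)

lemma sep_pd: "sep V W f \<Longrightarrow> sep V W (\<lambda>e p. pd w (f e) p)"
proof (induction rule: sep.induct)
  case (tensor a b)
  then show ?case by (auto simp: pd_cmult intro: sep.tensor polyfun_pd)
next
  case (add f g)
  then show ?case by (auto simp: pd_add[OF sep_imp_polyfun_right sep_imp_polyfun_right] intro: sep.add)
qed

text \<open>Linearity is required on polynomials alone, because that is where the Gaussian integrals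
  are known to converge.\<close>

locale linear_functional =
  fixes V :: "'v set" and \<Lambda> :: "(('v \<Rightarrow> complex) \<Rightarrow> complex) \<Rightarrow> complex"
  assumes add: "polyfun V f \<Longrightarrow> polyfun V g \<Longrightarrow> \<Lambda> (\<lambda>e. f e + g e) = \<Lambda> f + \<Lambda> g"
    and cmult: "polyfun V f \<Longrightarrow> \<Lambda> (\<lambda>e. c * f e) = c * \<Lambda> f"
begin

lemma zero: "\<Lambda> (\<lambda>e. 0) = 0"
  using cmult[OF polyfun.const, of 0 0] by simp

lemma diff: "polyfun V f \<Longrightarrow> polyfun V g \<Longrightarrow> \<Lambda> (\<lambda>e. f e - g e) = \<Lambda> f - \<Lambda> g"
  using add[of f "\<lambda>e. -1 * g e"] cmult[of g "-1"] polyfun_minus[of V g] by simp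

lemma sum: "(\<And>i. i \<in> S \<Longrightarrow> polyfun V (f i)) \<Longrightarrow> \<Lambda> (\<lambda>e. \<Sum>i\<in>S. f i e) = (\<Sum>i\<in>S. \<Lambda> (f i))"
  by (induction S rule: infinite_finite_induct) (auto simp: zero add polyfun_sum)

lemma polyfun_param: "sep V W f \<Longrightarrow> polyfun W (\<lambda>p. \<Lambda> (\<lambda>e. f e p))"
proof (induction rule: sep.induct)
  case (tensor a b)
  have "\<Lambda> (\<lambda>e. a e * b p) = b p * \<Lambda> a" for p
    using cmult[OF tensor(1), of "b p"] by (simp add: mult.commute)
  then show ?case using tensor by (auto intro: polyfun.intros)
next
  case (add f g)
  then show ?case
    by (simp add: linear_functional.add[OF linear_functional_axioms sep_imp_polyfun_left sep_imp_polyfun_left]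
        polyfun.add)
qed

text \<open>Differentiation under the expectation without any domination argument: on a tensor the
  factor depending on p moves out of the functional.\<close>

lemma pd_param: "sep V W f \<Longrightarrow> pd w (\<lambda>p. \<Lambda> (\<lambda>e. f e p)) = (\<lambda>p. \<Lambda> (\<lambda>e. pd w (f e) p))"
proof (induction rule: sep.induct)
  case (tensor a b)
  have "\<Lambda> (\<lambda>e. a e * c) = c * \<Lambda> a" for c
    using cmult[OF tensor(1), of c] by (simp add: mult.commute)
  then show ?case using tensor
    by (simp add: pd_cmult pd_mult[OF _ polyfun.const])
next
  case (add f g)
  note L = linear_functional.add[OF linear_functional_axioms]
  have "pd w (\<lambda>p. \<Lambda> (\<lambda>e. f e p + g e p)) = pd w (\<lambda>p. \<Lambda> (\<lambda>e. f e p) + \<Lambda> (\<lambda>e. g e p))"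
    by (simp add: L[OF sep_imp_polyfun_left[OF add(1)] sep_imp_polyfun_left[OF add(2)]])
  also have "\<dots> = (\<lambda>p. \<Lambda> (\<lambda>e. pd w (f e) p) + \<Lambda> (\<lambda>e. pd w (g e) p))"
    using add by (simp add: pd_add[OF polyfun_param polyfun_param])
  also have "\<dots> = (\<lambda>p. \<Lambda> (\<lambda>e. pd w (\<lambda>p. f e p + g e p) p))"
    using add by (simp add: pd_add[OF sep_imp_polyfun_right sep_imp_polyfun_right]
        L[OF sep_imp_polyfun_left[OF sep_pd] sep_imp_polyfun_left[OF sep_pd]])
  finally show ?case .
qed

end

subsection \<open>Gaussian integration by parts\<close>

definition gauss_moment :: "real \<Rightarrow> nat \<Rightarrow> real" where
  "gauss_moment \<sigma> m = (if even m then fact m / ((2 / \<sigma>\<^sup>2) ^ (m div 2) * fact (m div 2)) else 0)"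

lemma gauss_moment:
  assumes "0 < \<sigma>"
  shows "has_bochner_integral lborel (\<lambda>x. normal_density 0 \<sigma> x * x ^ m) (gauss_moment \<sigma> m)"
proof (cases "even m")
  case True
  then obtain j where "m = 2 * j" by auto
  then show ?thesis using normal_moment_even[OF assms, of 0 j] by (simp add: gauss_moment_def)
next
  case False
  then obtain j where "m = 2 * j + 1" using oddE by blast
  then show ?thesis using normal_moment_odd[OF assms, of 0 j] by (simp add: gauss_moment_def)
qed

text \<open>Integration by parts for a single monomial. For m = 0 the truncated index
  \<open>m - 1\<close> is harmless because of the factor m.\<close>

lemma gauss_moment_Suc:
  assumes "0 < \<sigma>"
  shows "gauss_moment \<sigma> (Suc m) = of_nat m * \<sigma>\<^sup>2 * gauss_moment \<sigma> (m - 1)"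
proof (cases "even m")
  case True
  then show ?thesis by (cases m) (auto simp: gauss_moment_def)
next
  case False
  then obtain j where m: "m = 2 * j + 1" using oddE by blast
  have f: "(fact (Suc (Suc (2 * j))) :: real) = (2 * real j + 2) * (2 * real j + 1) * fact (2 * j)"
    by (simp add: algebra_simps)
  have "gauss_moment \<sigma> (Suc m) = fact (Suc (Suc (2 * j))) / ((2 / \<sigma>\<^sup>2) ^ Suc j * fact (Suc j))"
    by (simp add: gauss_moment_def m)
  also have "\<dots> = (2 * real j + 1) * \<sigma>\<^sup>2 * (fact (2 * j) / ((2 / \<sigma>\<^sup>2) ^ j * fact j))"
  proof -
    define A where "A = (2 / \<sigma>\<^sup>2) ^ j"
    have "A \<noteq> 0" using assms by (simp add: A_def)
    then show ?thesis using assms unfolding f power_Suc A_def[symmetric] fact_Suc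
      by (simp add: divide_simps)
  qed
  also have "\<dots> = of_nat m * \<sigma>\<^sup>2 * gauss_moment \<sigma> (m - 1)"
    by (simp add: gauss_moment_def m)
  finally show ?thesis .
qed

text \<open>The variables are real but f takes complex arguments, so that the complex derivatives
  \<open>pd\<close> apply to f.\<close>

definition gauss_exp :: "real \<Rightarrow> 'i set \<Rightarrow> (('i \<Rightarrow> complex) \<Rightarrow> complex) \<Rightarrow> complex" where
  "gauss_exp \<sigma> I f = (\<integral>x. (\<Prod>i\<in>I. normal_density 0 \<sigma> (x i)) *\<^sub>R f (\<lambda>i. complex_of_real (x i))
     \<partial>(\<Pi>\<^sub>M i\<in>I. lborel))"

definition gauss_integrable :: "real \<Rightarrow> 'i set \<Rightarrow> (('i \<Rightarrow> complex) \<Rightarrow> complex) \<Rightarrow> bool" where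
  "gauss_integrable \<sigma> I f \<longleftrightarrow> integrable (\<Pi>\<^sub>M i\<in>I. lborel)
     (\<lambda>x. (\<Prod>i\<in>I. normal_density 0 \<sigma> (x i)) *\<^sub>R f (\<lambda>i. complex_of_real (x i)))"

lemma gauss_prod:
  assumes "finite I" "0 < \<sigma>"
  shows "gauss_integrable \<sigma> I (\<lambda>x. \<Prod>i\<in>I. x i ^ m i)"
    and "gauss_exp \<sigma> I (\<lambda>x. \<Prod>i\<in>I. x i ^ m i) = (\<Prod>i\<in>I. complex_of_real (gauss_moment \<sigma> (m i)))"
proof -
  interpret product_sigma_finite "\<lambda>i::'i. lborel :: real measure" by standard
  define h where "h i x = complex_of_real (normal_density 0 \<sigma> x * x ^ m i)" for i x
  have 1: "has_bochner_integral lborel (h i) (complex_of_real (gauss_moment \<sigma> (m i)))" for i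
    unfolding h_def
    using has_bochner_integral_bounded_linear[OF bounded_linear_of_real gauss_moment[OF assms(2), of "m i"]] .
  have eq: "(\<Prod>i\<in>I. normal_density 0 \<sigma> (x i)) *\<^sub>R (\<Prod>i\<in>I. complex_of_real (x i) ^ m i) = (\<Prod>i\<in>I. h i (x i))" for x
    by (simp add: h_def prod.distrib scaleR_conv_of_real)
  show "gauss_integrable \<sigma> I (\<lambda>x. \<Prod>i\<in>I. x i ^ m i)"
    unfolding gauss_integrable_def eq
    using 1 by (intro product_integrable_prod assms) (auto simp: has_bochner_integral_iff)
  show "gauss_exp \<sigma> I (\<lambda>x. \<Prod>i\<in>I. x i ^ m i) = (\<Prod>i\<in>I. complex_of_real (gauss_moment \<sigma> (m i)))"
    unfolding gauss_exp_def eq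
    using 1 by (subst product_integral_prod[OF assms(1)]) (auto simp: has_bochner_integral_iff)
qed

lemma gauss_exp_add:
  "gauss_integrable \<sigma> I f \<Longrightarrow> gauss_integrable \<sigma> I g \<Longrightarrow>
    gauss_exp \<sigma> I (\<lambda>x. f x + g x) = gauss_exp \<sigma> I f + gauss_exp \<sigma> I g"
  by (simp add: gauss_exp_def gauss_integrable_def scaleR_add_right)

lemma gauss_integrable_add:
  "gauss_integrable \<sigma> I f \<Longrightarrow> gauss_integrable \<sigma> I g \<Longrightarrow> gauss_integrable \<sigma> I (\<lambda>x. f x + g x)"
  by (simp add: gauss_integrable_def scaleR_add_right)

lemma gauss_exp_cmult: "gauss_exp \<sigma> I (\<lambda>x. c * f x) = c * gauss_exp \<sigma> I f"
  by (simp add: gauss_exp_def mult_scaleR_right[symmetric] del: mult_scaleR_right)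

lemma gauss_integrable_cmult: "gauss_integrable \<sigma> I f \<Longrightarrow> gauss_integrable \<sigma> I (\<lambda>x. c * f x)"
  by (simp add: gauss_integrable_def mult_scaleR_right[symmetric] del: mult_scaleR_right)

section \<open>Reduction of linear statements to monomials\<close>

text \<open>Monomials are lists of variables, so multiplication is concatenation; the exponents are
  recovered afterwards by counting occurrences.\<close>

inductive monomial_sum :: "'v set \<Rightarrow> (('v \<Rightarrow> 'a::comm_ring_1) \<Rightarrow> 'a) \<Rightarrow> bool" for V where
  mono: "set vs \<subseteq> V \<Longrightarrow> monomial_sum V (\<lambda>x. c * prod_list (map x vs))"
| add: "monomial_sum V f \<Longrightarrow> monomial_sum V g \<Longrightarrow> monomial_sum V (\<lambda>x. f x + g x)"

lemma monomial_sum_mult: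
  "monomial_sum V f \<Longrightarrow> monomial_sum V g \<Longrightarrow> monomial_sum V (\<lambda>x. f x * g x)"
proof (induction rule: monomial_sum.induct)
  case (mono vs c)
  from mono(2,1) show ?case
  proof (induction rule: monomial_sum.induct)
    case (mono ws d)
    then have "monomial_sum V (\<lambda>x. (c * d) * prod_list (map x (vs @ ws)))"
      by (intro monomial_sum.mono) auto
    then show ?case by (simp add: algebra_simps)
  next
    case (add f g)
    then have "monomial_sum V (\<lambda>x. c * prod_list (map x vs) * f x + c * prod_list (map x vs) * g x)"
      by (intro monomial_sum.add)
    then show ?case by (simp add: algebra_simps)
  qed
next
  case (add f g')
  then have "monomial_sum V (\<lambda>x. f x * g x + g' x * g x)" by (intro monomial_sum.add)
  then show ?case by (simp add: algebra_simps)
qed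

lemma polyfun_imp_monomial_sum: "polyfun V f \<Longrightarrow> monomial_sum V f"
proof (induction rule: polyfun.induct)
  case (const c)
  show ?case using monomial_sum.mono[of "[]" V c] by simp
next
  case (var v)
  then show ?case using monomial_sum.mono[of "[v]" V 1] by simp
qed (auto intro: monomial_sum.add monomial_sum_mult)

lemma monomial_sum_imp_polyfun: "monomial_sum V f \<Longrightarrow> polyfun V f"
proof (induction rule: monomial_sum.induct)
  case (mono vs c)
  then have "polyfun V (\<lambda>x. prod_list (map x vs))"
    by (induction vs) (auto intro: polyfun.intros)
  then show ?case by (rule polyfun_cmult)
qed (auto intro: polyfun.intros)

lemma prod_list_map_count:
  "finite V \<Longrightarrow> set vs \<subseteq> V \<Longrightarrow> prod_list (map x vs) = (\<Prod>v\<in>V. x v ^ count_list vs v)"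
proof (induction vs)
  case (Cons a vs)
  have "(\<Prod>v\<in>V. x v ^ count_list (a # vs) v) = (\<Prod>v\<in>V. (if v = a then x v else 1) * x v ^ count_list vs v)"
    by (intro prod.cong) auto
  also have "\<dots> = x a * (\<Prod>v\<in>V. x v ^ count_list vs v)"
    using Cons.prems by (simp add: prod.distrib)
  finally show ?case using Cons by simp
qed simp

text \<open>The defining induction of \<open>polyfun\<close> has a product case, which an
  expectation does not respect. On monomials it factors over the coordinates instead.\<close>

lemma polyfun_induct_monomial [consumes 2, case_names mono add]:
  assumes "polyfun V f" "finite V"
    and m: "\<And>c m. P (\<lambda>x. c * (\<Prod>v\<in>V. x v ^ m v))"
    and a: "\<And>f g. polyfun V f \<Longrightarrow> polyfun V g \<Longrightarrow> P f \<Longrightarrow> P g \<Longrightarrow> P (\<lambda>x. f x + g x)"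
  shows "P f"
  using polyfun_imp_monomial_sum[OF assms(1)]
proof (induction rule: monomial_sum.induct)
  case (mono vs c)
  have "(\<lambda>x. c * prod_list (map x vs)) = (\<lambda>x. c * (\<Prod>v\<in>V. x v ^ count_list vs v))"
    by (simp add: prod_list_map_count[OF assms(2) mono])
  then show ?case using m by simp
qed (auto intro: a monomial_sum_imp_polyfun)

lemma polyfun_gauss_integrable:
  assumes "polyfun I f" "finite I" "0 < \<sigma>"
  shows "gauss_integrable \<sigma> I f"
  using assms(1,2)
  by (induction rule: polyfun_induct_monomial)
    (use assms in \<open>auto intro: gauss_integrable_cmult gauss_prod gauss_integrable_add\<close>)

lemma gauss_linear_functional: "finite I \<Longrightarrow> 0 < \<sigma> \<Longrightarrow> linear_functional I (gauss_exp \<sigma> I)"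
  by unfold_locales (auto simp: gauss_exp_cmult intro: gauss_exp_add polyfun_gauss_integrable)

lemma pd_power: "pd v (\<lambda>x. x w ^ m) = (\<lambda>x. if v = w then of_nat m * x w ^ (m - 1) else 0)"
  by (rule ext, rule pd_eqI) (auto intro!: derivative_eq_intros)

lemma pd_monomial:
  assumes "finite V" "a \<in> V"
  shows "pd a (\<lambda>x. \<Prod>v\<in>V. x v ^ m v) = (\<lambda>x. of_nat (m a) * (\<Prod>v\<in>V. x v ^ (m(a := m a - 1)) v))"
proof
  fix x :: "'a \<Rightarrow> complex"
  have "pd a (\<lambda>x. \<Prod>v\<in>V. x v ^ m v) x
    = (\<Sum>i\<in>V. (if a = i then of_nat (m i) * x i ^ (m i - 1) else 0) * (\<Prod>j\<in>V - {i}. x j ^ m j))"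
    using pd_prod[of V V "\<lambda>v x. x v ^ m v" a] assms by (simp add: polyfun_power polyfun.var pd_power)
  also have "\<dots> = (\<Sum>i\<in>V. if a = i then of_nat (m i) * x i ^ (m i - 1) * (\<Prod>j\<in>V - {i}. x j ^ m j) else 0)"
    by (intro sum.cong) auto
  also have "\<dots> = of_nat (m a) * (x a ^ (m a - 1) * (\<Prod>j\<in>V - {a}. x j ^ m j))"
    using assms by simp
  also have "x a ^ (m a - 1) * (\<Prod>j\<in>V - {a}. x j ^ m j) = (\<Prod>v\<in>V. x v ^ (m(a := m a - 1)) v)"
    using assms by (subst prod.remove[of V a]) (auto intro!: prod.cong)
  finally show "pd a (\<lambda>x. \<Prod>v\<in>V. x v ^ m v) x = of_nat (m a) * (\<Prod>v\<in>V. x v ^ (m(a := m a - 1)) v)" .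
qed

text \<open>Both sides are linear in f. On a monomial the expectation factors, and the claim is the
  moment recurrence in coordinate a.\<close>

lemma gauss_stein:
  assumes "polyfun I f" "finite I" "0 < \<sigma>" "a \<in> I"
  shows "gauss_exp \<sigma> I (\<lambda>x. x a * f x) = complex_of_real (\<sigma>\<^sup>2) * gauss_exp \<sigma> I (pd a f)"
  using assms(1,2)
proof (induction rule: polyfun_induct_monomial)
  case (mono c m)
  have "(\<Prod>v\<in>I. x v ^ (m(a := Suc (m a))) v) = x a * (\<Prod>v\<in>I. x v ^ m v)" for x :: "'a \<Rightarrow> complex"
    using assms by (simp add: prod.remove[of I a])
  then have eq: "(\<lambda>x. x a * (c * (\<Prod>v\<in>I. x v ^ m v))) = (\<lambda>x. c * (\<Prod>v\<in>I. x v ^ (m(a := Suc (m a))) v))"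
    by (simp add: algebra_simps)
  have "gauss_exp \<sigma> I (\<lambda>x. x a * (c * (\<Prod>v\<in>I. x v ^ m v)))
    = c * (complex_of_real (gauss_moment \<sigma> (Suc (m a))) * (\<Prod>v\<in>I - {a}. complex_of_real (gauss_moment \<sigma> (m v))))"
    unfolding eq gauss_exp_cmult gauss_prod(2)[OF assms(2,3)] using assms
    by (simp add: prod.remove[of I a])
  also have "\<dots> = complex_of_real (\<sigma>\<^sup>2) * (c * (of_nat (m a) * (complex_of_real (gauss_moment \<sigma> (m a - 1))
      * (\<Prod>v\<in>I - {a}. complex_of_real (gauss_moment \<sigma> (m v))))))"
    by (simp add: gauss_moment_Suc[OF assms(3)])
  also have "complex_of_real (gauss_moment \<sigma> (m a - 1)) * (\<Prod>v\<in>I - {a}. complex_of_real (gauss_moment \<sigma> (m v)))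
    = gauss_exp \<sigma> I (\<lambda>x. \<Prod>v\<in>I. x v ^ (m(a := m a - 1)) v)"
    unfolding gauss_prod(2)[OF assms(2,3)] using assms by (simp add: prod.remove[of I a])
  also have "c * (of_nat (m a) * gauss_exp \<sigma> I (\<lambda>x. \<Prod>v\<in>I. x v ^ (m(a := m a - 1)) v))
     = gauss_exp \<sigma> I (\<lambda>x. c * (of_nat (m a) * (\<Prod>v\<in>I. x v ^ (m(a := m a - 1)) v)))"
    by (simp only: gauss_exp_cmult)
  also have "(\<lambda>x. c * (of_nat (m a) * (\<Prod>v\<in>I. x v ^ (m(a := m a - 1)) v))) = pd a (\<lambda>x. c * (\<Prod>v\<in>I. x v ^ m v))"
    by (subst pd_cmult[of I]) (auto simp: pd_monomial assms simp del: fun_upd_apply intro!: polyfun_intros)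
  finally show ?case .
next
  case (add f g)
  have i: "gauss_integrable \<sigma> I (\<lambda>x. x a * f x)" "gauss_integrable \<sigma> I (\<lambda>x. x a * g x)"
    "gauss_integrable \<sigma> I (pd a f)" "gauss_integrable \<sigma> I (pd a g)"
    using add(1,2) assms by (auto intro!: polyfun_gauss_integrable polyfun.intros polyfun_pd)
  show ?case using add(3,4)
    by (simp add: pd_add[OF add(1,2)] distrib_left gauss_exp_add[OF i(1,2)] gauss_exp_add[OF i(3,4)])
qed

subsection \<open>Polynomials in the entries of a Ginibre matrix\<close>

text \<open>The entries of a matrix and of its adjoint count as separate variables, distinguished by
  the flag, so that both families of determinants become polynomials.\<close>

definition entries :: "complex^'n^'n \<Rightarrow> 'n \<times> 'n \<times> bool \<Rightarrow> complex" where
  "entries A = (\<lambda>(i, j, b). if b then vec_nth (vec_nth (conj_transpose A) i) j else vec_nth (vec_nth A i) j)"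

text \<open>\<open>axis i (axis j 1)\<close> and \<open>axis i (axis j \<i>)\<close> index the real
  and imaginary part of entry (i, j). Conjugation is written out as a sign, since \<open>cnj\<close>
  is not polynomial in complex y.\<close>

definition entry_of_coords :: "'n \<times> 'n \<times> bool \<Rightarrow> (complex^'n^'n \<Rightarrow> complex) \<Rightarrow> complex" where
  "entry_of_coords = (\<lambda>(i, j, b) y.
     if b then y (axis j (axis i 1)) - \<i> * y (axis j (axis i \<i>))
     else y (axis i (axis j 1)) + \<i> * y (axis i (axis j \<i>)))"

text \<open>The density exp (- |A|^2) gives each real coordinate variance 1/2, hence the standard
  deviation 1 / sqrt 2.\<close>

definition ginibre_exp :: "(('n::finite \<times> 'n \<times> bool \<Rightarrow> complex) \<Rightarrow> complex) \<Rightarrow> complex" where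
  "ginibre_exp f = gauss_exp (1 / sqrt 2) Basis (\<lambda>y. f (\<lambda>v. entry_of_coords v y))"

lemma polyfun_entry_of_coords: "polyfun Basis (entry_of_coords v)"
  by (cases v) (auto simp: entry_of_coords_def Basis_complex_def intro!: polyfun_intros)

lemma polyfun_of_coords: "polyfun UNIV f \<Longrightarrow> polyfun Basis (\<lambda>y. f (\<lambda>v. entry_of_coords v y))"
  by (rule polyfun_compose) (auto intro: polyfun_entry_of_coords)

lemma ginibre_linear_functional: "linear_functional UNIV (ginibre_exp :: (('n::finite \<times> 'n \<times> bool \<Rightarrow> complex) \<Rightarrow> complex) \<Rightarrow> complex)"
proof -
  interpret linear_functional "Basis :: (complex^'n^'n) set" "gauss_exp (1 / sqrt 2) Basis"
    by (rule gauss_linear_functional) auto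
  show ?thesis
    by unfold_locales (simp_all add: ginibre_exp_def add cmult polyfun_of_coords)
qed

lemma entry_of_coords_eq:
  "entry_of_coords v (\<lambda>b. complex_of_real (x b)) = entries (\<Sum>b\<in>Basis. x b *\<^sub>R b) v"
proof -
  define A where "A = (\<Sum>b\<in>Basis. x b *\<^sub>R b)"
  have in_b: "inner A b = x b" if "b \<in> Basis" for b
    unfolding A_def using that by (simp add: inner_sum_left inner_Basis if_distrib cong: if_cong)
  have "Re (vec_nth (vec_nth A i) j) = x (axis i (axis j 1))" for i j
    using in_b[of "axis i (axis j 1)"] by (simp add: inner_axis Basis_complex_def)
  moreover have "Im (vec_nth (vec_nth A i) j) = x (axis i (axis j \<i>))" for i j
    using in_b[of "axis i (axis j \<i>)"] by (simp add: inner_axis Basis_complex_def)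
  ultimately show ?thesis unfolding A_def[symmetric]
    by (cases v) (auto simp: entry_of_coords_def entries_def conj_transpose_def complex_eq_iff)
qed

lemma trace_conj_transpose: "Re (Determinants.trace (A ** conj_transpose A)) = (norm A)\<^sup>2"
proof -
  have "Re (Determinants.trace (A ** conj_transpose A)) = (\<Sum>i\<in>UNIV. \<Sum>j\<in>UNIV. (norm (vec_nth (vec_nth A i) j))\<^sup>2)"
    by (simp add: Determinants.trace_def matrix_matrix_mult_def conj_transpose_def complex_mult_cnj cmod_power2)
  also have "\<dots> = (norm A)\<^sup>2"
    by (simp add: norm_vec_def L2_set_def sum_nonneg)
  finally show ?thesis .
qed

text \<open>The squared norm is the sum of the squared coordinates, and the 2 N^2 normalizing
  factors sqrt pi multiply to pi^(N^2).\<close>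

lemma ginibre_density_coords:
  "ginibre_density (\<Sum>b\<in>Basis. x b *\<^sub>R b :: complex^'n^'n) = (\<Prod>b\<in>Basis. normal_density 0 (1 / sqrt 2) (x b))"
proof -
  define A :: "complex^'n^'n" where "A = (\<Sum>b\<in>Basis. x b *\<^sub>R b)"
  have in_b: "inner A b = x b" if "b \<in> Basis" for b
    unfolding A_def using that by (simp add: inner_sum_left inner_Basis if_distrib cong: if_cong)
  have "(norm A)\<^sup>2 = (\<Sum>b\<in>Basis. (x b)\<^sup>2)"
    unfolding power2_norm_eq_inner euclidean_inner[of A A] by (simp add: in_b power2_eq_square)
  moreover have "normal_density 0 (1 / sqrt 2) t = exp (- t\<^sup>2) / sqrt pi" for t
    by (simp add: normal_density_def power_divide)
  moreover have "sqrt pi ^ (CARD('n) * (CARD('n) * 2)) = pi ^ (CARD('n)\<^sup>2)"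
    by (simp add: power2_eq_square mult.assoc[symmetric] power_mult power_mult[of "sqrt pi" 2, symmetric] mult.commute[of _ 2])
  ultimately show ?thesis
    by (simp add: ginibre_density_def trace_conj_transpose A_def[symmetric] prod_dividef exp_sum[symmetric] sum_negf)
qed

lemma polyfun_entries_measurable:
  "polyfun UNIV f \<Longrightarrow> (\<lambda>A. f (entries A)) \<in> borel_measurable borel"
proof (induction rule: polyfun.induct)
  case (var v)
  obtain i j b where v: "v = (i, j, b)" by (cases v)
  have "continuous_on UNIV (\<lambda>A. entries A v)"
    unfolding v entries_def conj_transpose_def by (cases b) (auto intro!: continuous_intros)
  then show ?case by (rule borel_measurable_continuous_onI)
qed auto

text \<open>The bridge from the probability space to \<open>ginibre_exp\<close>. From here on only
  the linear functional and its integration by parts are used.\<close>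

lemma ginibre_integral:
  fixes G :: "'a \<Rightarrow> complex^'n^'n"
  assumes G: "ginibre_matrix M G" and f: "polyfun UNIV f"
  shows "integrable M (\<lambda>\<omega>. f (entries (G \<omega>)))"
    and "(\<integral>\<omega>. f (entries (G \<omega>)) \<partial>M) = ginibre_exp f"
proof -
  have D: "distributed M lborel G (\<lambda>A. ennreal (ginibre_density A))"
    using G by (simp add: ginibre_matrix_def)
  have d0: "0 \<le> ginibre_density A" for A :: "complex^'n^'n" by (simp add: ginibre_density_def)
  note Gm = distributed_measurable[OF D]
  have dm: "ginibre_density \<in> borel_measurable (lborel :: (complex^'n^'n) measure)"
    using distributed_real_measurable[OF _ D] d0 by simp
  have eq: "distr M lborel G = density lborel (\<lambda>A. ennreal (ginibre_density A))"
    using D by (simp add: distributed_def)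
  define h where "h A = f (entries A)" for A :: "complex^'n^'n"
  have hm: "h \<in> borel_measurable borel"
    unfolding h_def using f by (rule polyfun_entries_measurable)
  let ?P = "\<Pi>\<^sub>M b\<in>(Basis :: (complex^'n^'n) set). (lborel :: real measure)"
  let ?\<Phi> = "\<lambda>x. \<Sum>b\<in>(Basis :: (complex^'n^'n) set). x b *\<^sub>R b"
  have \<Phi>: "?\<Phi> \<in> measurable ?P borel" by measurable
  have gh: "(\<lambda>A. ginibre_density A *\<^sub>R h A) \<in> borel_measurable borel" using dm hm by simp
  have coords: "ginibre_density (?\<Phi> x) *\<^sub>R h (?\<Phi> x) =
     (\<Prod>b\<in>Basis. normal_density 0 (1 / sqrt 2) (x b)) *\<^sub>R f (\<lambda>v. entry_of_coords v (\<lambda>b. complex_of_real (x b)))" for x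
    by (simp add: ginibre_density_coords h_def entry_of_coords_eq)
  have "integrable (lborel :: (complex^'n^'n) measure) (\<lambda>A. ginibre_density A *\<^sub>R h A)"
    by (subst lborel_eq, subst integrable_distr_eq[OF \<Phi> gh], unfold coords)
      (use polyfun_gauss_integrable[OF polyfun_of_coords[OF f], of "1 / sqrt 2"] in \<open>simp add: gauss_integrable_def\<close>)
  then have "integrable (distr M lborel G) h"
    unfolding eq using dm hm d0 by (subst integrable_density) auto
  then show "integrable M (\<lambda>\<omega>. f (entries (G \<omega>)))"
    using integrable_distr_eq[OF Gm, of h] hm by (simp add: h_def)
  have "(\<integral>\<omega>. f (entries (G \<omega>)) \<partial>M) = (\<integral>A. h A \<partial>distr M lborel G)"
    using integral_distr[OF Gm, of h] hm by (simp add: h_def[symmetric])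
  also have "\<dots> = (\<integral>A. ginibre_density A *\<^sub>R h A \<partial>lborel)"
    unfolding eq using dm hm d0 by (subst integral_density) auto
  also have "\<dots> = ginibre_exp f"
    unfolding ginibre_exp_def gauss_exp_def
    by (subst lborel_eq, subst integral_distr[OF \<Phi> gh], unfold coords) simp
  finally show "(\<integral>\<omega>. f (entries (G \<omega>)) \<partial>M) = ginibre_exp f" .
qed

lemma ginibre_const: "ginibre_exp (\<lambda>e :: 'n::finite \<times> 'n \<times> bool \<Rightarrow> complex. c) = c"
proof -
  interpret linear_functional UNIV "ginibre_exp :: (('n \<times> 'n \<times> bool \<Rightarrow> complex) \<Rightarrow> complex) \<Rightarrow> complex"
    by (rule ginibre_linear_functional)
  have "ginibre_exp (\<lambda>e :: 'n \<times> 'n \<times> bool \<Rightarrow> complex. 1) = 1"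
    unfolding ginibre_exp_def
    using gauss_prod(2)[of "Basis :: (complex^'n^'n) set" "1 / sqrt 2" "\<lambda>_. 0"]
    by (simp add: gauss_moment_def)
  then show ?thesis using cmult[OF polyfun.const, of c 1] by simp
qed

text \<open>An entry (i, j) of G has covariance 1 with the entry (j, i) of the adjoint and 0 with
  every other variable, so only one derivative survives. In real coordinates, x + i y produces half
  of twice that derivative.\<close>

lemma ginibre_stein:
  fixes f :: "('n::finite \<times> 'n \<times> bool \<Rightarrow> complex) \<Rightarrow> complex"
  assumes f: "polyfun UNIV f"
  shows "ginibre_exp (\<lambda>e. e (i, j, b) * f e) = ginibre_exp (pd (j, i, \<not> b) f)"
proof -
  define F where "F y = f (\<lambda>v. entry_of_coords v y)" for y
  let ?E = "gauss_exp (1 / sqrt 2) (Basis :: (complex^'n^'n) set)"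
  interpret linear_functional "Basis :: (complex^'n^'n) set" "?E"
    by (rule gauss_linear_functional) auto
  have F: "polyfun Basis F" unfolding F_def by (rule polyfun_of_coords[OF f])
  have pdF: "pd w F y = (\<Sum>v\<in>UNIV. pd v f (\<lambda>v. entry_of_coords v y) * pd w (entry_of_coords v) y)" for w y
    unfolding F_def using pd_chain[OF f _ polyfun_entry_of_coords, of w] by simp
  have pv: "polyfun UNIV (\<lambda>y. y (w :: complex^'n^'n))" for w by (rule polyfun.var) simp
  have pe: "pd w (entry_of_coords (k, l, c)) y =
     (if c then (if w = axis l (axis k 1) then 1 else 0) - \<i> * (if w = axis l (axis k \<i>) then 1 else 0)
      else (if w = axis k (axis l 1) then 1 else 0) + \<i> * (if w = axis k (axis l \<i>) then 1 else 0))"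
    for w :: "complex^'n^'n" and k l c y
    by (cases c) (simp_all add: entry_of_coords_def pd_diff[OF pv polyfun_cmult[OF pv]] pd_add[OF pv polyfun_cmult[OF pv]]
        pd_cmult[OF pv] pd_var)
  have ne: "axis k (axis l (1::complex)) \<noteq> axis k' (axis l' \<i>)" for k l k' l' :: 'n
    by (auto simp: axis_eq_axis complex_eq_iff)
  \<comment> \<open>Pairs entry (k, l) of G with entry (l, k) of the adjoint: these two depend on
    the same real coordinates.\<close>
  have split: "(\<Sum>v\<in>UNIV. h v) = (\<Sum>k\<in>UNIV. \<Sum>l\<in>UNIV. h (k, l, False) + h (l, k, True))" for h :: "'n \<times> 'n \<times> bool \<Rightarrow> complex"
  proof -
    have "(\<Sum>v\<in>UNIV. h v) = (\<Sum>k\<in>UNIV. \<Sum>l\<in>UNIV. \<Sum>c\<in>UNIV. h (k, l, c))"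
      by (simp add: sum.cartesian_product flip: UNIV_Times_UNIV)
    also have "\<dots> = (\<Sum>k\<in>UNIV. \<Sum>l\<in>UNIV. h (k, l, False)) + (\<Sum>k\<in>UNIV. \<Sum>l\<in>UNIV. h (k, l, True))"
      by (simp add: UNIV_bool sum.distrib)
    also have "(\<Sum>k\<in>UNIV. \<Sum>l\<in>UNIV. h (k, l, True)) = (\<Sum>k\<in>UNIV. \<Sum>l\<in>UNIV. h (l, k, True))"
      by (rule sum.swap)
    finally show ?thesis by (simp add: sum.distrib)
  qed
  have delta2: "(\<Sum>p\<in>UNIV. \<Sum>q\<in>UNIV. X p q * (if k = p \<and> l = q then c else 0)) = X k l * c"
    for X :: "'n \<Rightarrow> 'n \<Rightarrow> complex" and k l c
  proof -
    have "(\<Sum>q\<in>UNIV. X p q * (if k = p \<and> l = q then c else 0)) = (if k = p then X p l * c else 0)" for p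
      by (cases "k = p") (simp_all add: if_distrib cong: if_cong)
    then show ?thesis by simp
  qed
  have pe1: "pd (axis k (axis l 1)) (entry_of_coords (p, q, False)) y = (if k = p \<and> l = q then 1 else 0)"
    "pd (axis k (axis l 1)) (entry_of_coords (q, p, True)) y = (if k = p \<and> l = q then 1 else 0)"
    "pd (axis k (axis l \<i>)) (entry_of_coords (p, q, False)) y = (if k = p \<and> l = q then \<i> else 0)"
    "pd (axis k (axis l \<i>)) (entry_of_coords (q, p, True)) y = (if k = p \<and> l = q then - \<i> else 0)"
    for k l p q :: 'n and y
    unfolding pe by (simp_all add: ne ne[symmetric] axis_eq_axis)
  \<comment> \<open>\<open>d1\<close> and \<open>d2\<close> are the Wirtinger relations: the real
    direction gives the sum, the imaginary one \<i> times the difference of the two formal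
    derivatives.\<close>
  have d1: "pd (axis k (axis l 1)) F y =
      pd (k, l, False) f (\<lambda>v. entry_of_coords v y) + pd (l, k, True) f (\<lambda>v. entry_of_coords v y)" for k l y
    unfolding pdF split pe1 sum.distrib delta2 delta2 by simp
  have d2: "pd (axis k (axis l \<i>)) F y =
      \<i> * (pd (k, l, False) f (\<lambda>v. entry_of_coords v y) - pd (l, k, True) f (\<lambda>v. entry_of_coords v y))" for k l y
    unfolding pdF split pe1 sum.distrib delta2 by (simp add: algebra_simps)
  have half: "complex_of_real ((1 / sqrt 2)\<^sup>2) = 1 / 2" by (simp add: power_divide)
  have B: "axis k (axis l 1) \<in> (Basis :: (complex^'n^'n) set)" "axis k (axis l \<i>) \<in> (Basis :: (complex^'n^'n) set)" for k l
    by (auto simp: Basis_complex_def)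
  have st: "?E (\<lambda>y. y w * F y) = 1 / 2 * ?E (pd w F)" if "w \<in> Basis" for w
    using gauss_stein[OF F _ _ that, of "1 / sqrt 2"] half by simp
  have P: "polyfun Basis (\<lambda>y. y w * F y)" if "w \<in> Basis" for w
    using that F by (intro polyfun.intros)
  have Pd: "polyfun Basis (pd w F)" for w using F by (rule polyfun_pd)
  have D: "?E (\<lambda>y. y w * F y + c * (y w' * F y)) = 1 / 2 * ?E (\<lambda>y. pd w F y + c * pd w' F y)"
    if "w \<in> Basis" "w' \<in> Basis" for w w' c
    using that by (simp only: add cmult P Pd polyfun_cmult st) (simp add: algebra_simps)
  have two: "1 / 2 * ?E (\<lambda>y. 2 * g y) = ?E g" for g unfolding gauss_exp_cmult by simp
  have main: "?E (\<lambda>y. entry_of_coords (i, j, b) y * F y) = ?E (\<lambda>y. pd (j, i, \<not> b) f (\<lambda>v. entry_of_coords v y))"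
  proof (cases b)
    case True
    have "?E (\<lambda>y. entry_of_coords (i, j, b) y * F y)
      = ?E (\<lambda>y. y (axis j (axis i 1)) * F y + (- \<i>) * (y (axis j (axis i \<i>)) * F y))"
      using True by (simp add: entry_of_coords_def algebra_simps)
    also have "\<dots> = 1 / 2 * ?E (\<lambda>y. 2 * pd (j, i, False) f (\<lambda>v. entry_of_coords v y))"
      unfolding D[OF B(1) B(2)] d1 d2 by (simp add: algebra_simps)
    finally show ?thesis unfolding two using True by simp
  next
    case False
    have "?E (\<lambda>y. entry_of_coords (i, j, b) y * F y)
      = ?E (\<lambda>y. y (axis i (axis j 1)) * F y + \<i> * (y (axis i (axis j \<i>)) * F y))"
      using False by (simp add: entry_of_coords_def algebra_simps)
    also have "\<dots> = 1 / 2 * ?E (\<lambda>y. 2 * pd (j, i, True) f (\<lambda>v. entry_of_coords v y))"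
      unfolding D[OF B(1) B(2)] d1 d2 by (simp add: algebra_simps)
    finally show ?thesis unfolding two using False by simp
  qed
  then show ?thesis by (simp add: ginibre_exp_def F_def)
qed

subsection \<open>Derivatives of determinants and cofactors\<close>

definition mdet :: "('n::finite \<Rightarrow> 'n \<Rightarrow> complex) \<Rightarrow> complex" where
  "mdet m = (\<Sum>p | p permutes UNIV. of_int (sign p) * (\<Prod>i\<in>UNIV. m i (p i)))"

text \<open>The signed cofactor, that is, the derivative of the determinant in entry (a, b). The sum
  over permutations with p a = b avoids an index type with one element fewer.\<close>

definition cof :: "('n::finite \<Rightarrow> 'n \<Rightarrow> complex) \<Rightarrow> 'n \<Rightarrow> 'n \<Rightarrow> complex" where
  "cof m a b = (\<Sum>p | p permutes UNIV \<and> p a = b. of_int (sign p) * (\<Prod>i\<in>UNIV - {a}. m i (p i)))"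

text \<open>The second derivative in entries (a, b) and (c, d). A determinant is affine in each row,
  hence 0 for a = c; for a \<noteq> c and b = d the sum is empty.\<close>

definition cof2 :: "('n::finite \<Rightarrow> 'n \<Rightarrow> complex) \<Rightarrow> 'n \<Rightarrow> 'n \<Rightarrow> 'n \<Rightarrow> 'n \<Rightarrow> complex" where
  "cof2 m a b c d = (if a = c then 0 else
     (\<Sum>p | p permutes UNIV \<and> p a = b \<and> p c = d. of_int (sign p) * (\<Prod>i\<in>UNIV - {a, c}. m i (p i))))"

lemma mdet_eq: "Determinants.det A = mdet (\<lambda>i j. vec_nth (vec_nth A i) j)"
  by (simp add: mdet_def Determinants.det_def)

lemma sum_over_value:
  fixes f :: "('n::finite \<Rightarrow> 'n) \<Rightarrow> 'a::comm_monoid_add"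
  shows "(\<Sum>b\<in>UNIV. \<Sum>p | P p \<and> p a = b. f p) = (\<Sum>p | P p. f p)"
proof -
  have "(\<Sum>b\<in>UNIV. \<Sum>p | P p \<and> p a = b. f p) = (\<Sum>b\<in>UNIV. \<Sum>p\<in>{p\<in>Collect P. p a = b}. f p)"
    by (intro sum.cong) auto
  also have "\<dots> = (\<Sum>p | P p. f p)"
    by (rule sum.group) auto
  finally show ?thesis .
qed

lemma cof_row: "(\<Sum>b\<in>UNIV. m a b * cof m a b) = mdet m"
proof -
  have "(\<Sum>b\<in>UNIV. m a b * cof m a b) =
     (\<Sum>b\<in>UNIV. \<Sum>p | p permutes UNIV \<and> p a = b. of_int (sign p) * (\<Prod>i\<in>UNIV. m i (p i)))"
    unfolding cof_def sum_distrib_left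
    by (intro sum.cong) (auto simp: prod.remove[of UNIV a])
  then show ?thesis by (simp add: sum_over_value mdet_def)
qed

lemma mdet_identical_rows: "a \<noteq> c \<Longrightarrow> m a = m c \<Longrightarrow> mdet m = 0"
  using Determinants.det_identical_rows[of a c "\<chi> i j. m i j"] by (simp add: mdet_eq Finite_Cartesian_Product.row_def)

text \<open>Row a does not occur in its own cofactors, so it may be replaced by row c; the expansion
  is then that of a determinant with two equal rows.\<close>

lemma cof_row_other:
  assumes "a \<noteq> c"
  shows "(\<Sum>b\<in>UNIV. m c b * cof m a b) = 0"
proof -
  have "cof (m(a := m c)) a b = cof m a b" for b
    unfolding cof_def by (intro sum.cong arg_cong2[of _ _ _ _ "(*)"] prod.cong) auto
  then have "(\<Sum>b\<in>UNIV. m c b * cof m a b) = mdet (m(a := m c))"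
    using cof_row[of "m(a := m c)" a] by simp
  then show ?thesis using assms mdet_identical_rows[of a c "m(a := m c)"] by simp
qed

lemma cof_transpose: "cof (\<lambda>i j. m j i) b a = cof m a b"
proof -
  have "cof m a b = (\<Sum>p | p permutes UNIV \<and> p b = a. of_int (sign p) * (\<Prod>i\<in>UNIV - {b}. m (p i) i))"
    unfolding cof_def
  proof (rule sum.reindex_bij_witness[of _ "inv_into UNIV" "inv_into UNIV"])
    fix p assume p: "p \<in> {p. p permutes UNIV \<and> p a = b}"
    then have P: "p permutes UNIV" by simp
    show "inv_into UNIV (inv_into UNIV p) = p" using P by (rule permutes_inv_inv)
    show "inv_into UNIV p \<in> {p. p permutes UNIV \<and> p b = a}"
      using p permutes_inv[OF P] permutes_inverses(2)[OF P] by auto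
    have "(\<Prod>i\<in>UNIV - {b}. m (inv_into UNIV p i) i) = (\<Prod>i\<in>UNIV - {a}. m i (p i))"
    proof (rule prod.reindex_bij_witness[of _ p "inv_into UNIV p"])
      show "inv_into UNIV p i \<in> UNIV - {a}" if "i \<in> UNIV - {b}" for i
        using p that permutes_inverses(1)[OF P] by auto
      show "p i \<in> UNIV - {b}" if "i \<in> UNIV - {a}" for i
        using p that permutes_inj[OF P] by (auto simp: inj_eq)
    qed (simp_all add: permutes_inverses[OF P])
    then show "of_int (sign (inv_into UNIV p)) * (\<Prod>i\<in>UNIV - {b}. m (inv_into UNIV p i) i)
       = of_int (sign p) * (\<Prod>i\<in>UNIV - {a}. m i (p i))"
      using sign_inverse[of p] P permutation_permutes[of p] by force
  next
    fix p assume p: "p \<in> {p. p permutes UNIV \<and> p b = a}"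
    then have P: "p permutes UNIV" by simp
    show "inv_into UNIV (inv_into UNIV p) = p" using P by (rule permutes_inv_inv)
    show "inv_into UNIV p \<in> {p. p permutes UNIV \<and> p a = b}"
      using p permutes_inv[OF P] permutes_inverses(2)[OF P] by auto
  qed
  then show ?thesis by (simp add: cof_def)
qed

lemma mdet_transpose: "mdet (\<lambda>i j. m j i) = mdet m"
  using Determinants.det_transpose[of "\<chi> i j. m i j"] by (simp add: mdet_eq Finite_Cartesian_Product.transpose_def)

lemma cof_rows: "(\<Sum>b\<in>UNIV. m c b * cof m a b) = (if a = c then mdet m else 0)"
  using cof_row[of m a] cof_row_other[of a c m] by auto

lemma cof_cols: "(\<Sum>r\<in>UNIV. m r d * cof m r c) = (if c = d then mdet m else 0)"
  using cof_rows[of "\<lambda>i j. m j i" d c] by (simp add: cof_transpose[of m] mdet_transpose[of m])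

text \<open>For invertible matrices this is the trace of the resolvent identity, with
  \<open>cof m\<close> equal to det times the inverse transpose. Expanding \<delta> as m - m' and
  applying the row and column expansions proves it for singular ones as well.\<close>

lemma cof_resolvent:
  assumes "\<And>i j. m i j - m' i j = (if i = j then \<delta> else 0)"
  shows "\<delta> * (\<Sum>r\<in>UNIV. \<Sum>c\<in>UNIV. cof m r c * cof m' c r) =
    mdet m * (\<Sum>r\<in>UNIV. cof m' r r) - mdet m' * (\<Sum>r\<in>UNIV. cof m r r)"
proof -
  have "\<delta> * (\<Sum>r\<in>UNIV. \<Sum>c\<in>UNIV. cof m r c * cof m' c r)
    = (\<Sum>r\<in>UNIV. \<Sum>c\<in>UNIV. \<Sum>d\<in>UNIV. cof m r c * (if r = d then \<delta> else 0) * cof m' c d)"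
    by (simp add: sum_distrib_left if_distrib if_distribR algebra_simps cong: if_cong)
  also have "\<dots> = (\<Sum>r\<in>UNIV. \<Sum>c\<in>UNIV. \<Sum>d\<in>UNIV. m r d * cof m r c * cof m' c d)
     - (\<Sum>r\<in>UNIV. \<Sum>c\<in>UNIV. \<Sum>d\<in>UNIV. cof m r c * (m' r d * cof m' c d))"
    by (simp add: assms[symmetric] sum_subtractf algebra_simps)
  also have "(\<Sum>r\<in>UNIV. \<Sum>c\<in>UNIV. \<Sum>d\<in>UNIV. cof m r c * (m' r d * cof m' c d))
     = (\<Sum>r\<in>UNIV. \<Sum>c\<in>UNIV. cof m r c * (if c = r then mdet m' else 0))"
    by (simp add: sum_distrib_left[symmetric] cof_rows)
  also have "\<dots> = mdet m' * (\<Sum>r\<in>UNIV. cof m r r)"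
    by (simp add: sum_distrib_left if_distrib algebra_simps cong: if_cong)
  also have "(\<Sum>r\<in>UNIV. \<Sum>c\<in>UNIV. \<Sum>d\<in>UNIV. m r d * cof m r c * cof m' c d)
     = (\<Sum>c\<in>UNIV. \<Sum>d\<in>UNIV. \<Sum>r\<in>UNIV. m r d * cof m r c * cof m' c d)"
    by (subst sum.swap) (intro sum.cong refl sum.swap)
  also have "\<dots> = (\<Sum>c\<in>UNIV. \<Sum>d\<in>UNIV. (if c = d then mdet m else 0) * cof m' c d)"
    by (simp add: sum_distrib_right[symmetric] cof_cols)
  also have "\<dots> = mdet m * (\<Sum>r\<in>UNIV. cof m' r r)"
    by (simp add: sum_distrib_left if_distrib if_distribR cong: if_cong)
  finally show ?thesis .
qed

text \<open>Composing a permutation with the transposition of a and b flips its sign, which turns the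
  terms with p a = b, p b = a into those with p a = a, p b = b.\<close>

lemma cof2_swap: "cof2 m a b b a = - cof2 m a a b b"
proof (cases "a = b")
  case False
  let ?t = "Transposition.transpose a b"
  have t: "?t permutes UNIV" by (simp add: permutes_swap_id)
  have "(\<Sum>p | p permutes UNIV \<and> p a = b \<and> p b = a. of_int (sign p) * (\<Prod>i\<in>UNIV - {a, b}. m i (p i)))
    = (\<Sum>p | p permutes UNIV \<and> p a = a \<and> p b = b. - (of_int (sign p) * (\<Prod>i\<in>UNIV - {a, b}. m i (p i))))"
  proof (rule sum.reindex_bij_witness[of _ "\<lambda>p. p \<circ> ?t" "\<lambda>p. p \<circ> ?t"])
    fix p assume p: "p \<in> {p. p permutes UNIV \<and> p a = b \<and> p b = a}"
    then have P: "p permutes UNIV" by simp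
    show "(p \<circ> ?t) \<circ> ?t = p" by (simp add: fun_eq_iff)
    show "p \<circ> ?t \<in> {p. p permutes UNIV \<and> p a = a \<and> p b = b}"
      using p permutes_compose[OF t P] by auto
    have "sign (p \<circ> ?t) = - sign p"
      using False sign_compose[of p ?t] permutation_permutes P t finite
      by (metis mult_minus1_right sign_swap_id)
    moreover have "(\<Prod>i\<in>UNIV - {a, b}. m i ((p \<circ> ?t) i)) = (\<Prod>i\<in>UNIV - {a, b}. m i (p i))"
      by (intro prod.cong) (auto simp: Transposition.transpose_def)
    ultimately show "- (of_int (sign (p \<circ> ?t)) * (\<Prod>i\<in>UNIV - {a, b}. m i ((p \<circ> ?t) i)))
       = of_int (sign p) * (\<Prod>i\<in>UNIV - {a, b}. m i (p i))" by simp
  next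
    fix p assume p: "p \<in> {p. p permutes UNIV \<and> p a = a \<and> p b = b}"
    then have P: "p permutes UNIV" by simp
    show "(p \<circ> ?t) \<circ> ?t = p" by (simp add: fun_eq_iff)
    show "p \<circ> ?t \<in> {p. p permutes UNIV \<and> p a = b \<and> p b = a}"
      using p permutes_compose[OF t P] by auto
  qed
  then show ?thesis using False by (simp add: cof2_def sum_negf)
qed (simp add: cof2_def)

text \<open>Jacobi's formula.\<close>

lemma pd_mdet:
  assumes "\<And>i j. polyfun V (m i j)"
  shows "pd v (\<lambda>x. mdet (\<lambda>i j. m i j x)) = (\<lambda>x. \<Sum>i\<in>UNIV. \<Sum>j\<in>UNIV. pd v (m i j) x * cof (\<lambda>i j. m i j x) i j)"
proof
  fix x
  have "pd v (\<lambda>x. mdet (\<lambda>i j. m i j x)) x = (\<Sum>p | p permutes UNIV. of_int (sign p) *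
      (\<Sum>i\<in>UNIV. pd v (m i (p i)) x * (\<Prod>l\<in>UNIV - {i}. m l (p l) x)))"
    unfolding mdet_def
    by (subst pd_sum[of _ V]) (auto intro!: polyfun_intros assms
        simp: pd_cmult[OF polyfun_prod[of _ V], OF assms] pd_prod[OF _ assms])
  also have "\<dots> = (\<Sum>p | p permutes UNIV. \<Sum>i\<in>UNIV. pd v (m i (p i)) x *
      (of_int (sign p) * (\<Prod>l\<in>UNIV - {i}. m l (p l) x)))"
    by (simp add: sum_distrib_left algebra_simps)
  also have "\<dots> = (\<Sum>i\<in>UNIV. \<Sum>p | p permutes UNIV. pd v (m i (p i)) x *
      (of_int (sign p) * (\<Prod>l\<in>UNIV - {i}. m l (p l) x)))"
    by (rule sum.swap)
  also have "\<dots> = (\<Sum>i\<in>UNIV. \<Sum>j\<in>UNIV. \<Sum>p | p permutes UNIV \<and> p i = j. pd v (m i (p i)) x *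
      (of_int (sign p) * (\<Prod>l\<in>UNIV - {i}. m l (p l) x)))"
    by (subst sum_over_value) simp
  also have "\<dots> = (\<Sum>i\<in>UNIV. \<Sum>j\<in>UNIV. pd v (m i j) x * cof (\<lambda>i j. m i j x) i j)"
    unfolding cof_def sum_distrib_left by (intro sum.cong) auto
  finally show "pd v (\<lambda>x. mdet (\<lambda>i j. m i j x)) x = (\<Sum>i\<in>UNIV. \<Sum>j\<in>UNIV. pd v (m i j) x * cof (\<lambda>i j. m i j x) i j)" .
qed

lemma pd_cof:
  assumes "\<And>i j. polyfun V (m i j)"
  shows "pd v (\<lambda>x. cof (\<lambda>i j. m i j x) a b) =
    (\<lambda>x. \<Sum>i\<in>UNIV. \<Sum>j\<in>UNIV. pd v (m i j) x * cof2 (\<lambda>i j. m i j x) a b i j)"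
proof
  fix x
  let ?S = "{p. p permutes UNIV \<and> p a = b}"
  have "pd v (\<lambda>x. cof (\<lambda>i j. m i j x) a b) x = (\<Sum>p\<in>?S. of_int (sign p) *
      (\<Sum>i\<in>UNIV - {a}. pd v (m i (p i)) x * (\<Prod>l\<in>UNIV - {a} - {i}. m l (p l) x)))"
    unfolding cof_def
    by (subst pd_sum[of _ V]) (auto intro!: polyfun_intros assms
        simp: pd_cmult[OF polyfun_prod[of _ V], OF assms] pd_prod[OF _ assms])
  also have "\<dots> = (\<Sum>p\<in>?S. \<Sum>i\<in>UNIV - {a}. pd v (m i (p i)) x *
      (of_int (sign p) * (\<Prod>l\<in>UNIV - {a, i}. m l (p l) x)))"
    by (simp add: sum_distrib_left algebra_simps set_diff_eq conj_commute)
  also have "\<dots> = (\<Sum>i\<in>UNIV - {a}. \<Sum>p\<in>?S. pd v (m i (p i)) x *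
      (of_int (sign p) * (\<Prod>l\<in>UNIV - {a, i}. m l (p l) x)))"
    by (rule sum.swap)
  also have "\<dots> = (\<Sum>i\<in>UNIV - {a}. \<Sum>j\<in>UNIV. \<Sum>p | (p permutes UNIV \<and> p a = b) \<and> p i = j. pd v (m i (p i)) x *
      (of_int (sign p) * (\<Prod>l\<in>UNIV - {a, i}. m l (p l) x)))"
    by (subst sum_over_value) simp
  also have "\<dots> = (\<Sum>i\<in>UNIV - {a}. \<Sum>j\<in>UNIV. pd v (m i j) x * cof2 (\<lambda>i j. m i j x) a b i j)"
    unfolding cof2_def by (intro sum.cong) (auto simp: sum_distrib_left intro!: sum.cong)
  also have "\<dots> = (\<Sum>i\<in>UNIV. \<Sum>j\<in>UNIV. pd v (m i j) x * cof2 (\<lambda>i j. m i j x) a b i j)"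
    by (intro sum.mono_neutral_left) (auto simp: cof2_def)
  finally show "pd v (\<lambda>x. cof (\<lambda>i j. m i j x) a b) x =
     (\<Sum>i\<in>UNIV. \<Sum>j\<in>UNIV. pd v (m i j) x * cof2 (\<lambda>i j. m i j x) a b i j)" .
qed

lemma sep_if: "sep V W f \<Longrightarrow> sep V W g \<Longrightarrow> sep V W (\<lambda>e p. if b then f e p else g e p)"
  by (cases b) auto

lemma sep_mdet:
  assumes "\<And>i j. sep V W (m i j)"
  shows "sep V W (\<lambda>e p. mdet (\<lambda>i j. m i j e p))"
  unfolding mdet_def by (rule sep_sum, rule sep_cmult, rule sep_prod, rule assms)

lemma sep_cof:
  assumes "\<And>i j. sep V W (m i j)"
  shows "sep V W (\<lambda>e p. cof (\<lambda>i j. m i j e p) a b)"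
  unfolding cof_def by (rule sep_sum, rule sep_cmult, rule sep_prod, rule assms)

lemma sep_cof2:
  assumes "\<And>i j. sep V W (m i j)"
  shows "sep V W (\<lambda>e p. cof2 (\<lambda>i j. m i j e p) a b c d)"
  unfolding cof2_def
  by (rule sep_if, rule sep_const, rule sep_sum, rule sep_cmult, rule sep_prod, rule assms)

subsection \<open>The heat equation for products of characteristic polynomials\<close>

lemma sum_delta2:
  fixes c :: complex
  shows "(\<Sum>i\<in>UNIV. \<Sum>l\<in>UNIV. (if i = a \<and> l = b then c else 0) * X i l) = c * X (a::'n::finite) (b::'m::finite)"
proof -
  have "(\<Sum>l\<in>UNIV. (if i = a \<and> l = b then c else 0) * X i l) = (if i = a then c * X i b else 0)" for i
    by (cases "i = a") (simp_all add: if_distrib if_distribR cong: if_cong)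
  then show ?thesis by simp
qed

text \<open>Matrix number j is a G + b G* - u I with a = c0 j False + c1 j False t and
  b = c0 j True + c1 j True t; the coordinates of p are the time t = p 0 and u = p (Suc j).
  Factors in the same group share a and b; the covariance of factors from different groups must not
  depend on t.\<close>

locale matrix_flow =
  fixes m :: nat and c0 c1 :: "nat \<Rightarrow> bool \<Rightarrow> complex" and grp :: "nat \<Rightarrow> bool"
  assumes same: "i < m \<Longrightarrow> j < m \<Longrightarrow> grp i = grp j \<Longrightarrow> c0 i = c0 j \<and> c1 i = c1 j"
    and cross: "i < m \<Longrightarrow> j < m \<Longrightarrow> grp i \<noteq> grp j \<Longrightarrow>
      (\<Sum>b\<in>UNIV. c1 i b * (c0 j (\<not> b) + c1 j (\<not> b) * t)) +
      (\<Sum>b\<in>UNIV. c1 j b * (c0 i (\<not> b) + c1 i (\<not> b) * t)) = 0"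
begin

definition C :: "nat \<Rightarrow> bool \<Rightarrow> (nat \<Rightarrow> complex) \<Rightarrow> complex" where
  "C j b p = c0 j b + c1 j b * p 0"

definition mat_at :: "nat \<Rightarrow> ('n \<times> 'n \<times> bool \<Rightarrow> complex) \<Rightarrow> (nat \<Rightarrow> complex) \<Rightarrow> 'n \<Rightarrow> 'n \<Rightarrow> complex" where
  "mat_at j e p r c = C j False p * e (r, c, False) + C j True p * e (r, c, True) - (if r = c then p (Suc j) else 0)"

definition det_at :: "nat \<Rightarrow> ('n::finite \<times> 'n \<times> bool \<Rightarrow> complex) \<Rightarrow> (nat \<Rightarrow> complex) \<Rightarrow> complex" where
  "det_at j e p = mdet (\<lambda>r c. mat_at j e p r c)"

definition cof_at :: "nat \<Rightarrow> 'n \<Rightarrow> 'n \<Rightarrow> ('n::finite \<times> 'n \<times> bool \<Rightarrow> complex) \<Rightarrow> (nat \<Rightarrow> complex) \<Rightarrow> complex" where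
  "cof_at j r c e p = cof (\<lambda>r c. mat_at j e p r c) r c"

definition cof2_at :: "nat \<Rightarrow> 'n \<Rightarrow> 'n \<Rightarrow> 'n \<Rightarrow> 'n \<Rightarrow> ('n::finite \<times> 'n \<times> bool \<Rightarrow> complex) \<Rightarrow> (nat \<Rightarrow> complex) \<Rightarrow> complex" where
  "cof2_at j r c r' c' e p = cof2 (\<lambda>r c. mat_at j e p r c) r c r' c'"

definition rest :: "nat set \<Rightarrow> ('n::finite \<times> 'n \<times> bool \<Rightarrow> complex) \<Rightarrow> (nat \<Rightarrow> complex) \<Rightarrow> complex" where
  "rest S e p = (\<Prod>l\<in>{..<m} - S. det_at l e p)"

text \<open>The covariance of the time derivative of matrix j with matrix l. In particular
  \<open>rate j j\<close> is half the time derivative of the variance of matrix j.\<close>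

definition rate :: "nat \<Rightarrow> nat \<Rightarrow> (nat \<Rightarrow> complex) \<Rightarrow> complex" where
  "rate j l p = (\<Sum>b\<in>UNIV. c1 j b * C l (\<not> b) p)"

definition cof2_trace :: "nat \<Rightarrow> ('n::finite \<times> 'n \<times> bool \<Rightarrow> complex) \<Rightarrow> (nat \<Rightarrow> complex) \<Rightarrow> complex" where
  "cof2_trace j e p = (\<Sum>r\<in>UNIV. \<Sum>c\<in>UNIV. cof2_at j r c c r e p)"

definition cof_trace :: "nat \<Rightarrow> nat \<Rightarrow> ('n::finite \<times> 'n \<times> bool \<Rightarrow> complex) \<Rightarrow> (nat \<Rightarrow> complex) \<Rightarrow> complex" where
  "cof_trace j l e p = (\<Sum>r\<in>UNIV. \<Sum>c\<in>UNIV. cof_at j r c e p * cof_at l c r e p)"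

text \<open>The type argument carries the size of the matrices, which p does not determine.\<close>

definition mean_prod :: "'n::finite itself \<Rightarrow> (nat \<Rightarrow> complex) \<Rightarrow> complex" where
  "mean_prod _ p = ginibre_exp (\<lambda>e :: 'n \<times> 'n \<times> bool \<Rightarrow> complex. rest {} e p)"

lemma polyfun_C: "polyfun {0} (C j b)"
  unfolding C_def by (intro polyfun_intros) auto

lemma polyfun_rate: "polyfun {0} (rate j l)"
  unfolding rate_def using polyfun_C by (auto intro!: polyfun_intros)

lemma sep_mat_at: "j < m \<Longrightarrow> sep UNIV {..m} (\<lambda>e p. mat_at j e p r c)"
  unfolding mat_at_def
  by (intro sep_diff sep.add sep_mult sep_if sep_const sep_left sep_right polyfun.var
      polyfun_mono[OF polyfun_C]) auto

lemma sep_det_at: "j < m \<Longrightarrow> sep UNIV {..m} (det_at j)"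
  unfolding det_at_def[abs_def] by (rule sep_mdet) (rule sep_mat_at)

lemma sep_cof_at: "j < m \<Longrightarrow> sep UNIV {..m} (cof_at j r c)"
  unfolding cof_at_def[abs_def] by (rule sep_cof) (rule sep_mat_at)

lemma sep_cof2_at: "j < m \<Longrightarrow> sep UNIV {..m} (cof2_at j r c r' c')"
  unfolding cof2_at_def[abs_def] by (rule sep_cof2) (rule sep_mat_at)

lemma sep_rest: "sep UNIV {..m} (rest S)"
  unfolding rest_def[abs_def] by (rule sep_prod) (auto intro: sep_det_at)

lemma sep_cof2_trace: "j < m \<Longrightarrow> sep UNIV {..m} (cof2_trace j)"
  unfolding cof2_trace_def[abs_def] by (intro sep_sum sep_cof2_at)

lemma sep_cof_trace: "j < m \<Longrightarrow> l < m \<Longrightarrow> sep UNIV {..m} (cof_trace j l)"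
  unfolding cof_trace_def[abs_def] by (intro sep_sum sep_mult sep_cof_at)

lemma pd_e_mat_at:
  "pd (c, r, b) (\<lambda>e. mat_at j e p i l) = (\<lambda>e. if i = c \<and> l = r then C j b p else 0)"
proof -
  have v: "polyfun UNIV (\<lambda>e. e v)" for v :: "'a \<times> 'a \<times> bool" by (rule polyfun.var) simp
  show ?thesis unfolding mat_at_def
    by (rule ext)
      (auto simp: pd_diff[OF polyfun.add[OF polyfun_cmult[OF v] polyfun_cmult[OF v]] polyfun.const]
         pd_add[OF polyfun_cmult[OF v] polyfun_cmult[OF v]] pd_cmult[OF v] pd_var)
qed

lemma pd_e_det_at:
  assumes "j < m"
  shows "pd (c, r, b) (\<lambda>e. det_at j e p) = (\<lambda>e. C j b p * cof_at j c r e p)"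
  unfolding det_at_def
  by (subst pd_mdet[of UNIV]) (auto simp: pd_e_mat_at sum_delta2 cof_at_def intro: sep_imp_polyfun_left[OF sep_mat_at[OF assms]])

lemma pd_e_cof_at:
  assumes "j < m"
  shows "pd (c', r', b) (\<lambda>e. cof_at j r c e p) = (\<lambda>e. C j b p * cof2_at j r c c' r' e p)"
  unfolding cof_at_def
  by (subst pd_cof[of UNIV]) (auto simp: pd_e_mat_at sum_delta2 cof2_at_def intro: sep_imp_polyfun_left[OF sep_mat_at[OF assms]])

lemma pd_e_rest:
  "pd (c, r, b) (\<lambda>e. rest {j} e p) =
     (\<lambda>e. \<Sum>l\<in>{..<m} - {j}. C l b p * cof_at l c r e p * rest {j, l} e p)"
proof -
  have "{..<m} - {j} - {l} = {..<m} - {j, l}" for l by auto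
  then show ?thesis unfolding rest_def
    by (subst pd_prod[of _ UNIV]) (auto simp: pd_e_det_at intro: sep_imp_polyfun_left[OF sep_det_at])
qed

lemma pd_e_cof_at_rest:
  assumes "j < m"
  shows "pd (c, r, b) (\<lambda>e. cof_at j r c e p * rest {j} e p) =
    (\<lambda>e. C j b p * (cof2_at j r c c r e p * rest {j} e p) +
       (\<Sum>l\<in>{..<m} - {j}. C l b p * (cof_at j r c e p * cof_at l c r e p * rest {j, l} e p)))"
  by (subst pd_mult[of UNIV])
    (auto simp: pd_e_cof_at[OF assms] pd_e_rest sum_distrib_left algebra_simps
       intro: sep_imp_polyfun_left[OF sep_cof_at[OF assms]] sep_imp_polyfun_left[OF sep_rest])

lemma pd_t_mat_at:
  "pd 0 (\<lambda>p. mat_at j e p r c) = (\<lambda>p. \<Sum>b\<in>UNIV. c1 j b * e (r, c, b))"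
  unfolding mat_at_def C_def
  by (cases "r = c"; rule ext; rule pd_eqI) (auto intro!: derivative_eq_intros simp: UNIV_bool)

lemma pd_u_mat_at:
  "pd (Suc l) (\<lambda>p. mat_at j e p r c) = (\<lambda>p. if r = c \<and> l = j then -1 else 0)"
  unfolding mat_at_def C_def
  by (cases "r = c"; cases "l = j"; rule ext; rule pd_eqI) (auto intro!: derivative_eq_intros)

lemma pd_t_det_at:
  assumes "j < m"
  shows "pd 0 (det_at j e) p = (\<Sum>r\<in>UNIV. \<Sum>c\<in>UNIV. (\<Sum>b\<in>UNIV. c1 j b * e (r, c, b)) * cof_at j r c e p)"
  unfolding det_at_def[abs_def]
  by (subst pd_mdet[of "{..m}"]) (auto simp: pd_t_mat_at cof_at_def intro: sep_imp_polyfun_right[OF sep_mat_at[OF assms]])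

lemma pd_u_det_at:
  assumes "j < m"
  shows "pd (Suc l) (det_at j e) = (\<lambda>p. if l = j then - (\<Sum>r\<in>UNIV. cof_at j r r e p) else 0)"
proof
  fix p
  have "pd (Suc l) (det_at j e) p = (\<Sum>r\<in>UNIV. \<Sum>c\<in>UNIV. (if r = c \<and> l = j then -1 else 0) * cof_at j r c e p)"
    unfolding det_at_def[abs_def]
    by (subst pd_mdet[of "{..m}"]) (auto simp: pd_u_mat_at cof_at_def intro: sep_imp_polyfun_right[OF sep_mat_at[OF assms]])
  also have "\<dots> = (if l = j then - (\<Sum>r\<in>UNIV. cof_at j r r e p) else 0)"
    by (simp add: if_distrib if_distribR sum_negf cong: if_cong)
  finally show "pd (Suc l) (det_at j e) p = (if l = j then - (\<Sum>r\<in>UNIV. cof_at j r r e p) else 0)" .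
qed

lemma pd_u_cof_at:
  assumes "j < m"
  shows "pd (Suc j) (cof_at j a b e) = (\<lambda>p. - (\<Sum>r\<in>UNIV. cof2_at j a b r r e p))"
proof
  fix p
  have "pd (Suc j) (cof_at j a b e) p = (\<Sum>r\<in>UNIV. \<Sum>c\<in>UNIV. (if r = c then -1 else 0) * cof2_at j a b r c e p)"
    unfolding cof_at_def[abs_def]
    by (subst pd_cof[of "{..m}"]) (auto simp: pd_u_mat_at cof2_at_def intro: sep_imp_polyfun_right[OF sep_mat_at[OF assms]])
  also have "\<dots> = - (\<Sum>r\<in>UNIV. cof2_at j a b r r e p)"
    by (simp add: if_distrib if_distribR sum_negf cong: if_cong)
  finally show "pd (Suc j) (cof_at j a b e) p = - (\<Sum>r\<in>UNIV. cof2_at j a b r r e p)" .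
qed

lemma pd_u_rest:
  assumes "j < m"
  shows "pd (Suc j) (rest {} e) = (\<lambda>p. - (\<Sum>r\<in>UNIV. cof_at j r r e p) * rest {j} e p)"
proof
  fix p
  have "pd (Suc j) (rest {} e) p = (\<Sum>l<m. pd (Suc j) (det_at l e) p * rest {l} e p)"
    unfolding rest_def[abs_def]
    by (subst pd_prod[of _ "{..m}"]) (auto intro: sep_imp_polyfun_right[OF sep_det_at])
  also have "\<dots> = (\<Sum>l<m. if l = j then - (\<Sum>r\<in>UNIV. cof_at j r r e p) * rest {j} e p else 0)"
    by (intro sum.cong) (auto simp: pd_u_det_at)
  finally show "pd (Suc j) (rest {} e) p = - (\<Sum>r\<in>UNIV. cof_at j r r e p) * rest {j} e p"
    using assms by simp
qed

lemma pd_u_rest1: "j < m \<Longrightarrow> pd (Suc j) (rest {j} e) = (\<lambda>p. 0)"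
  unfolding rest_def[abs_def]
  by (subst pd_prod[of _ "{..m}"])
    (auto simp: fun_eq_iff pd_u_det_at intro!: sum.neutral intro: sep_imp_polyfun_right[OF sep_det_at])

text \<open>Differentiating twice along the diagonal gives second cofactors
  \<open>cof2 r r c c\<close>; exchanging the two values of the permutation turns them, up to sign,
  into the terms of \<open>cof2_trace\<close> that integration by parts produces.\<close>

lemma pd_uu_rest:
  assumes "j < m"
  shows "pd (Suc j) (pd (Suc j) (rest {} e)) = (\<lambda>p. - (cof2_trace j e p * rest {j} e p))"
proof
  fix p
  have p1: "polyfun {..m} (\<lambda>p. \<Sum>r\<in>UNIV. cof_at j r r e p)"
    by (intro polyfun_sum sep_imp_polyfun_right[OF sep_cof_at[OF assms]])
  have p2: "polyfun {..m} (rest {j} e)" by (rule sep_imp_polyfun_right[OF sep_rest])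
  have "pd (Suc j) (pd (Suc j) (rest {} e)) p = - pd (Suc j) (\<lambda>p. \<Sum>r\<in>UNIV. cof_at j r r e p) p * rest {j} e p"
    unfolding pd_u_rest[OF assms]
    by (subst pd_mult[OF polyfun_minus[OF p1] p2]) (simp add: pd_u_rest1[OF assms] pd_minus[OF p1])
  also have "pd (Suc j) (\<lambda>p. \<Sum>r\<in>UNIV. cof_at j r r e p) p = (\<Sum>r\<in>UNIV. - (\<Sum>c\<in>UNIV. cof2_at j r r c c e p))"
    by (subst pd_sum[of _ "{..m}"]) (auto simp: pd_u_cof_at[OF assms] intro: sep_imp_polyfun_right[OF sep_cof_at[OF assms]])
  also have "\<dots> = cof2_trace j e p"
    by (simp add: cof2_trace_def cof2_at_def sum_negf[symmetric] cof2_swap[symmetric])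
  finally show "pd (Suc j) (pd (Suc j) (rest {} e)) p = - (cof2_trace j e p * rest {j} e p)" by simp
qed

lemma pd_t_rest:
  "pd 0 (rest {} e) p = (\<Sum>j<m. \<Sum>r\<in>UNIV. \<Sum>c\<in>UNIV. \<Sum>b\<in>UNIV.
     c1 j b * (e (r, c, b) * (cof_at j r c e p * rest {j} e p)))"
proof -
  have "pd 0 (rest {} e) p = (\<Sum>j<m. pd 0 (det_at j e) p * rest {j} e p)"
    unfolding rest_def[abs_def]
    by (subst pd_prod[of _ "{..m}"]) (auto intro: sep_imp_polyfun_right[OF sep_det_at])
  also have "\<dots> = (\<Sum>j<m. \<Sum>r\<in>UNIV. \<Sum>c\<in>UNIV. \<Sum>b\<in>UNIV.
     c1 j b * (e (r, c, b) * (cof_at j r c e p * rest {j} e p)))"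
    by (intro sum.cong) (auto simp: pd_t_det_at sum_distrib_right sum_distrib_left algebra_simps)
  finally show ?thesis .
qed

text \<open>The time derivative releases an entry of G or of its adjoint. Integration by parts turns
  it into a derivative that hits either the same determinant, giving second cofactors, or another
  one, giving products of cofactors.\<close>

lemma pd_t_mean_prod:
  "pd 0 (mean_prod TYPE('n)) p = ginibre_exp (\<lambda>e :: 'n::finite \<times> 'n \<times> bool \<Rightarrow> complex.
     \<Sum>j<m. rate j j p * (cof2_trace j e p * rest {j} e p) +
       (\<Sum>l\<in>{..<m} - {j}. rate j l p * (cof_trace j l e p * rest {j, l} e p)))"
proof -
  let ?\<Lambda> = "ginibre_exp :: (('n \<times> 'n \<times> bool \<Rightarrow> complex) \<Rightarrow> complex) \<Rightarrow> complex"
  interpret linear_functional UNIV ?\<Lambda> by (rule ginibre_linear_functional)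
  define D where "D j r c b = pd (c, r, \<not> b) (\<lambda>e :: 'n \<times> 'n \<times> bool \<Rightarrow> complex. cof_at j r c e p * rest {j} e p)"
    for j r c b
  have P1: "polyfun UNIV (\<lambda>e. cof_at j r c e p * rest {j} e p)" if "j < m" for j and r c :: 'n
    by (intro polyfun.mult sep_imp_polyfun_left[OF sep_cof_at[OF that]] sep_imp_polyfun_left[OF sep_rest])
  have P2: "polyfun UNIV (\<lambda>e. e (r, c, b) * (cof_at j r c e p * rest {j} e p))" if "j < m" for j b and r c :: 'n
    by (intro polyfun.mult polyfun.var that P1) auto
  have P3: "polyfun UNIV (D j r c b)" if "j < m" for j b r c
    unfolding D_def by (rule polyfun_pd[OF P1[OF that]])
  have "pd 0 (mean_prod TYPE('n)) p = ?\<Lambda> (\<lambda>e. pd 0 (rest {} e) p)"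
    using pd_param[OF sep_rest[of "{}"], of 0] unfolding mean_prod_def by (simp add: fun_eq_iff)
  also have "\<dots> = (\<Sum>j<m. \<Sum>r\<in>UNIV. \<Sum>c\<in>UNIV. \<Sum>b\<in>UNIV.
     c1 j b * ?\<Lambda> (\<lambda>e. e (r, c, b) * (cof_at j r c e p * rest {j} e p)))"
    unfolding pd_t_rest
    by (subst sum, force intro!: polyfun_sum polyfun_cmult P2, intro sum.cong refl)+
      (auto intro!: cmult P2)
  also have "\<dots> = (\<Sum>j<m. \<Sum>r\<in>UNIV. \<Sum>c\<in>UNIV. \<Sum>b\<in>UNIV. c1 j b * ?\<Lambda> (D j r c b))"
    unfolding D_def by (intro sum.cong refl arg_cong2[of _ _ _ _ "(*)"] ginibre_stein P1) auto
  also have "\<dots> = ?\<Lambda> (\<lambda>e. \<Sum>j<m. \<Sum>r\<in>UNIV. \<Sum>c\<in>UNIV. \<Sum>b\<in>UNIV. c1 j b * D j r c b e)"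
    by (subst sum, force intro!: polyfun_sum polyfun_cmult P3, intro sum.cong refl)+
      (auto intro!: cmult[symmetric] P3)
  also have "(\<lambda>e. \<Sum>j<m. \<Sum>r\<in>UNIV. \<Sum>c\<in>UNIV. \<Sum>b\<in>UNIV. c1 j b * D j r c b e) =
    (\<lambda>e. \<Sum>j<m. rate j j p * (cof2_trace j e p * rest {j} e p) +
       (\<Sum>l\<in>{..<m} - {j}. rate j l p * (cof_trace j l e p * rest {j, l} e p)))"
  proof (intro ext sum.cong refl)
    fix e :: "'n \<times> 'n \<times> bool \<Rightarrow> complex" and j assume "j \<in> {..<m}"
    then have j: "j < m" by simp
    have "(\<Sum>b\<in>UNIV. c1 j b * D j r c b e) = rate j j p * (cof2_at j r c c r e p * rest {j} e p) +
        (\<Sum>l\<in>{..<m} - {j}. rate j l p * (cof_at j r c e p * cof_at l c r e p * rest {j, l} e p))" for r c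
      unfolding D_def pd_e_cof_at_rest[OF j] rate_def UNIV_bool
      by (simp add: sum_distrib_left sum.distrib algebra_simps)
    then have "(\<Sum>r\<in>UNIV. \<Sum>c\<in>UNIV. \<Sum>b\<in>UNIV. c1 j b * D j r c b e) =
       (\<Sum>r\<in>UNIV. \<Sum>c\<in>UNIV. rate j j p * (cof2_at j r c c r e p * rest {j} e p)) +
       (\<Sum>r\<in>UNIV. \<Sum>c\<in>UNIV. \<Sum>l\<in>{..<m} - {j}. rate j l p * (cof_at j r c e p * cof_at l c r e p * rest {j, l} e p))"
      by (simp add: sum.distrib)
    also have "(\<Sum>r\<in>UNIV. \<Sum>c\<in>UNIV. rate j j p * (cof2_at j r c c r e p * rest {j} e p)) = rate j j p * (cof2_trace j e p * rest {j} e p)"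
      by (simp add: cof2_trace_def sum_distrib_left sum_distrib_right)
    also have "(\<Sum>r\<in>UNIV. \<Sum>c\<in>UNIV. \<Sum>l\<in>{..<m} - {j}. rate j l p * (cof_at j r c e p * cof_at l c r e p * rest {j, l} e p))
      = (\<Sum>l\<in>{..<m} - {j}. \<Sum>r\<in>UNIV. \<Sum>c\<in>UNIV. rate j l p * (cof_at j r c e p * cof_at l c r e p * rest {j, l} e p))"
      by (subst sum.swap, subst sum.swap, intro sum.cong refl sum.swap)
    also have "\<dots> = (\<Sum>l\<in>{..<m} - {j}. rate j l p * (cof_trace j l e p * rest {j, l} e p))"
      by (simp add: cof_trace_def sum_distrib_left sum_distrib_right)
    finally show "(\<Sum>r\<in>UNIV. \<Sum>c\<in>UNIV. \<Sum>b\<in>UNIV. c1 j b * D j r c b e) =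
      rate j j p * (cof2_trace j e p * rest {j} e p) + (\<Sum>l\<in>{..<m} - {j}. rate j l p * (cof_trace j l e p * rest {j, l} e p))" .
  qed
  finally show ?thesis .
qed

end

section \<open>Vandermonde factors within groups and removal of the drift\<close>

context matrix_flow
begin

definition peers :: "nat \<Rightarrow> nat set" where
  "peers j = {l \<in> {..<m}. l \<noteq> j \<and> grp l = grp j}"

definition pairs :: "(nat \<times> nat) set" where
  "pairs = {(j, l) \<in> {..<m} \<times> {..<m}. j < l \<and> grp j = grp l}"

definition group_vdm :: "(nat \<Rightarrow> complex) \<Rightarrow> complex" where
  "group_vdm p = (\<Prod>q\<in>pairs. p (Suc (snd q)) - p (Suc (fst q)))"

definition vdm_logder :: "nat \<Rightarrow> (nat \<Rightarrow> complex) \<Rightarrow> complex" where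
  "vdm_logder j p = (\<Sum>l\<in>peers j. 1 / (p (Suc j) - p (Suc l)))"

lemma finite_peers: "finite (peers j)" by (simp add: peers_def)

lemma finite_pairs: "finite pairs"
  by (rule finite_subset[of _ "{..<m} \<times> {..<m}"]) (auto simp: pairs_def)

lemma sum_peers_swap: "(\<Sum>j<m. \<Sum>l\<in>peers j. F j l) = (\<Sum>j<m. \<Sum>l\<in>peers j. F l j)"
proof -
  have "(\<Sum>j<m. \<Sum>l\<in>peers j. F j l) = (\<Sum>l<m. \<Sum>j | j \<in> {..<m} \<and> l \<noteq> j \<and> grp l = grp j. F j l)"
    unfolding peers_def by (rule sum.swap_restrict) auto
  also have "\<dots> = (\<Sum>j<m. \<Sum>l\<in>peers j. F l j)"
    by (intro sum.cong) (auto simp: peers_def)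
  finally show ?thesis .
qed

lemma polyfun_group_vdm: "polyfun {1..m} group_vdm"
  unfolding group_vdm_def[abs_def] pairs_def by (intro polyfun_intros) auto

text \<open>Restricted to distinct coordinates, where the logarithmic derivative is a finite sum of
  reciprocals.\<close>

lemma pd_group_vdm:
  assumes inj: "inj_on p {1..m}" and j: "j < m"
  shows "pd (Suc j) group_vdm p = group_vdm p * vdm_logder j p"
proof -
  have v: "polyfun UNIV (\<lambda>p. p v)" for v :: nat by (rule polyfun.var) simp
  have ne: "p (Suc b) - p (Suc a) \<noteq> 0" if "(a, b) \<in> pairs" for a b
    using that inj_onD[OF inj, of "Suc a" "Suc b"] by (auto simp: pairs_def)
  have "pd (Suc j) group_vdm p = (\<Sum>q\<in>pairs. pd (Suc j) (\<lambda>p. p (Suc (snd q)) - p (Suc (fst q))) p *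
      (\<Prod>r\<in>pairs - {q}. p (Suc (snd r)) - p (Suc (fst r))))"
    unfolding group_vdm_def[abs_def]
    by (subst pd_prod[OF finite_pairs, of UNIV]) (auto intro!: polyfun_intros)
  also have "\<dots> = (\<Sum>q\<in>pairs. group_vdm p *
     (if snd q = j then 1 / (p (Suc j) - p (Suc (fst q)))
      else if fst q = j then 1 / (p (Suc j) - p (Suc (snd q))) else 0))"
  proof (rule sum.cong[OF refl])
    fix q assume q: "q \<in> pairs"
    then have V: "group_vdm p = (p (Suc (snd q)) - p (Suc (fst q))) * (\<Prod>r\<in>pairs - {q}. p (Suc (snd r)) - p (Suc (fst r)))"
      unfolding group_vdm_def by (rule prod.remove[OF finite_pairs])
    have n: "p (Suc (snd q)) \<noteq> p (Suc (fst q))" using ne[of "fst q" "snd q"] q by auto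
    have "fst q \<noteq> snd q" using q by (auto simp: pairs_def)
    then show "pd (Suc j) (\<lambda>p. p (Suc (snd q)) - p (Suc (fst q))) p *
      (\<Prod>r\<in>pairs - {q}. p (Suc (snd r)) - p (Suc (fst r))) = group_vdm p *
     (if snd q = j then 1 / (p (Suc j) - p (Suc (fst q)))
      else if fst q = j then 1 / (p (Suc j) - p (Suc (snd q))) else 0)"
      using n unfolding V by (auto simp: pd_diff[OF v v] pd_var field_simps)
  qed
  also have "\<dots> = group_vdm p * (\<Sum>q\<in>pairs.
     if snd q = j then 1 / (p (Suc j) - p (Suc (fst q)))
      else if fst q = j then 1 / (p (Suc j) - p (Suc (snd q))) else 0)"
    by (simp add: sum_distrib_left)
  also have "(\<Sum>q\<in>pairs.
     if snd q = j then 1 / (p (Suc j) - p (Suc (fst q)))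
      else if fst q = j then 1 / (p (Suc j) - p (Suc (snd q))) else 0) =
     (\<Sum>q\<in>{q \<in> pairs. fst q = j \<or> snd q = j}.
     if snd q = j then 1 / (p (Suc j) - p (Suc (fst q))) else 1 / (p (Suc j) - p (Suc (snd q))))"
    by (rule sum.mono_neutral_cong_right) (auto simp: finite_pairs)
  also have "\<dots> = vdm_logder j p"
    unfolding vdm_logder_def
    by (rule sum.reindex_bij_witness[of _ "\<lambda>l. (min l j, max l j)" "\<lambda>q. if snd q = j then fst q else snd q"])
      (use j in \<open>auto simp: pairs_def peers_def min_def max_def\<close>)
  finally show ?thesis .
qed

text \<open>With L the logarithmic derivative of V, the second derivative is V (L^2 + L'), and L'
  cancels the squared reciprocals in L^2.\<close>

lemma pd_pd_group_vdm:
  assumes inj: "inj_on p {1..m}" and j: "j < m"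
  shows "pd (Suc j) (pd (Suc j) group_vdm) p = group_vdm p * (\<Sum>l\<in>peers j. \<Sum>l'\<in>peers j - {l}.
     1 / ((p (Suc j) - p (Suc l)) * (p (Suc j) - p (Suc l'))))"
proof -
  \<comment> \<open>The formula for the first derivative holds at distinct coordinates only, so it
    is differentiated on the open set where coordinate j avoids the others.\<close>
  let ?U = "- p ` ({1..m} - {Suc j})"
  have ne: "p (Suc j) \<noteq> p (Suc l)" if "l \<in> peers j" for l
    using that inj_onD[OF inj, of "Suc j" "Suc l"] j by (auto simp: peers_def)
  have "((\<lambda>t. group_vdm (p(Suc j := t)) * (\<Sum>l\<in>peers j. 1 / (t - p (Suc l)))) has_field_derivative
     pd (Suc j) group_vdm p * (\<Sum>l\<in>peers j. 1 / (p (Suc j) - p (Suc l))) +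
     (\<Sum>l\<in>peers j. - 1 / (p (Suc j) - p (Suc l))\<^sup>2) * group_vdm (p(Suc j := p (Suc j)))) (at (p (Suc j)))"
    by (intro DERIV_mult has_pd[OF polyfun_group_vdm] DERIV_sum)
      (auto intro!: derivative_eq_intros simp: ne power2_eq_square divide_simps)
  then have "((\<lambda>t. pd (Suc j) group_vdm (p(Suc j := t))) has_field_derivative
     pd (Suc j) group_vdm p * (\<Sum>l\<in>peers j. 1 / (p (Suc j) - p (Suc l))) +
     (\<Sum>l\<in>peers j. - 1 / (p (Suc j) - p (Suc l))\<^sup>2) * group_vdm (p(Suc j := p (Suc j)))) (at (p (Suc j)))"
  proof (rule has_field_derivative_transform_within_open[of _ _ _ ?U])
    show "open ?U" by (intro open_Compl finite_imp_closed) auto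
    show "p (Suc j) \<in> ?U" using inj_onD[OF inj, of "Suc j"] j by force
    fix t assume t: "t \<in> ?U"
    have "inj_on (p(Suc j := t)) {1..m}"
    proof (rule inj_onI)
      fix a b assume ab: "a \<in> {1..m}" "b \<in> {1..m}" "(p(Suc j := t)) a = (p(Suc j := t)) b"
      have nt: "p c \<noteq> t" if "c \<in> {1..m}" "c \<noteq> Suc j" for c using t that by blast
      show "a = b"
        using ab nt[of a] nt[of b] inj_onD[OF inj, of a b] by (auto split: if_splits)
    qed
    from pd_group_vdm[OF this j]
    show "group_vdm (p(Suc j := t)) * (\<Sum>l\<in>peers j. 1 / (t - p (Suc l))) = pd (Suc j) group_vdm (p(Suc j := t))"
      by (simp add: vdm_logder_def peers_def)
  qed
  then have "pd (Suc j) (pd (Suc j) group_vdm) p = group_vdm p * ((vdm_logder j p)\<^sup>2 - (\<Sum>l\<in>peers j. 1 / (p (Suc j) - p (Suc l))\<^sup>2))"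
    by (subst pd_eqI) (auto simp: pd_group_vdm[OF inj j] vdm_logder_def sum_negf algebra_simps power2_eq_square)
  also have "(vdm_logder j p)\<^sup>2 = (\<Sum>l\<in>peers j. \<Sum>l'\<in>peers j. 1 / ((p (Suc j) - p (Suc l)) * (p (Suc j) - p (Suc l'))))"
    by (simp add: vdm_logder_def power2_eq_square sum_product)
  also have "\<dots> = (\<Sum>l\<in>peers j. 1 / (p (Suc j) - p (Suc l))\<^sup>2 +
      (\<Sum>l'\<in>peers j - {l}. 1 / ((p (Suc j) - p (Suc l)) * (p (Suc j) - p (Suc l')))))"
    by (intro sum.cong refl) (simp add: sum.remove[OF finite_peers] power2_eq_square)
  finally show ?thesis by (simp add: sum.distrib)
qed

lemma rate_same: "i < m \<Longrightarrow> j < m \<Longrightarrow> grp i = grp j \<Longrightarrow> rate i j p = rate i i p \<and> rate j j p = rate i i p"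
  using same[of i j] by (simp add: rate_def C_def)

text \<open>The off-diagonal products of reciprocals cancel in cyclic triples: 1/((u-v)(u-w)) +
  1/((v-w)(v-u)) + 1/((w-u)(w-v)) = 0. All members of a triple lie in one group and share their
  rate.\<close>

lemma group_vdm_harmonic:
  assumes inj: "inj_on p {1..m}"
  shows "(\<Sum>j<m. rate j j p * pd (Suc j) (pd (Suc j) group_vdm) p) = 0"
proof -
  define R where "R = {(j, l, l') \<in> {..<m} \<times> {..<m} \<times> {..<m}. l \<in> peers j \<and> l' \<in> peers j - {l}}"
  define f where "f = (\<lambda>(j, l, l'). rate j j p / ((p (Suc j) - p (Suc l)) * (p (Suc j) - p (Suc l'))))"
  \<comment> \<open>Rotation of the indices; since it permutes \<open>R\<close>, three times the sum
    is the sum over whole cycles.\<close>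
  define rot where "rot = (\<lambda>(j::nat, l::nat, l'::nat). (l, l', j))"
  have fin: "finite R" by (rule finite_subset[of _ "{..<m} \<times> {..<m} \<times> {..<m}"]) (auto simp: R_def)
  have bij: "bij_betw rot R R"
    by (rule bij_betw_byWitness[of _ "\<lambda>(j, l, l'). (l', j, l)"]) (auto simp: R_def rot_def peers_def)
  have 1: "sum f R = (\<Sum>x\<in>R. f (rot x))" using sum.reindex_bij_betw[OF bij, of f] by simp
  have 2: "\<dots> = (\<Sum>x\<in>R. f (rot (rot x)))"
    using sum.reindex_bij_betw[OF bij, of "\<lambda>x. f (rot x)"] by simp
  have "3 * sum f R = (\<Sum>x\<in>R. f x + f (rot x) + f (rot (rot x)))"
    using 1 2 by (simp add: sum.distrib)
  also have "\<dots> = 0"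
  proof (rule sum.neutral, safe)
    fix a b c assume x: "(a, b, c) \<in> R"
    then have lt: "a < m" "b < m" "c < m" and d: "a \<noteq> b" "a \<noteq> c" "b \<noteq> c"
      and g: "grp a = grp b" "grp a = grp c" by (auto simp: R_def peers_def)
    have n: "p (Suc a) \<noteq> p (Suc b)" "p (Suc a) \<noteq> p (Suc c)" "p (Suc b) \<noteq> p (Suc c)"
      using inj_onD[OF inj, of "Suc a" "Suc b"] inj_onD[OF inj, of "Suc a" "Suc c"]
        inj_onD[OF inj, of "Suc b" "Suc c"] lt d by auto
    have id: "1 / ((u - v) * (u - w)) + 1 / ((v - w) * (v - u)) + 1 / ((w - u) * (w - v)) = (0::complex)"
      if "u \<noteq> v" "u \<noteq> w" "v \<noteq> w" for u v w
      using that by (simp add: divide_simps) (simp add: algebra_simps)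
    have "f (a, b, c) + f (rot (a, b, c)) + f (rot (rot (a, b, c))) = rate a a p *
      (1 / ((p (Suc a) - p (Suc b)) * (p (Suc a) - p (Suc c))) +
       1 / ((p (Suc b) - p (Suc c)) * (p (Suc b) - p (Suc a))) +
       1 / ((p (Suc c) - p (Suc a)) * (p (Suc c) - p (Suc b))))"
      using rate_same[of a b p] rate_same[of a c p] lt g by (simp add: f_def rot_def algebra_simps)
    then show "f (a, b, c) + f (rot (a, b, c)) + f (rot (rot (a, b, c))) = 0"
      using id[OF n] by simp
  qed
  finally have "sum f R = 0" by simp
  moreover have "sum f R = (\<Sum>j<m. \<Sum>l\<in>peers j. \<Sum>l'\<in>peers j - {l}. f (j, l, l'))"
  proof -
    have "R = Sigma {..<m} (\<lambda>j. Sigma (peers j) (\<lambda>l. peers j - {l}))"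
      by (auto simp: R_def peers_def)
    then show ?thesis by (simp add: sum.Sigma finite_peers split_def)
  qed
  moreover have "(\<Sum>j<m. rate j j p * pd (Suc j) (pd (Suc j) group_vdm) p) =
      group_vdm p * (\<Sum>j<m. \<Sum>l\<in>peers j. \<Sum>l'\<in>peers j - {l}. f (j, l, l'))"
    by (simp add: pd_pd_group_vdm[OF inj] f_def sum_distrib_left algebra_simps)
  ultimately show ?thesis by simp
qed

lemma polyfun_mean_prod: "polyfun {..m} (mean_prod TYPE('n::finite))"
proof -
  interpret linear_functional UNIV "ginibre_exp :: (('n \<times> 'n \<times> bool \<Rightarrow> complex) \<Rightarrow> complex) \<Rightarrow> complex"
    by (rule ginibre_linear_functional)
  show ?thesis unfolding mean_prod_def[abs_def] by (rule polyfun_param[OF sep_rest])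
qed

lemma rest_insert:
  assumes "j < m" "j \<notin> S"
  shows "rest S e p = det_at j e p * rest (insert j S) e p"
proof -
  have "{..<m} - insert j S = ({..<m} - S) - {j}" by auto
  then show ?thesis using assms by (simp add: rest_def prod.remove[of "{..<m} - S" j])
qed

text \<open>Two matrices of one group differ by a multiple of the identity, so the resolvent
  identity applies; traces of cofactors are negated derivatives in u.\<close>

lemma cof_trace_rest:
  assumes "j < m" "l < m" "l \<noteq> j" "grp l = grp j"
  shows "(p (Suc j) - p (Suc l)) * (cof_trace j l e p * rest {j, l} e p) =
     pd (Suc l) (rest {} e) p - pd (Suc j) (rest {} e) p"
proof -
  have "mat_at j e p r c - mat_at l e p r c = (if r = c then - (p (Suc j) - p (Suc l)) else 0)" for r c
    using same[of j l] assms by (simp add: mat_at_def C_def)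
  from cof_resolvent[OF this] have
    "- (p (Suc j) - p (Suc l)) * cof_trace j l e p =
       det_at j e p * (\<Sum>r\<in>UNIV. cof_at l r r e p) - det_at l e p * (\<Sum>r\<in>UNIV. cof_at j r r e p)"
    unfolding cof_trace_def cof_at_def det_at_def .
  then have "- (p (Suc j) - p (Suc l)) * cof_trace j l e p * rest {j, l} e p =
     (det_at j e p * (\<Sum>r\<in>UNIV. cof_at l r r e p) - det_at l e p * (\<Sum>r\<in>UNIV. cof_at j r r e p)) * rest {j, l} e p"
    by simp
  moreover have "rest {j} e p = det_at l e p * rest {j, l} e p" "rest {l} e p = det_at j e p * rest {j, l} e p"
    using rest_insert[of l "{j}" e p] rest_insert[of j "{l}" e p] assms by (simp_all add: insert_commute)
  ultimately show ?thesis using assms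
    by (simp add: pd_u_rest algebra_simps)
qed

text \<open>Within a group each product of cofactors is a difference quotient (D l - D j) / (u_j -
  u_l). Exchanging j and l in the terms with D l doubles those with D j, which gives the drift 2
  \<open>vdm_logder\<close>.\<close>

lemma pd_t_mean_prod_heat:
  assumes inj: "inj_on p {1..m}"
  shows "pd 0 (mean_prod TYPE('n::finite)) p =
    - (\<Sum>j<m. rate j j p * (pd (Suc j) (pd (Suc j) (mean_prod TYPE('n))) p + 2 * vdm_logder j p * pd (Suc j) (mean_prod TYPE('n)) p))"
proof -
  let ?\<Lambda> = "ginibre_exp :: (('n \<times> 'n \<times> bool \<Rightarrow> complex) \<Rightarrow> complex) \<Rightarrow> complex"
  interpret linear_functional UNIV ?\<Lambda> by (rule ginibre_linear_functional)
  define D where "D j = pd (Suc j) (mean_prod TYPE('n)) p" for j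
  define Y where "Y j l = ?\<Lambda> (\<lambda>e. cof_trace j l e p * rest {j, l} e p)" for j l
  have P1: "polyfun UNIV (\<lambda>e :: 'n \<times> 'n \<times> bool \<Rightarrow> complex. cof2_trace j e p * rest {j} e p)" if "j < m" for j
    by (intro polyfun.mult sep_imp_polyfun_left[OF sep_cof2_trace[OF that]] sep_imp_polyfun_left[OF sep_rest])
  have P2: "polyfun UNIV (\<lambda>e :: 'n \<times> 'n \<times> bool \<Rightarrow> complex. cof_trace j l e p * rest {j, l} e p)" if "j < m" "l < m" for j l
    by (intro polyfun.mult sep_imp_polyfun_left[OF sep_cof_trace[OF that]] sep_imp_polyfun_left[OF sep_rest])
  have P3: "polyfun UNIV (\<lambda>e :: 'n \<times> 'n \<times> bool \<Rightarrow> complex. pd v (rest {} e) p)" for v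
    by (intro sep_imp_polyfun_left[OF sep_pd[OF sep_rest]])
  have pdQ: "pd (Suc j) (mean_prod TYPE('n)) = (\<lambda>p. ?\<Lambda> (\<lambda>e. pd (Suc j) (rest {} e) p))" for j
    using pd_param[OF sep_rest[of "{}"], of "Suc j"] unfolding mean_prod_def[abs_def] .
  have D: "D j = ?\<Lambda> (\<lambda>e. pd (Suc j) (rest {} e) p)" for j
    unfolding D_def pdQ ..
  have D2: "?\<Lambda> (\<lambda>e. cof2_trace j e p * rest {j} e p) = - pd (Suc j) (pd (Suc j) (mean_prod TYPE('n))) p" if "j < m" for j
  proof -
    have "pd (Suc j) (pd (Suc j) (mean_prod TYPE('n))) p = ?\<Lambda> (\<lambda>e. pd (Suc j) (\<lambda>p. pd (Suc j) (rest {} e) p) p)"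
      unfolding pdQ by (subst pd_param[OF sep_pd[OF sep_rest]]) simp
    also have "\<dots> = ?\<Lambda> (\<lambda>e. - 1 * (cof2_trace j e p * rest {j} e p))"
      by (simp add: pd_uu_rest[OF that])
    also have "\<dots> = - ?\<Lambda> (\<lambda>e. cof2_trace j e p * rest {j} e p)"
      by (subst cmult[OF P1[OF that]]) simp
    finally show ?thesis by simp
  qed
  have Y: "Y j l = (D l - D j) / (p (Suc j) - p (Suc l))" if "j < m" "l \<in> peers j" for j l
  proof -
    have l: "l < m" "l \<noteq> j" "grp l = grp j" using that(2) by (auto simp: peers_def)
    then have ne: "p (Suc j) - p (Suc l) \<noteq> 0" using inj_onD[OF inj, of "Suc j" "Suc l"] that(1) by auto
    have "(p (Suc j) - p (Suc l)) * Y j l = ?\<Lambda> (\<lambda>e. pd (Suc l) (rest {} e) p - pd (Suc j) (rest {} e) p)"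
      unfolding Y_def cmult[OF P2[OF that(1) l(1)], symmetric] cof_trace_rest[OF that(1) l] ..
    also have "\<dots> = D l - D j" unfolding D by (rule diff[OF P3 P3])
    finally show ?thesis using ne by (simp add: field_simps)
  qed
  have Ysym: "Y j l = Y l j" for j l
  proof -
    have "cof_trace j l e p = cof_trace l j e p" for e :: "'n \<times> 'n \<times> bool \<Rightarrow> complex"
      unfolding cof_trace_def by (subst sum.swap) (simp add: mult.commute)
    then show ?thesis by (simp add: Y_def insert_commute)
  qed
  have "pd 0 (mean_prod TYPE('n)) p = (\<Sum>j<m. rate j j p * ?\<Lambda> (\<lambda>e. cof2_trace j e p * rest {j} e p) +
     (\<Sum>l\<in>{..<m} - {j}. rate j l p * Y j l))"
  proof -
    define F where "F j e = rate j j p * (cof2_trace j e p * rest {j} e p) +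
       (\<Sum>l\<in>{..<m} - {j}. rate j l p * (cof_trace j l e p * rest {j, l} e p))" for j and e :: "'n \<times> 'n \<times> bool \<Rightarrow> complex"
    have p2: "polyfun UNIV (\<lambda>e :: 'n \<times> 'n \<times> bool \<Rightarrow> complex. rate j l p * (cof_trace j l e p * rest {j, l} e p))" if "j < m" "l \<in> {..<m} - {j}" for j l
      using that by (auto intro: polyfun_cmult P2)
    have p1: "polyfun UNIV (\<lambda>e :: 'n \<times> 'n \<times> bool \<Rightarrow> complex. rate j j p * (cof2_trace j e p * rest {j} e p))" if "j < m" for j
      using that by (auto intro: polyfun_cmult P1)
    have pF: "polyfun UNIV (F j)" if "j < m" for j
      unfolding F_def[abs_def] using that by (intro polyfun.add polyfun_sum p1 p2)
    have "pd 0 (mean_prod TYPE('n)) p = ?\<Lambda> (\<lambda>e. \<Sum>j<m. F j e)" unfolding pd_t_mean_prod F_def ..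
    also have "\<dots> = (\<Sum>j<m. ?\<Lambda> (F j))" by (rule sum) (auto intro: pF)
    also have "\<dots> = (\<Sum>j<m. rate j j p * ?\<Lambda> (\<lambda>e. cof2_trace j e p * rest {j} e p) +
      (\<Sum>l\<in>{..<m} - {j}. rate j l p * Y j l))"
    proof (rule sum.cong[OF refl])
      fix j assume "j \<in> {..<m}"
      then have j: "j < m" by simp
      have "?\<Lambda> (F j) = ?\<Lambda> (\<lambda>e. rate j j p * (cof2_trace j e p * rest {j} e p)) +
          ?\<Lambda> (\<lambda>e. \<Sum>l\<in>{..<m} - {j}. rate j l p * (cof_trace j l e p * rest {j, l} e p))"
        unfolding F_def[abs_def] by (intro add p1 polyfun_sum p2 j)
      also have "?\<Lambda> (\<lambda>e. rate j j p * (cof2_trace j e p * rest {j} e p)) = rate j j p * ?\<Lambda> (\<lambda>e. cof2_trace j e p * rest {j} e p)"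
        by (rule cmult[OF P1[OF j]])
      also have "?\<Lambda> (\<lambda>e. \<Sum>l\<in>{..<m} - {j}. rate j l p * (cof_trace j l e p * rest {j, l} e p))
         = (\<Sum>l\<in>{..<m} - {j}. ?\<Lambda> (\<lambda>e. rate j l p * (cof_trace j l e p * rest {j, l} e p)))"
        by (rule sum) (rule p2[OF j])
      also have "\<dots> = (\<Sum>l\<in>{..<m} - {j}. rate j l p * Y j l)"
        unfolding Y_def by (intro sum.cong refl cmult P2 j) auto
      finally show "?\<Lambda> (F j) = rate j j p * ?\<Lambda> (\<lambda>e. cof2_trace j e p * rest {j} e p) +
        (\<Sum>l\<in>{..<m} - {j}. rate j l p * Y j l)" .
    qed
    finally show ?thesis .
  qed
  also have "\<dots> = (\<Sum>j<m. rate j j p * ?\<Lambda> (\<lambda>e. cof2_trace j e p * rest {j} e p)) +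
     (\<Sum>j<m. \<Sum>l\<in>{..<m} - {j}. rate j l p * Y j l)"
    by (simp add: sum.distrib)
  also have "(\<Sum>j<m. \<Sum>l\<in>{..<m} - {j}. rate j l p * Y j l) =
     (\<Sum>j<m. (\<Sum>l\<in>peers j. rate j l p * Y j l) + (\<Sum>l\<in>{l\<in>{..<m}. grp l \<noteq> grp j}. rate j l p * Y j l))"
  proof (rule sum.cong[OF refl])
    fix j
    have "{..<m} - {j} = peers j \<union> {l\<in>{..<m}. grp l \<noteq> grp j}" by (auto simp: peers_def)
    then show "(\<Sum>l\<in>{..<m} - {j}. rate j l p * Y j l) =
      (\<Sum>l\<in>peers j. rate j l p * Y j l) + (\<Sum>l\<in>{l\<in>{..<m}. grp l \<noteq> grp j}. rate j l p * Y j l)"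
      by (simp only:) (rule sum.union_disjoint, auto simp: peers_def)
  qed
  also have "\<dots> = (\<Sum>j<m. \<Sum>l\<in>peers j. rate j l p * Y j l) + (\<Sum>j<m. \<Sum>l\<in>{l\<in>{..<m}. grp l \<noteq> grp j}. rate j l p * Y j l)"
    by (rule sum.distrib)
  \<comment> \<open>Constant covariance between the groups makes the rate antisymmetric there, while
    \<open>Y\<close> is symmetric; hence the sum equals its own negative.\<close>
  also have "(\<Sum>j<m. \<Sum>l\<in>{l\<in>{..<m}. grp l \<noteq> grp j}. rate j l p * Y j l) = 0" (is "?X = 0")
  proof -
    have "?X = (\<Sum>l<m. \<Sum>j | j \<in> {..<m} \<and> grp l \<noteq> grp j. rate j l p * Y j l)"
      by (rule sum.swap_restrict) auto
    also have "\<dots> = (\<Sum>l<m. \<Sum>j | j \<in> {..<m} \<and> grp j \<noteq> grp l. - (rate l j p * Y l j))"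
    proof (intro sum.cong refl)
      fix l j assume "l \<in> {..<m}" "j \<in> {j. j \<in> {..<m} \<and> grp j \<noteq> grp l}"
      then have "rate j l p + rate l j p = 0" using cross[of j l "p 0"] by (simp add: rate_def C_def)
      then have "rate j l p = - rate l j p" by (simp add: eq_neg_iff_add_eq_0)
      then show "rate j l p * Y j l = - (rate l j p * Y l j)" using Ysym[of j l] by simp
    qed auto
    also have "\<dots> = - ?X" by (simp add: sum_negf)
    finally show ?thesis by simp
  qed
  also have "(\<Sum>j<m. \<Sum>l\<in>peers j. rate j l p * Y j l) =
     (\<Sum>j<m. \<Sum>l\<in>peers j. rate j j p * D l / (p (Suc j) - p (Suc l))) - (\<Sum>j<m. \<Sum>l\<in>peers j. rate j j p * D j / (p (Suc j) - p (Suc l)))"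
    unfolding sum_subtractf[symmetric]
  proof (intro sum.cong refl)
    fix j l assume j: "j \<in> {..<m}" and l: "l \<in> peers j"
    then have "rate j l p = rate j j p" using rate_same[of j l p] by (auto simp: peers_def)
    then show "rate j l p * Y j l = rate j j p * D l / (p (Suc j) - p (Suc l)) - rate j j p * D j / (p (Suc j) - p (Suc l))"
      using Y[of j l] j l by (simp add: right_diff_distrib diff_divide_distrib)
  qed
  also have "(\<Sum>j<m. \<Sum>l\<in>peers j. rate j j p * D l / (p (Suc j) - p (Suc l))) =
     (\<Sum>j<m. \<Sum>l\<in>peers j. rate l l p * D j / (p (Suc l) - p (Suc j)))"
    by (rule sum_peers_swap)
  also have "\<dots> = - (\<Sum>j<m. \<Sum>l\<in>peers j. rate j j p * D j / (p (Suc j) - p (Suc l)))"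
    unfolding sum_negf[symmetric]
  proof (intro sum.cong refl)
    fix j l assume j: "j \<in> {..<m}" and l: "l \<in> peers j"
    then have "rate l l p = rate j j p" using rate_same[of j l p] by (auto simp: peers_def)
    then show "rate l l p * D j / (p (Suc l) - p (Suc j)) = - (rate j j p * D j / (p (Suc j) - p (Suc l)))"
      by (metis minus_diff_eq minus_divide_right)
  qed
  also have "(\<Sum>j<m. \<Sum>l\<in>peers j. rate j j p * D j / (p (Suc j) - p (Suc l))) = (\<Sum>j<m. rate j j p * (vdm_logder j p * D j))"
    by (simp add: vdm_logder_def sum_distrib_left sum_distrib_right)
  also have "(\<Sum>j<m. rate j j p * ?\<Lambda> (\<lambda>e. cof2_trace j e p * rest {j} e p)) = - (\<Sum>j<m. rate j j p * pd (Suc j) (pd (Suc j) (mean_prod TYPE('n))) p)"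
    unfolding sum_negf[symmetric] by (intro sum.cong) (auto simp: D2)
  finally show ?thesis
    by (simp add: D_def sum.distrib sum_distrib_left sum_negf algebra_simps)
qed

definition vdm_mean :: "'n::finite itself \<Rightarrow> (nat \<Rightarrow> complex) \<Rightarrow> complex" where
  "vdm_mean T p = group_vdm p * mean_prod T p"

lemma polyfun_vdm_mean: "polyfun {..m} (vdm_mean TYPE('n::finite))"
  unfolding vdm_mean_def[abs_def] by (intro polyfun.mult polyfun_mean_prod polyfun_mono[OF polyfun_group_vdm]) auto

text \<open>V (Q'' + 2 (V'/V) Q') = (V Q)'' - V'' Q in each coordinate, and the terms with V'' add
  up to 0 by harmonicity. So the factor V removes the drift.\<close>

lemma vdm_mean_heat:
  "pd 0 (vdm_mean TYPE('n::finite)) = (\<lambda>p. \<Sum>v\<in>{1..m}. - rate (v - 1) (v - 1) p * pd v (pd v (vdm_mean TYPE('n))) p)"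
proof
  fix p
  let ?Q = "mean_prod TYPE('n)"
  note pV = polyfun_mono[OF polyfun_group_vdm, of "{..m}", simplified] and pQ = polyfun_mean_prod[where 'n = 'n]
  have main: "pd 0 (vdm_mean TYPE('n)) p = (\<Sum>v\<in>{1..m}. - rate (v - 1) (v - 1) p * pd v (pd v (vdm_mean TYPE('n))) p)"
    if inj: "inj_on p {1..m}" for p
  proof -
    have pd1: "pd v (vdm_mean TYPE('n)) = (\<lambda>p. pd v group_vdm p * ?Q p + group_vdm p * pd v ?Q p)" for v
      unfolding vdm_mean_def[abs_def] by (rule pd_mult[OF pV pQ])
    have q: "polyfun {..m} (\<lambda>p. pd v group_vdm p * ?Q p)" "polyfun {..m} (\<lambda>p. group_vdm p * pd v ?Q p)" for v
      using pV pQ polyfun_pd by (auto intro!: polyfun.mult)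
    have pd2: "pd (Suc j) (pd (Suc j) (vdm_mean TYPE('n))) p = pd (Suc j) (pd (Suc j) group_vdm) p * ?Q p
      + group_vdm p * (pd (Suc j) (pd (Suc j) ?Q) p + 2 * vdm_logder j p * pd (Suc j) ?Q p)" if "j < m" for j
      unfolding pd1
      by (subst pd_add[OF q], subst pd_mult[OF polyfun_pd[OF pV] pQ], subst pd_mult[OF pV polyfun_pd[OF pQ]])
        (simp add: pd_group_vdm[OF inj that] algebra_simps)
    have "pd 0 (vdm_mean TYPE('n)) p = group_vdm p * pd 0 ?Q p"
      unfolding pd1 using pd_notin[OF polyfun_group_vdm, of 0] by simp
    also have "\<dots> = - (\<Sum>j<m. rate j j p * (pd (Suc j) (pd (Suc j) group_vdm) p)) * ?Q p
       - group_vdm p * (\<Sum>j<m. rate j j p * (pd (Suc j) (pd (Suc j) ?Q) p + 2 * vdm_logder j p * pd (Suc j) ?Q p))"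
      unfolding group_vdm_harmonic[OF inj] pd_t_mean_prod_heat[OF inj] by simp
    also have "\<dots> = (\<Sum>j<m. - rate j j p * pd (Suc j) (pd (Suc j) (vdm_mean TYPE('n))) p)"
      by (simp add: pd2 sum_distrib_left sum_distrib_right sum_negf sum.distrib[symmetric] algebra_simps)
    also have "\<dots> = (\<Sum>v\<in>{1..m}. - rate (v - 1) (v - 1) p * pd v (pd v (vdm_mean TYPE('n))) p)"
      by (rule sum.reindex_bij_witness[of _ "\<lambda>v. v - 1" Suc]) auto
    finally show ?thesis .
  qed
  \<comment> \<open>Both sides are polynomials, so the identity extends from distinct to arbitrary
    coordinates.\<close>
  show "pd 0 (vdm_mean TYPE('n)) p = (\<Sum>v\<in>{1..m}. - rate (v - 1) (v - 1) p * pd v (pd v (vdm_mean TYPE('n))) p)"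
  proof (rule polyfun_eq_if_eq_on_inj[where V = "{..m}" and W = "{..m}"
        and S = "{1..m}" and f = "pd 0 (vdm_mean TYPE('n))"
        and g = "\<lambda>p. \<Sum>v = 1..m. - rate (v - 1) (v - 1) p * pd v (pd v (vdm_mean TYPE('n))) p"])
    show "polyfun {..m} (pd 0 (vdm_mean TYPE('n)))" by (intro polyfun_pd polyfun_vdm_mean)
    show "polyfun {..m} (\<lambda>p. \<Sum>v = 1..m. - rate (v - 1) (v - 1) p * pd v (pd v (vdm_mean TYPE('n))) p)"
      by (intro polyfun_sum polyfun.mult polyfun_minus polyfun_pd polyfun_vdm_mean polyfun_mono[OF polyfun_rate]) auto
  qed (use main in auto)
qed

end

subsection \<open>Determinants of monic polynomials\<close>

definition pdet :: "nat \<Rightarrow> (nat \<Rightarrow> nat \<Rightarrow> 'a::comm_ring_1) \<Rightarrow> 'a" where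
  "pdet n F = (\<Sum>\<pi> | \<pi> permutes {..<n}. of_int (sign \<pi>) * (\<Prod>i<n. F i (\<pi> i)))"

lemma pdet_eq: "pdet n F = Determinant.det (Matrix.mat n n (\<lambda>(i, j). F i j))"
proof -
  have "Determinant.det (Matrix.mat n n (\<lambda>(i, j). F i j)) = (\<Sum>\<pi> | \<pi> permutes {0..<n}. of_int (sign \<pi>) *
      (\<Prod>i = 0..<n. Matrix.mat n n (\<lambda>(i, j). F i j) $$ (i, \<pi> i)))"
    by (rule det_def') simp
  also have "\<dots> = (\<Sum>\<pi> | \<pi> permutes {0..<n}. of_int (sign \<pi>) * (\<Prod>i = 0..<n. F i (\<pi> i)))"
    by (intro sum.cong refl arg_cong2[of _ _ _ _ "(*)"] prod.cong) (auto dest: permutes_in_image)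
  finally show ?thesis by (simp add: pdet_def atLeast0LessThan)
qed

definition vdm :: "nat \<Rightarrow> (nat \<Rightarrow> 'a::comm_ring_1) \<Rightarrow> 'a" where
  "vdm n y = (\<Prod>j<n. \<Prod>i<j. y j - y i)"

text \<open>In the Newton basis for the nodes y the matrix of values at y is triangular.\<close>

lemma newton_expansion:
  fixes y :: "nat \<Rightarrow> 'a::idom"
  assumes "degree p \<le> n"
  shows "\<exists>c. c n = coeff p n \<and> (\<forall>x. poly p x = (\<Sum>l\<le>n. c l * (\<Prod>i<l. x - y i)))"
  using assms
proof (induction n arbitrary: p)
  case 0
  then obtain a where "p = [:a:]" by (metis degree_eq_zeroE le_zero_eq)
  then show ?case by (intro exI[of _ "\<lambda>_. a"]) simp
next
  case (Suc n)
  define q where "q = (\<Prod>i<Suc n. [:- y i, 1:])"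
  have dq: "degree q = Suc n" unfolding q_def by (subst degree_prod_eq_sum_degree) auto
  have lq: "coeff q (Suc n) = 1"
    using lead_coeff_prod[of "\<lambda>i. [:- y i, 1:]" "{..<Suc n}"] dq by (simp add: q_def del: prod.lessThan_Suc)
  have pq: "poly q x = (\<Prod>i<Suc n. x - y i)" for x
    unfolding q_def poly_prod by simp
  define r where "r = p - Polynomial.smult (coeff p (Suc n)) q"
  have "degree r \<le> Suc n" unfolding r_def
    by (rule degree_diff_le) (use Suc.prems dq degree_smult_le[of "coeff p (Suc n)" q] in auto)
  moreover have "coeff r (Suc n) = 0" by (simp add: r_def lq)
  ultimately have "degree r \<le> n" by (metis Suc_leI coeff_0 leading_coeff_0_iff le_Suc_eq degree_0 zero_le)
  from Suc.IH[OF this] obtain c where c: "\<And>x. poly r x = (\<Sum>l\<le>n. c l * (\<Prod>i<l. x - y i))" by blast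
  have "poly p x = poly r x + coeff p (Suc n) * poly q x" for x by (simp add: r_def)
  then show ?case
    by (intro exI[of _ "\<lambda>l. if l = Suc n then coeff p (Suc n) else c l"]) (simp add: c pq)
qed

text \<open>Passing to the Newton basis is a unitriangular change of columns. The lemma applies
  alike to powers and to Hermite polynomials, which therefore have the same determinant.\<close>

lemma pdet_monic:
  fixes y :: "nat \<Rightarrow> 'a::idom"
  assumes P: "\<And>j. j < n \<Longrightarrow> degree (P j) = j \<and> coeff (P j) j = 1"
  shows "pdet n (\<lambda>i j. poly (P j) (y i)) = vdm n y"
proof -
  define Q where "Q l x = (\<Prod>i<l. x - y i)" for l x
  have "\<forall>j. \<exists>c. j < n \<longrightarrow> c j = 1 \<and> (\<forall>x. poly (P j) x = (\<Sum>l\<le>j. c l * Q l x))"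
    using newton_expansion[of "P _" _ y] P unfolding Q_def by (metis order_refl)
  then obtain c where c: "\<And>j. j < n \<Longrightarrow> c j j = 1"
    "\<And>j x. j < n \<Longrightarrow> poly (P j) x = (\<Sum>l\<le>j. c j l * Q l x)" by metis
  define A where "A = Matrix.mat n n (\<lambda>(i, j). Q j (y i))"
  define T where "T = Matrix.mat n n (\<lambda>(l, j). if l \<le> j then c j l else 0)"
  have A: "A \<in> carrier_mat n n" and T: "T \<in> carrier_mat n n" by (simp_all add: A_def T_def)
  have "Matrix.mat n n (\<lambda>(i, j). poly (P j) (y i)) = A * T"
  proof (rule eq_matI)
    fix i j assume "i < dim_row (A * T)" "j < dim_col (A * T)"
    then have ij: "i < n" "j < n" using A T by auto
    have "(A * T) $$ (i, j) = (\<Sum>l = 0..<n. Q l (y i) * (if l \<le> j then c j l else 0))"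
      using ij by (simp add: A_def T_def scalar_prod_def)
    also have "\<dots> = (\<Sum>l\<le>j. c j l * Q l (y i))"
      by (rule sum.mono_neutral_cong_right) (use ij in auto)
    finally show "Matrix.mat n n (\<lambda>(i, j). poly (P j) (y i)) $$ (i, j) = (A * T) $$ (i, j)"
      using ij c(2)[of j "y i"] by simp
  qed (use A T in auto)
  then have "pdet n (\<lambda>i j. poly (P j) (y i)) = Determinant.det A * Determinant.det T"
    by (simp add: pdet_eq det_mult[OF A T])
  also have "Determinant.det T = 1"
    by (subst det_upper_triangular[OF _ T]) (auto simp: T_def prod_list_diag_prod c(1) intro!: prod.neutral)
  also have "Determinant.det A = (\<Prod>j<n. Q j (y j))"
    by (subst det_lower_triangular[OF _ A])
      (auto simp: A_def prod_list_diag_prod Q_def atLeast0LessThan intro!: prod_zero)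
  finally show ?thesis by (simp add: vdm_def Q_def)
qed

lemma prod_lessThan_add: "(\<Prod>i<a + b. f i) = (\<Prod>i<a. f i) * (\<Prod>i<b. f (a + i))" for f :: "nat \<Rightarrow> 'a::comm_monoid_mult"
  by (induction b) (simp_all add: mult.assoc)

lemma vdm_add: "vdm (a + b) y = vdm a y * vdm b (\<lambda>i. y (a + i)) * (\<Prod>j<b. \<Prod>i<a. y (a + j) - y i)"
proof (induction b)
  case (Suc b)
  have "vdm (a + Suc b) y = vdm (a + b) y * (\<Prod>i<a + b. y (a + b) - y i)"
    by (simp add: vdm_def)
  then show ?case unfolding Suc prod_lessThan_add by (simp add: vdm_def mult_ac)
qed (simp add: vdm_def)

subsection \<open>Hermite polynomials of variable variance\<close>

text \<open>The monic Hermite polynomials of a centred Gaussian with variance s. They are polynomial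
  in s as well, so complex variances are allowed and s = 0 gives the powers of z.\<close>

fun He :: "nat \<Rightarrow> complex \<Rightarrow> complex \<Rightarrow> complex" where
  "He 0 s z = 1"
| "He (Suc 0) s z = z"
| "He (Suc (Suc l)) s z = z * He (Suc l) s z - s * of_nat (Suc l) * He l s z"

lemma He_Suc: "He (Suc l) s z = z * He l s z - s * of_nat l * He (l - 1) s z"
  by (cases l) auto

lemma He_0_var: "He l 0 z = z ^ l"
  by (induction l "0::complex" z rule: He.induct) auto

lemma He_deriv_z: "((\<lambda>z. He l s z) has_field_derivative of_nat l * He (l - 1) s z) (at z)"
proof (induction l s z rule: He.induct)
  case (3 l s z)
  have "((\<lambda>z. He (Suc (Suc l)) s z) has_field_derivative
     (z * (of_nat (Suc l) * He l s z) + He (Suc l) s z) - s * of_nat (Suc l) * (of_nat l * He (l - 1) s z)) (at z)"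
    unfolding He.simps(3)
    by (rule derivative_eq_intros 3[simplified] refl)+ simp
  also have "(z * (of_nat (Suc l) * He l s z) + He (Suc l) s z) - s * of_nat (Suc l) * (of_nat l * He (l - 1) s z)
     = of_nat (Suc l) * (z * He l s z - s * of_nat l * He (l - 1) s z) + He (Suc l) s z"
    by (simp add: algebra_simps)
  also have "\<dots> = of_nat (Suc (Suc l)) * He (Suc l) s z"
    unfolding He_Suc[of l s z, symmetric] by (simp add: algebra_simps)
  finally show ?case by simp
qed auto

text \<open>Together with \<open>He_deriv_z\<close> this is the backward heat equation: the
  s-derivative is -1/2 times the second z-derivative. Truncated indices come with vanishing
  factors.\<close>

lemma He_deriv_s:
  "((\<lambda>s. He l s z) has_field_derivative - (of_nat l * of_nat (l - 1) / 2) * He (l - 2) s z) (at s)"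
proof (induction l s z rule: He.induct)
  case (3 l s z)
  have "((\<lambda>s. He (Suc (Suc l)) s z) has_field_derivative
     z * (- (of_nat (Suc l) * of_nat l / 2) * He (l - 1) s z) -
      ((s * of_nat (Suc l)) * (- (of_nat l * of_nat (l - 1) / 2) * He (l - 2) s z) + of_nat (Suc l) * He l s z)) (at s)"
    unfolding He.simps(3)
    using 3 by (auto intro!: derivative_eq_intros simp: algebra_simps)
  also have "z * (- (of_nat (Suc l) * of_nat l / 2) * He (l - 1) s z) -
      ((s * of_nat (Suc l)) * (- (of_nat l * of_nat (l - 1) / 2) * He (l - 2) s z) + of_nat (Suc l) * He l s z)
     = - (of_nat (Suc l) * of_nat l / 2) * (z * He (l - 1) s z - s * of_nat (l - 1) * He (l - 2) s z) - of_nat (Suc l) * He l s z"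
    by (simp add: algebra_simps)
  also have "\<dots> = - (of_nat (Suc l) / 2) * (of_nat l * (z * He (l - 1) s z - s * of_nat (l - 1) * He (l - 2) s z)) - of_nat (Suc l) * He l s z"
    by simp
  also have "of_nat l * (z * He (l - 1) s z - s * of_nat (l - 1) * He (l - 2) s z) = of_nat l * He l s z"
    by (cases l) (simp_all add: He_Suc numeral_2_eq_2)
  also have "- (of_nat (Suc l) / 2) * (of_nat l * He l s z) - of_nat (Suc l) * He l s z
     = - (of_nat (Suc (Suc l)) * of_nat (Suc l) / 2) * He l s z"
    by (simp add: field_simps)
  finally show ?case by (simp add: numeral_2_eq_2)
qed auto

fun Hp :: "nat \<Rightarrow> complex poly" where
  "Hp 0 = 1"
| "Hp (Suc 0) = [:0, 1:]"
| "Hp (Suc (Suc l)) = pCons 0 (Hp (Suc l)) - Polynomial.smult (of_nat (Suc l)) (Hp l)"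

lemma poly_Hp: "poly (Hp l) z = He l 1 z"
  by (induction l rule: Hp.induct) simp_all

lemma Hp_monic: "degree (Hp l) = l \<and> coeff (Hp l) l = 1"
proof (induction l rule: Hp.induct)
  case (3 l)
  have z: "coeff (Hp l) (Suc (Suc l)) = 0" using 3 by (intro coeff_eq_0) auto
  have "degree (Hp (Suc (Suc l))) \<le> Suc (Suc l)"
    using 3 by (auto intro!: degree_diff_le order.trans[OF degree_pCons_le] order.trans[OF degree_smult_le])
  moreover have "coeff (Hp (Suc (Suc l))) (Suc (Suc l)) = 1" using 3 z by simp
  ultimately show ?case by (metis le_degree zero_neq_one antisym)
qed auto

lemma pdet_He: "pdet n (\<lambda>i j. He j 1 (y i)) = vdm n y"
  using pdet_monic[of n Hp y] Hp_monic by (simp add: poly_Hp)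

lemma pdet_power: "pdet n (\<lambda>i j. y i ^ j) = vdm n y" for y :: "nat \<Rightarrow> complex"
  using pdet_monic[of n "monom 1" y] by (simp add: poly_monom degree_monom_eq)

lemma polyfun_He: "polyfun V f \<Longrightarrow> polyfun V g \<Longrightarrow> polyfun V (\<lambda>x. He l (f x) (g x))"
  by (induction l "0::complex" "0::complex" rule: He.induct) (auto intro!: polyfun_intros)

text \<open>Each step lowers one degree on either side and produces the factor b j. The induction is
  on the sum of the degrees a.\<close>

lemma hermite_orthogonal:
  assumes "finite I"
  shows "gauss_exp 1 I (\<lambda>x. \<Prod>i\<in>I. He (a i) 1 (x i) * He (b i) 1 (x i)) =
     (\<Prod>i\<in>I. if a i = b i then fact (a i) else 0)"
proof (induction "\<Sum>i\<in>I. a i" arbitrary: a b)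
  interpret linear_functional I "gauss_exp 1 I" using assms by (intro gauss_linear_functional) auto
  have He_p: "polyfun I (\<lambda>x. He l 1 (x i))" if "i \<in> I" for l i
    using that by (intro polyfun_He polyfun.intros)
  have pd_He: "pd i (\<lambda>x. He l 1 (x i)) = (\<lambda>x. of_nat l * He (l - 1) 1 (x i))" for l i
    by (rule ext, rule pd_eqI, unfold fun_upd_same, rule He_deriv_z)
  \<comment> \<open>\<open>He (Suc l)\<close> is x \<open>He l\<close> minus its derivative, and
    this raising operator is adjoint to differentiation by integration by parts.\<close>
  have step: "gauss_exp 1 I (\<lambda>x. He (Suc l) 1 (x i) * R x) = gauss_exp 1 I (\<lambda>x. He l 1 (x i) * pd i R x)"
    if i: "i \<in> I" and R: "polyfun I R" for i l R
  proof -
    have "gauss_exp 1 I (\<lambda>x. x i * (He l 1 (x i) * R x)) = gauss_exp 1 I (pd i (\<lambda>x. He l 1 (x i) * R x))"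
      using gauss_stein[OF polyfun.mult[OF He_p[OF i] R] assms _ i, of 1] by simp
    also have "pd i (\<lambda>x. He l 1 (x i) * R x) = (\<lambda>x. of_nat l * (He (l - 1) 1 (x i) * R x) + He l 1 (x i) * pd i R x)"
      by (simp add: pd_mult[OF He_p[OF i] R] pd_He mult.assoc)
    also have "gauss_exp 1 I \<dots> = of_nat l * gauss_exp 1 I (\<lambda>x. He (l - 1) 1 (x i) * R x) + gauss_exp 1 I (\<lambda>x. He l 1 (x i) * pd i R x)"
      by (subst add) (auto intro!: polyfun.mult polyfun.const He_p i R polyfun_pd simp: gauss_exp_cmult)
    finally have 1: "gauss_exp 1 I (\<lambda>x. x i * (He l 1 (x i) * R x)) =
       of_nat l * gauss_exp 1 I (\<lambda>x. He (l - 1) 1 (x i) * R x) + gauss_exp 1 I (\<lambda>x. He l 1 (x i) * pd i R x)" .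
    have "(\<lambda>x. He (Suc l) 1 (x i) * R x) =
        (\<lambda>x. x i * (He l 1 (x i) * R x) - of_nat l * (He (l - 1) 1 (x i) * R x))"
      by (simp add: He_Suc algebra_simps)
    then have "gauss_exp 1 I (\<lambda>x. He (Suc l) 1 (x i) * R x) =
        gauss_exp 1 I (\<lambda>x. x i * (He l 1 (x i) * R x)) - gauss_exp 1 I (\<lambda>x. of_nat l * (He (l - 1) 1 (x i) * R x))"
      by simp (rule diff, auto intro!: polyfun.mult polyfun.const polyfun.var He_p i R)
    then show ?thesis using 1 by (simp add: gauss_exp_cmult)
  qed
  define W where "W a b = (\<lambda>x. \<Prod>i\<in>I. He (a i) 1 (x i) * He (b i) 1 (x i))" for a b :: "'a \<Rightarrow> nat"
  define W' where "W' j a b = (\<lambda>x. \<Prod>i\<in>I - {j}. He (a i) 1 (x i) * He (b i) 1 (x i))" for j and a b :: "'a \<Rightarrow> nat"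
  have W: "W a b = (\<lambda>x. He (a j) 1 (x j) * (He (b j) 1 (x j) * W' j a b x))" if "j \<in> I" for j a b
    using that assms by (simp add: W_def W'_def prod.remove mult.assoc)
  have W'p: "polyfun (I - {j}) (W' j a b)" for j a b
    unfolding W'_def by (intro polyfun_prod polyfun.mult polyfun_He polyfun.intros)
  have W'I: "polyfun I (W' j a b)" for j a b using polyfun_mono[OF W'p] by blast
  have red: "gauss_exp 1 I (W a b) = of_nat (b j) * gauss_exp 1 I (W (a(j := l)) (b(j := b j - 1)))"
    if j: "j \<in> I" and aj: "a j = Suc l" for a b j l
  proof -
    have p: "polyfun I (\<lambda>x. He (b j) 1 (x j) * W' j a b x)" by (intro polyfun.mult He_p j W'I)
    have "gauss_exp 1 I (W a b) = gauss_exp 1 I (\<lambda>x. He l 1 (x j) * pd j (\<lambda>x. He (b j) 1 (x j) * W' j a b x) x)"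
      unfolding W[OF j] aj by (rule step[OF j p])
    also have "pd j (\<lambda>x. He (b j) 1 (x j) * W' j a b x) = (\<lambda>x. of_nat (b j) * He (b j - 1) 1 (x j) * W' j a b x)"
      using pd_notin[OF W'p, of j] by (simp add: pd_mult[OF He_p[OF j] W'I] pd_He)
    also have "(\<lambda>x. He l 1 (x j) * (of_nat (b j) * He (b j - 1) 1 (x j) * W' j a b x)) =
       (\<lambda>x. of_nat (b j) * W (a(j := l)) (b(j := b j - 1)) x)"
      by (simp add: W[OF j] W'_def algebra_simps)
    finally show ?thesis by (simp add: gauss_exp_cmult)
  qed
  {
    case 0
    then have a0: "\<And>i. i \<in> I \<Longrightarrow> a i = 0" using assms by simp
    show ?case
    proof (cases "\<forall>i\<in>I. b i = 0")
      case True
      have "gauss_exp 1 I (\<lambda>x. 1) = 1" using gauss_prod(2)[OF assms, of 1 "\<lambda>_. 0"] by (simp add: gauss_moment_def)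
      then show ?thesis using True a0 by (simp cong: prod.cong)
    next
      case False
      then obtain j l where j: "j \<in> I" "b j = Suc l" by (auto simp: gr0_conv_Suc)
      \<comment> \<open>With all a equal to 0 the reduction is run on b instead; its factor a j is
        then 0.\<close>
      have "W a b = W b a" by (simp add: W_def mult.commute)
      moreover have "gauss_exp 1 I (W b a) = of_nat (a j) * gauss_exp 1 I (W (b(j := l)) (a(j := a j - 1)))"
        by (rule red) (rule j)+
      ultimately have "gauss_exp 1 I (W a b) = 0" using a0[OF j(1)] by simp
      moreover have "(\<Prod>i\<in>I. if a i = b i then fact (a i) else 0) = (0::complex)"
        using j a0[OF j(1)] assms by (intro prod_zero bexI[of _ j]) auto
      ultimately show ?thesis unfolding W_def by metis
    qed
  next
    case (Suc s)
    then have "(\<Sum>i\<in>I. a i) \<noteq> 0" by simp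
    then obtain j where j: "j \<in> I" "a j \<noteq> 0" using assms by auto
    then obtain l where l: "a j = Suc l" using not0_implies_Suc by blast
    define a' b' where "a' = a(j := l)" and "b' = b(j := b j - 1)"
    have "(\<Sum>i\<in>I. a i) = Suc (\<Sum>i\<in>I. a' i)"
      using assms j l by (simp add: a'_def sum.remove[of I j])
    then have "gauss_exp 1 I (W a' b') = (\<Prod>i\<in>I. if a' i = b' i then fact (a' i) else 0)"
      unfolding W_def using Suc by simp
    then have "gauss_exp 1 I (W a b) = of_nat (b j) * (\<Prod>i\<in>I. if a' i = b' i then fact (a' i) else 0)"
    proof -
      have "gauss_exp 1 I (W a b) = of_nat (b j) * gauss_exp 1 I (W (a(j := l)) (b(j := b j - 1)))"
        by (rule red) (rule j(1), rule l)
      then show ?thesis using \<open>gauss_exp 1 I (W a' b') = _\<close> by (simp add: a'_def b'_def)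
    qed
    also have "(\<Prod>i\<in>I. if a' i = b' i then fact (a' i) else (0::complex)) =
       (if l = b j - 1 then fact l else 0) * (\<Prod>i\<in>I - {j}. if a i = b i then fact (a i) else 0)"
    proof -
      have "(\<Prod>i\<in>I - {j}. if a' i = b' i then fact (a' i) else (0::complex)) =
         (\<Prod>i\<in>I - {j}. if a i = b i then fact (a i) else 0)"
        by (intro prod.cong) (auto simp: a'_def b'_def)
      then show ?thesis using assms j
        by (subst prod.remove[of I j]) (simp_all add: a'_def b'_def)
    qed
    also have "of_nat (b j) * ((if l = b j - 1 then fact l else 0) * (\<Prod>i\<in>I - {j}. if a i = b i then fact (a i) else 0))
       = (if a j = b j then fact (a j) else 0) * (\<Prod>i\<in>I - {j}. if a i = b i then fact (a i) else (0::complex))"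
      using l by (cases "b j") (auto simp: algebra_simps)
    also have "\<dots> = (\<Prod>i\<in>I. if a i = b i then fact (a i) else 0)"
      using assms j by (simp add: prod.remove[of I j])
    finally show ?case unfolding W_def .
  }
qed

subsection \<open>Pairs of permutations agreeing on an initial segment\<close>

lemma permutes_agreeing:
  assumes \<sigma>: "\<sigma> permutes U" and A: "A \<subseteq> U"
  shows "{\<tau>. \<tau> permutes U \<and> (\<forall>i\<in>A. \<tau> i = \<sigma> i)} = (\<lambda>\<rho>. \<sigma> \<circ> \<rho>) ` {\<rho>. \<rho> permutes U - A}"
proof (intro Set.set_eqI iffI)
  fix \<tau> assume "\<tau> \<in> {\<tau>. \<tau> permutes U \<and> (\<forall>i\<in>A. \<tau> i = \<sigma> i)}"
  then have t: "\<tau> permutes U" "\<And>i. i \<in> A \<Longrightarrow> \<tau> i = \<sigma> i" by auto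
  define \<rho> where "\<rho> = inv_into UNIV \<sigma> \<circ> \<tau>"
  have rU: "\<rho> permutes U" unfolding \<rho>_def by (intro permutes_compose permutes_inv t \<sigma>)
  have fixA: "\<rho> i = i" if "i \<in> A" for i
    using t(2)[OF that] permutes_inverses(2)[OF \<sigma>] by (simp add: \<rho>_def)
  have "\<rho> permutes U - A" by (rule permutes_superset[OF rU]) (rule fixA, blast)
  moreover have "\<tau> = \<sigma> \<circ> \<rho>" using permutes_inverses(1)[OF \<sigma>] by (simp add: \<rho>_def fun_eq_iff)
  ultimately show "\<tau> \<in> (\<lambda>\<rho>. \<sigma> \<circ> \<rho>) ` {\<rho>. \<rho> permutes U - A}" by blast
next
  fix \<tau> assume "\<tau> \<in> (\<lambda>\<rho>. \<sigma> \<circ> \<rho>) ` {\<rho>. \<rho> permutes U - A}"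
  then obtain \<rho> where r: "\<rho> permutes U - A" "\<tau> = \<sigma> \<circ> \<rho>" by auto
  have "\<rho> permutes U" using r(1) by (rule permutes_subset) auto
  then show "\<tau> \<in> {\<tau>. \<tau> permutes U \<and> (\<forall>i\<in>A. \<tau> i = \<sigma> i)}"
    using r permutes_compose[OF _ \<sigma>, of \<rho>] permutes_not_in[OF r(1)] by auto
qed

lemma pdet_shift:
  "(\<Sum>\<rho> | \<rho> permutes {N..<N + m}. of_int (sign \<rho>) * (\<Prod>i<m. F i (\<rho> (N + i)))) = pdet m (\<lambda>i j. F i (N + j))"
proof -
  let ?A = "{..<m}" and ?B = "{N..<N + m}"
  have b: "bij_betw (\<lambda>i. N + i) ?A ?B" by (rule bij_betw_byWitness[of _ "\<lambda>i. i - N"]) auto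
  have b': "bij_betw (\<lambda>i. i - N) ?B ?A" by (rule bij_betw_byWitness[of _ "\<lambda>i. N + i"]) auto
  show ?thesis unfolding pdet_def
  proof (rule sum.reindex_bij_witness[of _ "map_permutation ?A (\<lambda>i. N + i)" "map_permutation ?B (\<lambda>i. i - N)"])
    fix \<rho> assume "\<rho> \<in> {\<rho>. \<rho> permutes ?B}"
    then have r: "\<rho> permutes ?B" by simp
    show "map_permutation ?A (\<lambda>i. N + i) (map_permutation ?B (\<lambda>i. i - N) \<rho>) = \<rho>"
      by (rule map_permutation_compose_inv[OF b' r]) auto
    show "map_permutation ?B (\<lambda>i. i - N) \<rho> \<in> {\<pi>. \<pi> permutes ?A}"
      using map_permutation_permutes[OF b' r] by simp
    have "sign (map_permutation ?B (\<lambda>i. i - N) \<rho>) = sign \<rho>"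
      by (rule sign_map_permutation) (use r b' in \<open>auto simp: bij_betw_def\<close>)
    moreover have "N + map_permutation ?B (\<lambda>i. i - N) \<rho> i = \<rho> (N + i)" if "i < m" for i
    proof -
      have "map_permutation ?B (\<lambda>i. i - N) \<rho> (N + i - N) = \<rho> (N + i) - N"
        by (rule map_permutation_apply) (use that b' in \<open>auto simp: bij_betw_def\<close>)
      moreover have "\<rho> (N + i) \<in> ?B" using permutes_in_image[OF r, of "N + i"] that by simp
      ultimately show ?thesis by simp
    qed
    ultimately show "of_int (sign (map_permutation ?B (\<lambda>i. i - N) \<rho>)) *
        (\<Prod>i<m. F i (N + map_permutation ?B (\<lambda>i. i - N) \<rho> i)) = of_int (sign \<rho>) * (\<Prod>i<m. F i (\<rho> (N + i)))"
      by simp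
  next
    fix \<pi> assume "\<pi> \<in> {\<pi>. \<pi> permutes ?A}"
    then have p: "\<pi> permutes ?A" by simp
    show "map_permutation ?B (\<lambda>i. i - N) (map_permutation ?A (\<lambda>i. N + i) \<pi>) = \<pi>"
      by (rule map_permutation_compose_inv[OF b p]) auto
    show "map_permutation ?A (\<lambda>i. N + i) \<pi> \<in> {\<rho>. \<rho> permutes ?B}"
      using map_permutation_permutes[OF b p] by simp
  qed
qed

text \<open>The weight left by two Leibniz expansions after the first N variables are integrated out
  by Hermite orthogonality.\<close>

definition coef :: "nat \<Rightarrow> (nat \<Rightarrow> nat) \<Rightarrow> (nat \<Rightarrow> nat) \<Rightarrow> complex" where
  "coef N \<sigma> \<tau> = of_int (sign \<sigma>) * of_int (sign \<tau>) * (\<Prod>i<N. if \<sigma> i = \<tau> i then fact (\<sigma> i) else 0)"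

text \<open>A nonzero weight forces \<tau> to agree with \<sigma> below N, so \<tau> = \<sigma> o
  \<rho> with \<rho> acting on the last m places. The signs of \<sigma> cancel and the sum over
  \<rho> is a determinant.\<close>

lemma sum_coef:
  assumes \<sigma>: "\<sigma> permutes {..<N + m}"
  shows "(\<Sum>\<tau> | \<tau> permutes {..<N + m}. coef N \<sigma> \<tau> * (\<Prod>i<m. F i (\<tau> (N + i)))) =
    (\<Prod>i<N. fact (\<sigma> i)) * pdet m (\<lambda>i j. F i (\<sigma> (N + j)))"
proof -
  let ?S = "{\<tau>. \<tau> permutes {..<N + m} \<and> (\<forall>i\<in>{..<N}. \<tau> i = \<sigma> i)}"
  have perm: "permutation \<sigma>" using \<sigma> by (auto intro: permutes_imp_permutation)
  have sgn: "of_int (sign \<sigma>) * of_int (sign \<sigma>) = (1::complex)" by (simp flip: of_int_mult)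
  have diff: "{..<N + m} - {..<N} = {N..<N + m}" by auto
  have "(\<Sum>\<tau> | \<tau> permutes {..<N + m}. coef N \<sigma> \<tau> * (\<Prod>i<m. F i (\<tau> (N + i)))) =
     (\<Sum>\<tau>\<in>?S. of_int (sign \<sigma>) * of_int (sign \<tau>) * (\<Prod>i<N. fact (\<sigma> i)) * (\<Prod>i<m. F i (\<tau> (N + i))))"
  proof (rule sum.mono_neutral_cong_right)
    show "finite {\<tau>. \<tau> permutes {..<N + m}}" by (rule finite_permutations) simp
    show "\<forall>\<tau>\<in>{\<tau>. \<tau> permutes {..<N + m}} - ?S. coef N \<sigma> \<tau> * (\<Prod>i<m. F i (\<tau> (N + i))) = 0"
    proof
      fix \<tau> assume "\<tau> \<in> {\<tau>. \<tau> permutes {..<N + m}} - ?S"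
      then obtain i where "i < N" "\<tau> i \<noteq> \<sigma> i" by auto
      then have "(\<Prod>i<N. if \<sigma> i = \<tau> i then fact (\<sigma> i) else 0) = (0::complex)"
        by (intro prod_zero bexI[of _ i]) auto
      then show "coef N \<sigma> \<tau> * (\<Prod>i<m. F i (\<tau> (N + i))) = 0" by (simp add: coef_def)
    qed
  qed (auto simp: coef_def)
  also have "\<dots> = (\<Sum>\<rho> | \<rho> permutes {N..<N + m}.
     of_int (sign \<sigma>) * of_int (sign (\<sigma> \<circ> \<rho>)) * (\<Prod>i<N. fact (\<sigma> i)) * (\<Prod>i<m. F i (\<sigma> (\<rho> (N + i)))))"
  proof -
    have "inj (\<lambda>\<rho>. \<sigma> \<circ> \<rho>)" using permutes_inj[OF \<sigma>] by (auto simp: inj_on_def fun_eq_iff)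
    then have "inj_on (\<lambda>\<rho>. \<sigma> \<circ> \<rho>) {\<rho>. \<rho> permutes {N..<N + m}}" by (rule inj_on_subset) simp
    moreover have "?S = (\<lambda>\<rho>. \<sigma> \<circ> \<rho>) ` {\<rho>. \<rho> permutes {N..<N + m}}"
      using permutes_agreeing[OF \<sigma>, of "{..<N}"] by (simp add: diff)
    ultimately show ?thesis by (simp add: sum.reindex)
  qed
  also have "\<dots> = (\<Sum>\<rho> | \<rho> permutes {N..<N + m}. (\<Prod>i<N. fact (\<sigma> i)) *
     (of_int (sign \<rho>) * (\<Prod>i<m. F i (\<sigma> (\<rho> (N + i))))))"
  proof (rule sum.cong[OF refl])
    fix \<rho> assume "\<rho> \<in> {\<rho>. \<rho> permutes {N..<N + m}}"
    then have "permutation \<rho>" by (auto intro: permutes_imp_permutation)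
    then have "of_int (sign \<sigma>) * of_int (sign (\<sigma> \<circ> \<rho>)) = (of_int (sign \<rho>) :: complex)"
      using sign_compose[OF perm] sgn by (simp add: mult.assoc[symmetric])
    then show "of_int (sign \<sigma>) * of_int (sign (\<sigma> \<circ> \<rho>)) * (\<Prod>i<N. fact (\<sigma> i)) * (\<Prod>i<m. F i (\<sigma> (\<rho> (N + i)))) =
       (\<Prod>i<N. fact (\<sigma> i)) * (of_int (sign \<rho>) * (\<Prod>i<m. F i (\<sigma> (\<rho> (N + i)))))"
      by (simp add: mult_ac)
  qed
  also have "\<dots> = (\<Prod>i<N. fact (\<sigma> i)) * pdet m (\<lambda>i j. F i (\<sigma> (N + j)))"
    using pdet_shift[where N = N and m = m and F = "\<lambda>i j. F i (\<sigma> j)"] by (simp add: sum_distrib_left[symmetric])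
  finally show ?thesis .
qed

subsection \<open>The Christoffel-Darboux type identity for Hermite polynomials\<close>

definition join :: "nat \<Rightarrow> (nat \<Rightarrow> 'a) \<Rightarrow> (nat \<Rightarrow> 'a) \<Rightarrow> nat \<Rightarrow> 'a" where
  "join N x z i = (if i < N then x i else z (i - N))"

text \<open>Two separate numbers a and b of outer variables are allowed because both sides of the
  next identity are instances: a = b = k, and a = 0 with b = 2k.\<close>

lemma gauss_exp_vdm_vdm:
  "gauss_exp 1 {..<N} (\<lambda>x. vdm (N + a) (join N x z) * vdm (N + b) (join N x w)) =
    (\<Sum>\<sigma> | \<sigma> permutes {..<N + a}. \<Sum>\<tau> | \<tau> permutes {..<N + b}.
       coef N \<sigma> \<tau> * ((\<Prod>i<a. He (\<sigma> (N + i)) 1 (z i)) * (\<Prod>i<b. He (\<tau> (N + i)) 1 (w i))))"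
proof -
  interpret linear_functional "{..<N}" "gauss_exp 1 {..<N}" by (intro gauss_linear_functional) auto
  define T where "T \<sigma> \<tau> x = (\<Prod>i<N. He (\<sigma> i) 1 (x i) * He (\<tau> i) 1 (x i))" for \<sigma> \<tau> :: "nat \<Rightarrow> nat" and x
  define c where "c \<sigma> \<tau> = of_int (sign \<sigma>) * of_int (sign \<tau>) *
     ((\<Prod>i<a. He (\<sigma> (N + i)) 1 (z i)) * (\<Prod>i<b. He (\<tau> (N + i)) 1 (w i)))" for \<sigma> \<tau> :: "nat \<Rightarrow> nat"
  have pT: "polyfun {..<N} (T \<sigma> \<tau>)" for \<sigma> \<tau>
    unfolding T_def[abs_def] by (intro polyfun_prod polyfun.mult polyfun_He polyfun.intros) auto
  have e: "vdm (N + a) (join N x z) = (\<Sum>\<sigma> | \<sigma> permutes {..<N + a}. of_int (sign \<sigma>) *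
     ((\<Prod>i<N. He (\<sigma> i) 1 (x i)) * (\<Prod>i<a. He (\<sigma> (N + i)) 1 (z i))))" for x a z
    unfolding pdet_He[symmetric] pdet_def prod_lessThan_add by (simp add: join_def)
  have "vdm (N + a) (join N x z) * vdm (N + b) (join N x w) =
     (\<Sum>\<sigma> | \<sigma> permutes {..<N + a}. \<Sum>\<tau> | \<tau> permutes {..<N + b}. c \<sigma> \<tau> * T \<sigma> \<tau> x)" for x
    unfolding e sum_product by (intro sum.cong refl) (simp add: c_def T_def prod.distrib)
  then have "gauss_exp 1 {..<N} (\<lambda>x. vdm (N + a) (join N x z) * vdm (N + b) (join N x w)) =
     gauss_exp 1 {..<N} (\<lambda>x. \<Sum>\<sigma> | \<sigma> permutes {..<N + a}. \<Sum>\<tau> | \<tau> permutes {..<N + b}. c \<sigma> \<tau> * T \<sigma> \<tau> x)"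
    by simp
  also have "\<dots> = (\<Sum>\<sigma> | \<sigma> permutes {..<N + a}. gauss_exp 1 {..<N} (\<lambda>x. \<Sum>\<tau> | \<tau> permutes {..<N + b}. c \<sigma> \<tau> * T \<sigma> \<tau> x))"
    by (rule sum) (intro polyfun_sum polyfun_cmult pT)
  also have "\<dots> = (\<Sum>\<sigma> | \<sigma> permutes {..<N + a}. \<Sum>\<tau> | \<tau> permutes {..<N + b}. gauss_exp 1 {..<N} (\<lambda>x. c \<sigma> \<tau> * T \<sigma> \<tau> x))"
    by (intro sum.cong refl sum) (intro polyfun_cmult pT)
  also have "\<dots> = (\<Sum>\<sigma> | \<sigma> permutes {..<N + a}. \<Sum>\<tau> | \<tau> permutes {..<N + b}.
       coef N \<sigma> \<tau> * ((\<Prod>i<a. He (\<sigma> (N + i)) 1 (z i)) * (\<Prod>i<b. He (\<tau> (N + i)) 1 (w i))))"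
    unfolding gauss_exp_cmult T_def[abs_def]
    by (intro sum.cong refl) (simp add: hermite_orthogonal c_def coef_def mult_ac)
  finally show ?thesis .
qed

lemma join_vdm:
  fixes x :: "nat \<Rightarrow> complex"
  shows "vdm (N + k) (join N x z) * vdm (N + k) (join N x w) * (\<Prod>j<k. \<Prod>i<k. w j - z i) =
    vdm N x * vdm (N + (k + k)) (join N x (join k z w))"
proof -
  have 1: "vdm (N + m) (join N x v) = vdm N x * vdm m v * (\<Prod>j<m. \<Prod>i<N. v j - x i)" for m v
  proof -
    have "vdm N (join N x v) = vdm N x" unfolding vdm_def by (intro prod.cong) (auto simp: join_def)
    moreover have "(\<Prod>j<m. \<Prod>i<N. join N x v (N + j) - join N x v i) = (\<Prod>j<m. \<Prod>i<N. v j - x i)"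
      by (intro prod.cong) (auto simp: join_def)
    ultimately show ?thesis unfolding vdm_add by (simp add: join_def)
  qed
  have 2: "vdm (k + k) (join k z w) = vdm k z * vdm k w * (\<Prod>j<k. \<Prod>i<k. w j - z i)"
  proof -
    have "vdm k (join k z w) = vdm k z" unfolding vdm_def by (intro prod.cong) (auto simp: join_def)
    moreover have "(\<Prod>j<k. \<Prod>i<k. join k z w (k + j) - join k z w i) = (\<Prod>j<k. \<Prod>i<k. w j - z i)"
      by (intro prod.cong) (auto simp: join_def)
    ultimately show ?thesis unfolding vdm_add by (simp add: join_def)
  qed
  have 3: "(\<Prod>j<k + k. \<Prod>i<N. join k z w j - x i) = (\<Prod>j<k. \<Prod>i<N. z j - x i) * (\<Prod>j<k. \<Prod>i<N. w j - x i)"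
    unfolding prod_lessThan_add by (simp add: join_def)
  show ?thesis unfolding 1 2 3 by (simp add: mult_ac)
qed

text \<open>One Gaussian integral evaluated in two ways. For a = 0 the permutation \<sigma> moves
  only indices below N, each of its N! choices contributes the same, and the degrees N, ..., N + 2k
  - 1 are left for the outer variables.\<close>

lemma hermite_identity:
  "(\<Sum>\<sigma> | \<sigma> permutes {..<N + k}. \<Sum>\<tau> | \<tau> permutes {..<N + k}.
     coef N \<sigma> \<tau> * ((\<Prod>i<k. He (\<sigma> (N + i)) 1 (z i)) * (\<Prod>i<k. He (\<tau> (N + i)) 1 (w i)))) *
     (\<Prod>j<k. \<Prod>i<k. w j - z i) =
   fact N * (\<Prod>i<N. fact i) * pdet (k + k) (\<lambda>i j. He (N + j) 1 (join k z w i))"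
proof -
  let ?u = "join k z w"
  have "(\<Sum>\<sigma> | \<sigma> permutes {..<N + k}. \<Sum>\<tau> | \<tau> permutes {..<N + k}.
     coef N \<sigma> \<tau> * ((\<Prod>i<k. He (\<sigma> (N + i)) 1 (z i)) * (\<Prod>i<k. He (\<tau> (N + i)) 1 (w i)))) *
     (\<Prod>j<k. \<Prod>i<k. w j - z i) =
     gauss_exp 1 {..<N} (\<lambda>x. (\<Prod>j<k. \<Prod>i<k. w j - z i) * (vdm (N + k) (join N x z) * vdm (N + k) (join N x w)))"
    unfolding gauss_exp_cmult gauss_exp_vdm_vdm by (rule mult.commute)
  also have "\<dots> = gauss_exp 1 {..<N} (\<lambda>x. vdm (N + 0) (join N x z) * vdm (N + (k + k)) (join N x ?u))"
  proof -
    have 0: "vdm (N + 0) (join N x z) = vdm N x" for x :: "nat \<Rightarrow> complex"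
      unfolding vdm_def by (intro prod.cong) (auto simp: join_def)
    have "(\<Prod>j<k. \<Prod>i<k. w j - z i) * (vdm (N + k) (join N x z) * vdm (N + k) (join N x w)) =
       vdm (N + 0) (join N x z) * vdm (N + (k + k)) (join N x ?u)" for x :: "nat \<Rightarrow> complex"
      unfolding 0 join_vdm[symmetric] by (rule mult.commute)
    then show ?thesis by presburger
  qed
  also have "\<dots> = (\<Sum>\<sigma> | \<sigma> permutes {..<N}. \<Sum>\<tau> | \<tau> permutes {..<N + (k + k)}.
       coef N \<sigma> \<tau> * (\<Prod>i<k + k. He (\<tau> (N + i)) 1 (?u i)))"
    unfolding gauss_exp_vdm_vdm by simp
  also have "\<dots> = (\<Sum>\<sigma> | \<sigma> permutes {..<N}. (\<Prod>i<N. fact i) * pdet (k + k) (\<lambda>i j. He (N + j) 1 (?u i)))"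
  proof (rule sum.cong[OF refl])
    fix \<sigma> assume "\<sigma> \<in> {\<sigma>. \<sigma> permutes {..<N}}"
    then have s: "\<sigma> permutes {..<N}" by simp
    have s': "\<sigma> permutes {..<N + (k + k)}" using s by (rule permutes_subset) auto
    have "(\<Prod>i<N. fact (\<sigma> i)) = (\<Prod>i<N. fact i :: complex)"
      using prod.permute[OF s, of "fact :: nat \<Rightarrow> complex"] by (simp add: comp_def)
    moreover have "\<sigma> (N + j) = N + j" for j using permutes_not_in[OF s, of "N + j"] by simp
    ultimately show "(\<Sum>\<tau> | \<tau> permutes {..<N + (k + k)}. coef N \<sigma> \<tau> * (\<Prod>i<k + k. He (\<tau> (N + i)) 1 (?u i))) =
      (\<Prod>i<N. fact i) * pdet (k + k) (\<lambda>i j. He (N + j) 1 (?u i))"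
      using sum_coef[OF s', where F = "\<lambda>i j. He j 1 (?u i)"] by simp
  qed
  also have "\<dots> = fact N * (\<Prod>i<N. fact i) * pdet (k + k) (\<lambda>i j. He (N + j) 1 (?u i))"
    by (simp add: card_permutations[OF refl])
  finally show ?thesis .
qed

subsection \<open>Schur polynomials by the branching rule\<close>

lemma polynomial_fun_iff: "polynomial_fun k f \<longleftrightarrow> polyfun {1..k} f"
proof
  show "polynomial_fun k f \<Longrightarrow> polyfun {1..k} f"
    by (induction rule: polynomial_fun.induct) (auto intro: polyfun.intros)
  show "polyfun {1..k} f \<Longrightarrow> polynomial_fun k f"
    by (induction rule: polyfun.induct) (auto intro: polynomial_fun.intros)
qed

lemma pdet_transpose: "pdet n (\<lambda>i j. F j i) = pdet n F"
proof -
  have "Matrix.mat n n (\<lambda>(i, j). F j i) = transpose_mat (Matrix.mat n n (\<lambda>(i, j). F i j))"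
    by (intro eq_matI) auto
  then show ?thesis by (simp add: pdet_eq Determinant.det_transpose[of _ n])
qed

lemma pdet_last_row:
  assumes "\<And>j. j < k \<Longrightarrow> F k j = 0"
  shows "pdet (Suc k) F = F k k * pdet k F"
proof -
  have eq: "{\<pi>. \<pi> permutes {..<k}} = {\<pi>. \<pi> permutes {..<Suc k} \<and> \<pi> k = k}"
  proof (intro Set.set_eqI iffI)
    fix \<pi> assume "\<pi> \<in> {\<pi>. \<pi> permutes {..<k}}"
    then show "\<pi> \<in> {\<pi>. \<pi> permutes {..<Suc k} \<and> \<pi> k = k}"
      using permutes_subset[of \<pi> "{..<k}" "{..<Suc k}"] permutes_not_in[of \<pi> "{..<k}" k] by auto
  next
    fix \<pi> assume "\<pi> \<in> {\<pi>. \<pi> permutes {..<Suc k} \<and> \<pi> k = k}"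
    then show "\<pi> \<in> {\<pi>. \<pi> permutes {..<k}}"
      using permutes_superset[of \<pi> "{..<Suc k}" "{..<k}"] by (auto simp: less_Suc_eq)
  qed
  have "pdet (Suc k) F = (\<Sum>\<pi> | \<pi> permutes {..<Suc k} \<and> \<pi> k = k. of_int (sign \<pi>) * (\<Prod>i<Suc k. F i (\<pi> i)))"
    unfolding pdet_def
  proof (rule sum.mono_neutral_right)
    show "finite {\<pi>. \<pi> permutes {..<Suc k}}" by (rule finite_permutations) simp
    show "\<forall>\<pi>\<in>{\<pi>. \<pi> permutes {..<Suc k}} - {\<pi>. \<pi> permutes {..<Suc k} \<and> \<pi> k = k}.
       of_int (sign \<pi>) * (\<Prod>i<Suc k. F i (\<pi> i)) = 0"
    proof
      fix \<pi> assume "\<pi> \<in> {\<pi>. \<pi> permutes {..<Suc k}} - {\<pi>. \<pi> permutes {..<Suc k} \<and> \<pi> k = k}"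
      then have "\<pi> permutes {..<Suc k}" "\<pi> k \<noteq> k" by auto
      then have "\<pi> k < k" using permutes_in_image[of \<pi> "{..<Suc k}" k] by auto
      then show "of_int (sign \<pi>) * (\<Prod>i<Suc k. F i (\<pi> i)) = 0" using assms by simp
    qed
  qed auto
  also have "\<dots> = (\<Sum>\<pi> | \<pi> permutes {..<k}. of_int (sign \<pi>) * (\<Prod>i<Suc k. F i (\<pi> i)))"
    unfolding eq ..
  also have "\<dots> = (\<Sum>\<pi> | \<pi> permutes {..<k}. F k k * (of_int (sign \<pi>) * (\<Prod>i<k. F i (\<pi> i))))"
    by (intro sum.cong refl) (auto simp: permutes_not_in mult_ac)
  finally show ?thesis by (simp add: pdet_def sum_distrib_left)
qed

lemma pdet_cong: "(\<And>i j. i < n \<Longrightarrow> j < n \<Longrightarrow> F i j = G i j) \<Longrightarrow> pdet n F = pdet n G"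
  unfolding pdet_eq by (intro arg_cong[of _ _ Determinant.det] eq_matI) auto

lemma pdet_row_scale: "pdet n (\<lambda>i j. c i * F i j) = (\<Prod>i<n. c i) * pdet n F"
  by (simp add: pdet_def prod.distrib sum_distrib_left mult_ac)

lemma pdet_column_sums:
  assumes "\<And>j. j < n \<Longrightarrow> finite (I j)"
  shows "pdet n (\<lambda>i j. \<Sum>m\<in>I j. c j m * G m i) =
    (\<Sum>m\<in>PiE {..<n} I. (\<Prod>j<n. c j (m j)) * pdet n (\<lambda>i j. G (m j) i))"
proof -
  have "pdet n (\<lambda>i j. \<Sum>m\<in>I j. c j m * G m i) = pdet n (\<lambda>j i. \<Sum>m\<in>I j. c j m * G m i)"
    by (rule pdet_transpose[symmetric])
  also have "\<dots> = (\<Sum>\<pi> | \<pi> permutes {..<n}. \<Sum>m\<in>PiE {..<n} I.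
     of_int (sign \<pi>) * (\<Prod>j<n. c j (m j) * G (m j) (\<pi> j)))"
    unfolding pdet_def by (subst prod_sum_PiE) (auto simp: assms sum_distrib_left)
  also have "\<dots> = (\<Sum>m\<in>PiE {..<n} I. \<Sum>\<pi> | \<pi> permutes {..<n}.
     of_int (sign \<pi>) * (\<Prod>j<n. c j (m j) * G (m j) (\<pi> j)))"
    by (rule sum.swap)
  also have "\<dots> = (\<Sum>m\<in>PiE {..<n} I. (\<Prod>j<n. c j (m j)) * pdet n (\<lambda>j i. G (m j) i))"
    by (simp add: pdet_def prod.distrib sum_distrib_left mult_ac)
  also have "\<dots> = (\<Sum>m\<in>PiE {..<n} I. (\<Prod>j<n. c j (m j)) * pdet n (\<lambda>i j. G (m j) i))"
    by (intro sum.cong refl arg_cong2[of _ _ _ _ "(*)"]) (rule pdet_transpose)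
  finally show ?thesis .
qed

text \<open>A geometric sum cut off at b; its range \<open>{b..<a}\<close> is the origin of the
  interlacing condition.\<close>

lemma power_diff_scaled:
  fixes x y :: "'a::comm_ring_1"
  assumes "b \<le> a"
  shows "x ^ a - y ^ (a - b) * x ^ b = (x - y) * (\<Sum>m\<in>{b..<a}. y ^ (a - 1 - m) * x ^ m)"
  using assms
proof (induction a rule: dec_induct)
  case (step n)
  have "(\<Sum>m\<in>{b..<Suc n}. y ^ (Suc n - 1 - m) * x ^ m) = (\<Sum>m\<in>{b..<n}. y * (y ^ (n - 1 - m) * x ^ m)) + x ^ n"
  proof -
    have eq: "y ^ (n - m) * x ^ m = y * (y ^ (n - 1 - m) * x ^ m)" if "m \<in> {b..<n}" for m
    proof -
      have "n - m = Suc (n - 1 - m)" using that by auto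
      then show ?thesis by (simp add: mult.assoc)
    qed
    have "(\<Sum>m\<in>{b..<n}. y ^ (n - m) * x ^ m) = (\<Sum>m\<in>{b..<n}. y * (y ^ (n - 1 - m) * x ^ m))"
      by (rule sum.cong[OF refl eq])
    then show ?thesis using step by (simp add: atLeastLessThanSuc add.commute)
  qed
  then have "(x - y) * (\<Sum>m\<in>{b..<Suc n}. y ^ (Suc n - 1 - m) * x ^ m) =
     y * ((x - y) * (\<Sum>m\<in>{b..<n}. y ^ (n - 1 - m) * x ^ m)) + (x - y) * x ^ n"
    by (simp add: sum_distrib_left algebra_simps)
  also have "\<dots> = y * (x ^ n - y ^ (n - b) * x ^ b) + (x - y) * x ^ n" using step by simp
  also have "\<dots> = x ^ Suc n - y ^ (Suc n - b) * x ^ b"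
    using step by (simp add: Suc_diff_le algebra_simps)
  finally show ?case by simp
qed simp

text \<open>In terms of the exponents l j = \<eta> (j + 1) + k - (j + 1), the partitions interlacing with \<eta> are the
  sequences m with l (j + 1) \<le> m j < l j.\<close>

primrec branching :: "nat \<Rightarrow> (nat \<Rightarrow> nat) \<Rightarrow> (nat \<Rightarrow> 'a::comm_ring_1) \<Rightarrow> 'a" where
  "branching 0 l x = 1"
| "branching (Suc k) l x = (\<Sum>m\<in>PiE {..<k} (\<lambda>j. {l (Suc j)..<l j}).
     x k ^ l k * (\<Prod>j<k. x k ^ (l j - 1 - m j)) * branching k m x)"

text \<open>The order of the differences is reversed against \<open>vdm\<close> because exponents of
  alternants decrease. The resulting sign cancels in a product of two.\<close>

definition dvdm :: "nat \<Rightarrow> (nat \<Rightarrow> 'a::comm_ring_1) \<Rightarrow> 'a" where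
  "dvdm n y = (\<Prod>j<n. \<Prod>i<j. y i - y j)"

text \<open>Column operations clear the last row up to its last entry. Each remaining row i then
  contains the factor x_i - x_k, and multilinearity in the columns leaves smaller determinants whose
  exponents interlace with l.\<close>

lemma pdet_branching:
  assumes "\<And>j. Suc j < k \<Longrightarrow> l (Suc j) < l j"
  shows "pdet k (\<lambda>i j. x i ^ l j) = dvdm k x * branching k l x"
  using assms
proof (induction k arbitrary: l)
  case 0
  then show ?case by (simp add: pdet_def dvdm_def)
next
  case (Suc k)
  have dec: "l (Suc j) < l j" if "j < k" for j using Suc.prems that by simp
  define B where "B i j = (if j < k then x i ^ l j - x k ^ (l j - l (Suc j)) * x i ^ l (Suc j) else x i ^ l k)" for i j
  define A where "A = Matrix.mat (Suc k) (Suc k) (\<lambda>(i, j). x i ^ l j)"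
  \<comment> \<open>Right multiplication by \<open>E\<close> subtracts x_k^(l_j - l_(j+1)) times
    column j + 1 from column j, which makes entry j of row k vanish for j < k.\<close>
  define E where "E = Matrix.mat (Suc k) (Suc k)
     (\<lambda>(i, j). if i = j then 1 else if i = Suc j then - (x k ^ (l j - l (Suc j))) else 0)"
  have A: "A \<in> carrier_mat (Suc k) (Suc k)" and E: "E \<in> carrier_mat (Suc k) (Suc k)"
    by (simp_all add: A_def E_def)
  have "Determinant.det E = 1"
    by (subst det_lower_triangular[OF _ E]) (auto simp: E_def prod_list_diag_prod)
  then have "pdet (Suc k) (\<lambda>i j. x i ^ l j) = Determinant.det (A * E)"
    unfolding pdet_eq A_def[symmetric] by (simp add: det_mult[OF A E])
  also have "A * E = Matrix.mat (Suc k) (Suc k) (\<lambda>(i, j). B i j)"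
  proof (rule eq_matI)
    fix i j assume "i < dim_row (Matrix.mat (Suc k) (Suc k) (\<lambda>(i, j). B i j))"
      "j < dim_col (Matrix.mat (Suc k) (Suc k) (\<lambda>(i, j). B i j))"
    then have ij: "i < Suc k" "j < Suc k" by auto
    have "(A * E) $$ (i, j) = (\<Sum>n = 0..<Suc k. x i ^ l n *
       (if n = j then 1 else if n = Suc j then - (x k ^ (l j - l (Suc j))) else 0))"
      using ij by (simp add: A_def E_def scalar_prod_def del: sum.op_ivl_Suc)
    also have "\<dots> = (\<Sum>n\<in>{0..<Suc k}. (if n = j then x i ^ l j else 0) +
       (if n = Suc j then - (x k ^ (l j - l (Suc j))) * x i ^ l (Suc j) else 0))"
      by (intro sum.cong) auto
    also have "\<dots> = B i j" using ij by (auto simp: sum.distrib B_def less_Suc_eq simp del: sum.op_ivl_Suc)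
    finally show "(A * E) $$ (i, j) = Matrix.mat (Suc k) (Suc k) (\<lambda>(i, j). B i j) $$ (i, j)"
      using ij by simp
  qed (use A E in auto)
  also have "Determinant.det (Matrix.mat (Suc k) (Suc k) (\<lambda>(i, j). B i j)) = pdet (Suc k) B"
    by (simp add: pdet_eq)
  also have "\<dots> = B k k * pdet k B"
    using dec by (intro pdet_last_row) (simp add: B_def flip: power_add, simp add: less_imp_le)
  also have "pdet k B = pdet k (\<lambda>i j. (x i - x k) * (\<Sum>m\<in>{l (Suc j)..<l j}. x k ^ (l j - 1 - m) * x i ^ m))"
    by (rule pdet_cong) (simp add: B_def power_diff_scaled less_imp_le[OF dec])
  also have "\<dots> = (\<Prod>i<k. x i - x k) * (\<Sum>m\<in>PiE {..<k} (\<lambda>j. {l (Suc j)..<l j}).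
      (\<Prod>j<k. x k ^ (l j - 1 - m j)) * pdet k (\<lambda>i j. x i ^ m j))"
    by (simp add: pdet_row_scale pdet_column_sums[where G = "\<lambda>m i. x i ^ m"])
  also have "(\<Sum>m\<in>PiE {..<k} (\<lambda>j. {l (Suc j)..<l j}). (\<Prod>j<k. x k ^ (l j - 1 - m j)) * pdet k (\<lambda>i j. x i ^ m j))
     = (\<Sum>m\<in>PiE {..<k} (\<lambda>j. {l (Suc j)..<l j}). (\<Prod>j<k. x k ^ (l j - 1 - m j)) * (dvdm k x * branching k m x))"
  proof (intro sum.cong refl arg_cong2[of _ _ _ _ "(*)"] Suc.IH)
    fix m j assume m: "m \<in> PiE {..<k} (\<lambda>j. {l (Suc j)..<l j})" and j: "Suc j < k"
    have "m (Suc j) < l (Suc j)" "l (Suc j) \<le> m j" using m j by (auto simp: PiE_iff)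
    then show "m (Suc j) < m j" by simp
  qed
  finally show ?case by (simp add: dvdm_def B_def sum_distrib_left mult_ac)
qed

lemma branching_staircase:
  "(\<And>j. j < k \<Longrightarrow> l j = k - Suc j) \<Longrightarrow> branching k l x = 1"
proof (induction k arbitrary: l)
  case (Suc k)
  have "PiE {..<k} (\<lambda>j. {l (Suc j)..<l j}) = PiE {..<k} (\<lambda>j. {(\<lambda>j\<in>{..<k}. k - Suc j) j})"
    using Suc.prems by (intro PiE_cong) auto
  also have "\<dots> = {\<lambda>j\<in>{..<k}. k - Suc j}" by (rule PiE_singleton) (rule restrict_extensional)
  finally have P: "PiE {..<k} (\<lambda>j. {l (Suc j)..<l j}) = {\<lambda>j\<in>{..<k}. k - Suc j}" .
  have "branching k (\<lambda>j\<in>{..<k}. k - Suc j) x = 1" by (rule Suc.IH) simp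
  moreover have "l j - 1 - (\<lambda>j\<in>{..<k}. k - Suc j) j = 0" if "j < k" for j using that Suc.prems[of j] by simp
  ultimately show ?case unfolding branching.simps P using Suc.prems[of k] by simp
qed simp

lemma polyfun_branching: "polyfun {..<k} (branching k l :: (nat \<Rightarrow> 'a::comm_ring_1) \<Rightarrow> 'a)"
proof (induction k arbitrary: l)
  case (Suc k)
  show ?case unfolding branching.simps(2)[abs_def]
    by (intro polyfun_sum polyfun.mult polyfun_prod polyfun_power polyfun.var polyfun_mono[OF Suc]) auto
next
  case 0
  have "branching 0 l = (\<lambda>x :: nat \<Rightarrow> 'a. 1)" for l by auto
  then show ?case by (simp add: polyfun.const)
qed

lemma branching_nonneg:
  fixes x :: "nat \<Rightarrow> 'a::linordered_idom"
  shows "(\<And>i. i < k \<Longrightarrow> 0 \<le> x i) \<Longrightarrow> 0 \<le> branching k l x"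
  by (induction k arbitrary: l) (auto intro!: sum_nonneg mult_nonneg_nonneg prod_nonneg)

text \<open>The branching sum has nonnegative coefficients, which neither the quotient of alternants
  nor its polynomial extension shows.\<close>

lemma branching_mono:
  fixes x y :: "nat \<Rightarrow> 'a::linordered_idom"
  shows "(\<And>i. i < k \<Longrightarrow> 0 \<le> x i \<and> x i \<le> y i) \<Longrightarrow> branching k l x \<le> branching k l y"
proof (induction k arbitrary: l)
  case (Suc k)
  have xk: "0 \<le> x k" "x k \<le> y k" using Suc.prems[of k] by auto
  then have yk: "0 \<le> y k" by simp
  have "x k ^ l k * (\<Prod>j<k. x k ^ (l j - 1 - m j)) * branching k m x \<le>
    y k ^ l k * (\<Prod>j<k. y k ^ (l j - 1 - m j)) * branching k m y" for m
    using Suc.prems xk yk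
    by (intro mult_mono power_mono prod_mono conjI Suc.IH mult_nonneg_nonneg prod_nonneg branching_nonneg zero_le_power ballI)
      (auto intro: order.trans)
  then show ?case by (simp add: sum_mono)
qed simp

definition exps :: "nat \<Rightarrow> (nat \<Rightarrow> nat) \<Rightarrow> nat \<Rightarrow> nat" where
  "exps k \<eta> j = \<eta> (Suc j) + k - Suc j"

lemma exps_decreasing:
  assumes "\<eta> \<in> partitions k" "i < j" "j < k"
  shows "exps k \<eta> j < exps k \<eta> i"
proof -
  have "\<eta> (Suc j) \<le> \<eta> (Suc i)" using assms by (auto simp: partitions_def)
  then show ?thesis using assms(2,3) by (simp add: exps_def)
qed

lemma alternant_eq: "alternant k \<eta> x = pdet k (\<lambda>i j. x (Suc i) ^ exps k \<eta> j)"
  by (simp add: alternant_def pdet_eq exps_def)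

lemma alternant_branching:
  assumes "\<eta> \<in> partitions k"
  shows "alternant k \<eta> x = dvdm k (\<lambda>i. x (Suc i)) * branching k (exps k \<eta>) (\<lambda>i. x (Suc i))"
  unfolding alternant_eq
  by (rule pdet_branching[where x = "\<lambda>i. x (Suc i)"]) (use exps_decreasing[OF assms] in auto)

lemma alternant_0: "alternant k (\<lambda>_. 0) x = dvdm k (\<lambda>i. x (Suc i))"
  using alternant_branching[of "\<lambda>_. 0" k x] branching_staircase[of k "exps k (\<lambda>_. 0)" "\<lambda>i. x (Suc i)"]
  by (simp add: partitions_def exps_def)

lemma dvdm_nonzero:
  fixes x :: "nat \<Rightarrow> 'a::idom"
  assumes "inj_on x {1..k}"
  shows "dvdm k (\<lambda>i. x (Suc i)) \<noteq> 0"
proof -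
  have "x (Suc i) \<noteq> x (Suc j)" if "i < j" "j < k" for i j
    using inj_onD[OF assms, of "Suc i" "Suc j"] that by auto
  then show ?thesis by (auto simp: dvdm_def)
qed

text \<open>The branching sum meets the description in \<open>schur\<close>, and agreement at
  distinct arguments determines a polynomial function.\<close>

lemma schur_branching:
  fixes x :: "nat \<Rightarrow> 'a::field_char_0"
  assumes \<eta>: "\<eta> \<in> partitions k"
  shows "schur k \<eta> x = branching k (exps k \<eta>) (\<lambda>i. x (Suc i))"
proof -
  let ?f = "\<lambda>x :: nat \<Rightarrow> 'a. branching k (exps k \<eta>) (\<lambda>i. x (Suc i))"
  have pf: "polyfun {1..k} ?f"
    by (rule polyfun_compose[OF polyfun_branching]) (auto intro!: polyfun.var)
  have ag: "?f x = alternant k \<eta> x / alternant k (\<lambda>_. 0) x" if "inj_on x {1..k}" for x :: "nat \<Rightarrow> 'a"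
    unfolding alternant_branching[OF \<eta>] alternant_0 using dvdm_nonzero[OF that] by simp
  have "schur k \<eta> = ?f"
    unfolding schur_def
  proof (rule the_equality)
    show "polynomial_fun k ?f \<and> (\<forall>x. inj_on x {1..k} \<longrightarrow> ?f x = alternant k \<eta> x / alternant k (\<lambda>_. 0) x)"
      using pf ag by (simp add: polynomial_fun_iff)
    fix g :: "(nat \<Rightarrow> 'a) \<Rightarrow> 'a"
    assume g: "polynomial_fun k g \<and> (\<forall>x. inj_on x {1..k} \<longrightarrow> g x = alternant k \<eta> x / alternant k (\<lambda>_. 0) x)"
    show "g = ?f"
    proof
      fix x
      show "g x = ?f x"
      proof (rule polyfun_eq_if_eq_on_inj[where f = g and g = ?f and S = "{1..k}"])
        show "polyfun {1..k} g" using g by (simp add: polynomial_fun_iff)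
      qed (use g pf ag in auto)
    qed
  qed
  then show ?thesis by simp
qed

subsection \<open>From injective exponent sequences to partitions\<close>

lemma exps_inj: "\<eta> \<in> partitions k \<Longrightarrow> inj_on (exps k \<eta>) {..<k}"
  by (rule inj_onI) (metis exps_decreasing lessThan_iff linorder_neqE_nat less_irrefl)

lemma strictly_decreasing_unique:
  fixes d d' :: "nat \<Rightarrow> nat"
  assumes "\<And>i j. i < j \<Longrightarrow> j < k \<Longrightarrow> d j < d i" "\<And>i j. i < j \<Longrightarrow> j < k \<Longrightarrow> d' j < d' i"
    and "d ` {..<k} = d' ` {..<k}" and "i < k"
  shows "d i = d' i"
proof -
  have "sorted_wrt (<) (rev (map d [0..<k]))" "sorted_wrt (<) (rev (map d' [0..<k]))"
    using assms(1,2) by (auto simp: sorted_wrt_iff_nth_less rev_nth)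
  moreover have "set (rev (map d [0..<k])) = set (rev (map d' [0..<k]))"
    using assms(3) by (simp add: atLeast0LessThan)
  ultimately have "rev (map d [0..<k]) = rev (map d' [0..<k])" by (metis strict_sorted_equal)
  then have "\<forall>j\<in>{0..<k}. d j = d' j" by simp
  then show ?thesis using assms(4) by simp
qed

lemma exps_determine:
  assumes "\<eta> \<in> partitions k" "\<eta>' \<in> partitions k" "\<And>j. j < k \<Longrightarrow> exps k \<eta> j = exps k \<eta>' j"
  shows "\<eta> = \<eta>'"
proof
  fix i
  show "\<eta> i = \<eta>' i"
  proof (cases "i \<in> {1..k}")
    case True
    then have "exps k \<eta> (i - 1) = exps k \<eta>' (i - 1)" by (intro assms(3)) auto
    then show ?thesis using True by (auto simp: exps_def)
  next
    case False
    then show ?thesis using assms(1,2) by (simp add: partitions_def)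
  qed
qed

lemma exps_less: "\<eta> \<in> partitions k \<Longrightarrow> \<eta> 1 \<le> N \<Longrightarrow> j < k \<Longrightarrow> exps k \<eta> j < N + k"
  unfolding partitions_def exps_def by (drule CollectD, drule conjunct1, drule spec[of _ 1], drule spec[of _ "Suc j"]) auto

definition injseqs :: "nat \<Rightarrow> nat \<Rightarrow> (nat \<Rightarrow> nat) set" where
  "injseqs k n = {l \<in> PiE {..<k} (\<lambda>_. {..<n}). inj_on l {..<k}}"

lemma finite_injseqs: "finite (injseqs k n)"
  by (rule finite_subset[of _ "PiE {..<k} (\<lambda>_. {..<n})"]) (auto simp: injseqs_def intro: finite_PiE)

text \<open>An injective sequence is a rearrangement of a unique strictly decreasing one, and
  subtracting the staircase k-1, ..., 0 turns the latter into a partition. Values below N + k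
  correspond to a largest part of at most N.\<close>

lemma bij_betw_injseqs:
  "bij_betw (\<lambda>(\<eta>, \<pi>). \<lambda>i\<in>{..<k}. exps k \<eta> (\<pi> i))
     ({\<eta>. \<eta> \<in> partitions k \<and> \<eta> 1 \<le> N} \<times> {\<pi>. \<pi> permutes {..<k}}) (injseqs k (N + k))"
proof (rule bij_betw_imageI)
  show "inj_on (\<lambda>(\<eta>, \<pi>). \<lambda>i\<in>{..<k}. exps k \<eta> (\<pi> i))
     ({\<eta>. \<eta> \<in> partitions k \<and> \<eta> 1 \<le> N} \<times> {\<pi>. \<pi> permutes {..<k}})"
  proof (rule inj_onI, clarify)
    fix \<eta> \<pi> \<eta>' \<pi>'
    assume \<eta>: "\<eta> \<in> partitions k" and \<eta>': "\<eta>' \<in> partitions k"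
      and p: "\<pi> permutes {..<k}" "\<pi>' permutes {..<k}"
      and eq: "(\<lambda>i\<in>{..<k}. exps k \<eta> (\<pi> i)) = (\<lambda>i\<in>{..<k}. exps k \<eta>' (\<pi>' i))"
    have e: "exps k \<eta> (\<pi> i) = exps k \<eta>' (\<pi>' i)" if "i < k" for i
      using fun_cong[OF eq, of i] that by simp
    have "exps k \<eta> ` {..<k} = (\<lambda>i. exps k \<eta> (\<pi> i)) ` {..<k}"
      using permutes_image[OF p(1)] by (metis image_image)
    also have "\<dots> = (\<lambda>i. exps k \<eta>' (\<pi>' i)) ` {..<k}" using e by (intro image_cong) auto
    also have "\<dots> = exps k \<eta>' ` {..<k}"
      using permutes_image[OF p(2)] by (metis image_image)
    finally have im: "exps k \<eta> ` {..<k} = exps k \<eta>' ` {..<k}" .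
    have "exps k \<eta> j = exps k \<eta>' j" if "j < k" for j
      by (rule strictly_decreasing_unique[OF _ _ im that]) (auto intro: exps_decreasing \<eta> \<eta>')
    then have \<eta>\<eta>': "\<eta> = \<eta>'" by (rule exps_determine[OF \<eta> \<eta>'])
    have "\<pi> i = \<pi>' i" for i
    proof (cases "i < k")
      case True
      then have "\<pi> i \<in> {..<k}" "\<pi>' i \<in> {..<k}" using permutes_in_image[OF p(1), of i] permutes_in_image[OF p(2), of i] by simp_all
      then show ?thesis using inj_onD[OF exps_inj[OF \<eta>], of "\<pi> i" "\<pi>' i"] e[OF True] \<eta>\<eta>' by auto
    next
      case False
      then show ?thesis using permutes_not_in[OF p(1), of i] permutes_not_in[OF p(2), of i] by simp
    qed
    then show "\<eta> = \<eta>' \<and> \<pi> = \<pi>'" using \<eta>\<eta>' by auto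
  qed
next
  show "(\<lambda>(\<eta>, \<pi>). \<lambda>i\<in>{..<k}. exps k \<eta> (\<pi> i)) `
     ({\<eta>. \<eta> \<in> partitions k \<and> \<eta> 1 \<le> N} \<times> {\<pi>. \<pi> permutes {..<k}}) = injseqs k (N + k)"
  proof (intro equalityI subsetI)
    fix l assume "l \<in> (\<lambda>(\<eta>, \<pi>). \<lambda>i\<in>{..<k}. exps k \<eta> (\<pi> i)) `
     ({\<eta>. \<eta> \<in> partitions k \<and> \<eta> 1 \<le> N} \<times> {\<pi>. \<pi> permutes {..<k}})"
    then obtain \<eta> \<pi> where \<eta>: "\<eta> \<in> partitions k" "\<eta> 1 \<le> N" and p: "\<pi> permutes {..<k}"
      and l: "l = (\<lambda>i\<in>{..<k}. exps k \<eta> (\<pi> i))" by auto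
    have pi: "\<pi> i < k" if "i < k" for i using permutes_in_image[OF p, of i] that by simp
    have "inj_on l {..<k}"
    proof (rule inj_onI)
      fix i j assume ij: "i \<in> {..<k}" "j \<in> {..<k}" "l i = l j"
      then have "\<pi> i = \<pi> j" using inj_onD[OF exps_inj[OF \<eta>(1)], of "\<pi> i" "\<pi> j"] pi by (auto simp: l)
      then show "i = j" using permutes_inj[OF p] by (simp add: inj_eq)
    qed
    then show "l \<in> injseqs k (N + k)"
      using exps_less[OF \<eta>] pi by (auto simp: injseqs_def l)
  next
    fix l assume "l \<in> injseqs k (N + k)"
    then have l: "l \<in> PiE {..<k} (\<lambda>_. {..<N + k})" and inj: "inj_on l {..<k}" by (auto simp: injseqs_def)
    define S where "S = l ` {..<k}"
    have fS: "finite S" and cS: "card S = k" using inj by (auto simp: S_def card_image)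
    define xs where "xs = sorted_list_of_set S"
    have xs: "length xs = k" "set xs = S" "sorted_wrt (<) xs"
      using fS cS by (simp_all add: xs_def)
    \<comment> \<open>The values of l in decreasing order.\<close>
    define d where "d j = xs ! (k - Suc j)" for j
    have dec: "d j < d i" if "i < j" "j < k" for i j
      using xs(1,3) that by (auto simp: d_def sorted_wrt_iff_nth_less)
    have dS: "d ` {..<k} = S"
    proof -
      have "d ` {..<k} = (\<lambda>j. xs ! j) ` {..<k}"
      proof (intro equalityI subsetI)
        fix v assume "v \<in> (\<lambda>j. xs ! j) ` {..<k}"
        then obtain j where "j < k" "v = xs ! j" by auto
        then show "v \<in> d ` {..<k}" by (intro image_eqI[of _ _ "k - Suc j"]) (auto simp: d_def)
      qed (auto simp: d_def)
      then show ?thesis using xs(1,2) by (auto simp: set_conv_nth)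
    qed
    have dinj: "inj_on d {..<k}"
      by (rule inj_onI) (metis dec lessThan_iff linorder_neqE_nat less_irrefl)
    have dlt: "d j < N + k" if "j < k" for j
    proof -
      have "d j \<in> S" using that dS by blast
      then show ?thesis using l by (auto simp: S_def PiE_iff)
    qed
    \<comment> \<open>Strict decrease of integers means weak decrease after adding the index; this
      gives the partition property and, by comparison with the last index, the lower bound
      \<open>dge\<close> that prevents truncation in \<eta>.\<close>
    have dle: "d j + j \<le> d i + i" if "i \<le> j" "j < k" for i j
      using that
    proof (induction j rule: dec_induct)
      case (step n)
      then show ?case using dec[of n "Suc n"] by simp
    qed simp
    have dge: "k - Suc j \<le> d j" if "j < k" for j
    proof -
      have "d (k - 1) + (k - 1) \<le> d j + j" by (rule dle) (use that in auto)
      then show ?thesis using that by linarith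
    qed
    define \<eta> where "\<eta> i = (if i \<in> {1..k} then d (i - 1) - (k - i) else 0)" for i
    have ed: "exps k \<eta> j = d j" if "j < k" for j
      using dge[OF that] that by (simp add: exps_def \<eta>_def)
    have \<eta>: "\<eta> \<in> partitions k"
    proof -
      have "\<eta> j \<le> \<eta> i" if "1 \<le> i" "i \<le> j" "j \<le> k" for i j
      proof -
        have "d (j - 1) + (j - 1) \<le> d (i - 1) + (i - 1)" by (rule dle) (use that in auto)
        then have "d (j - 1) - (k - j) \<le> d (i - 1) - (k - i)" using that by linarith
        then show ?thesis using that by (simp add: \<eta>_def)
      qed
      then show ?thesis by (auto simp: partitions_def \<eta>_def)
    qed
    have \<eta>1: "\<eta> 1 \<le> N"
    proof (cases "k = 0")
      case False
      then show ?thesis using dlt[of 0] by (simp add: \<eta>_def)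
    qed (simp add: \<eta>_def)
    define \<pi> where "\<pi> i = (if i \<in> {..<k} then inv_into {..<k} d (l i) else i)" for i
    have dp: "d (\<pi> i) = l i" if "i < k" for i
      using that dS by (simp add: \<pi>_def f_inv_into_f S_def)
    have p: "\<pi> permutes {..<k}"
    proof (rule bij_imp_permutes)
      have into: "\<pi> i \<in> {..<k}" if "i \<in> {..<k}" for i
      proof -
        have "l i \<in> d ` {..<k}" using that dS by (simp add: S_def)
        then show ?thesis using that inv_into_into[of "l i" d "{..<k}"] by (simp add: \<pi>_def)
      qed
      have "inj_on \<pi> {..<k}"
      proof (rule inj_onI)
        fix i j assume ij: "i \<in> {..<k}" "j \<in> {..<k}" "\<pi> i = \<pi> j"
        then have "l i = l j" using dp[of i] dp[of j] by auto
        then show "i = j" using inj_onD[OF inj] ij by blast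
      qed
      moreover have "\<pi> ` {..<k} \<subseteq> {..<k}" using into by auto
      ultimately show "bij_betw \<pi> {..<k} {..<k}" by (simp add: bij_betw_def endo_inj_surj)
    qed (simp add: \<pi>_def)
    have "l = (\<lambda>i\<in>{..<k}. exps k \<eta> (\<pi> i))"
    proof
      fix i
      show "l i = (\<lambda>i\<in>{..<k}. exps k \<eta> (\<pi> i)) i"
      proof (cases "i < k")
        case True
        then have "\<pi> i < k" using permutes_in_image[OF p, of i] by simp
        then show ?thesis using True ed dp by simp
      next
        case False
        then show ?thesis using l by (auto simp: PiE_def extensional_def)
      qed
    qed
    then show "l \<in> (\<lambda>(\<eta>, \<pi>). \<lambda>i\<in>{..<k}. exps k \<eta> (\<pi> i)) `
     ({\<eta>. \<eta> \<in> partitions k \<and> \<eta> 1 \<le> N} \<times> {\<pi>. \<pi> permutes {..<k}})"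
      using \<eta> \<eta>1 p by (intro image_eqI[of _ _ "(\<eta>, \<pi>)"]) auto
  qed
qed

text \<open>The product with the nonempty set of permutations is in bijection with a finite
  set.\<close>

lemma finite_partitions_le: "finite {\<eta>. \<eta> \<in> partitions k \<and> \<eta> 1 \<le> N}"
proof -
  have "finite ({\<eta>. \<eta> \<in> partitions k \<and> \<eta> 1 \<le> N} \<times> {\<pi>. \<pi> permutes {..<k}})"
    using bij_betw_finite[OF bij_betw_injseqs] finite_injseqs by blast
  moreover have "id \<in> {\<pi>. \<pi> permutes {..<k}}" by (simp add: permutes_id)
  ultimately show ?thesis using finite_cartesian_productD1 by blast
qed

lemma pdet_permute_columns:
  assumes "\<pi> permutes {..<k}"
  shows "pdet k (\<lambda>i j. F i (\<pi> j)) = of_int (sign \<pi>) * pdet k F"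
proof -
  have perm: "permutation \<pi>" using assms by (auto intro: permutes_imp_permutation)
  have sgn: "of_int (sign \<pi>) * of_int (sign \<pi>) = (1 :: 'a)" by (simp flip: of_int_mult)
  have "of_int (sign \<pi>) * pdet k F = (\<Sum>\<rho> | \<rho> permutes {..<k}. of_int (sign \<pi>) *
     (of_int (sign (\<pi> \<circ> \<rho>)) * (\<Prod>i<k. F i ((\<pi> \<circ> \<rho>) i))))"
    unfolding pdet_def sum_distrib_left by (rule setum_permutations_compose_left[OF assms])
  also have "\<dots> = pdet k (\<lambda>i j. F i (\<pi> j))"
    unfolding pdet_def
  proof (rule sum.cong[OF refl])
    fix \<rho> assume "\<rho> \<in> {\<rho>. \<rho> permutes {..<k}}"
    then have "permutation \<rho>" by (auto intro: permutes_imp_permutation)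
    then show "of_int (sign \<pi>) * (of_int (sign (\<pi> \<circ> \<rho>)) * (\<Prod>i<k. F i ((\<pi> \<circ> \<rho>) i))) =
       of_int (sign \<rho>) * (\<Prod>i<k. F i (\<pi> (\<rho> i)))"
      using sgn by (simp add: sign_compose[OF perm] mult.assoc[symmetric])
  qed
  finally show ?thesis ..
qed

text \<open>The last k values being prescribed, one extension s exists by counting, and all others
  are s o \<rho> with \<rho> permuting the first N places.\<close>

lemma card_extensions:
  assumes "l \<in> injseqs k (N + k)"
  shows "card {\<sigma>. \<sigma> permutes {..<N + k} \<and> (\<lambda>i\<in>{..<k}. \<sigma> (N + i)) = l} = fact N"
proof -
  have l: "l \<in> PiE {..<k} (\<lambda>_. {..<N + k})" and inj: "inj_on l {..<k}" using assms by (auto simp: injseqs_def)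
  have sub: "l ` {..<k} \<subseteq> {..<N + k}" using l by (auto simp: PiE_iff)
  have "card ({..<N + k} - l ` {..<k}) = card {..<N}"
    using sub inj by (simp add: card_Diff_subset card_image)
  then obtain f where f: "bij_betw f {..<N} ({..<N + k} - l ` {..<k})"
    using finite_same_card_bij[of "{..<N}" "{..<N + k} - l ` {..<k}"] by auto
  define s where "s i = (if i < N then f i else if i < N + k then l (i - N) else i)" for i
  have s: "s permutes {..<N + k}"
  proof (rule bij_imp_permutes)
    have "bij_betw s ({..<N} \<union> {N..<N + k}) (({..<N + k} - l ` {..<k}) \<union> l ` {..<k})"
    proof (rule bij_betw_combine)
      show "bij_betw s {..<N} ({..<N + k} - l ` {..<k})"
        using f by (subst bij_betw_cong[of _ _ f]) (auto simp: s_def)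
      have "bij_betw (l \<circ> (\<lambda>i. i - N)) {N..<N + k} (l ` {..<k})"
      proof (rule bij_betw_trans)
        show "bij_betw (\<lambda>i. i - N) {N..<N + k} {..<k}" by (rule bij_betw_byWitness[of _ "\<lambda>i. N + i"]) auto
        show "bij_betw l {..<k} (l ` {..<k})" using inj by (rule inj_on_imp_bij_betw)
      qed
      then show "bij_betw s {N..<N + k} (l ` {..<k})"
        by (subst bij_betw_cong[of _ _ "l \<circ> (\<lambda>i. i - N)"]) (auto simp: s_def)
    qed auto
    moreover have "{..<N} \<union> {N..<N + k} = {..<N + k}" by auto
    moreover have "({..<N + k} - l ` {..<k}) \<union> l ` {..<k} = {..<N + k}" using sub by auto
    ultimately show "bij_betw s {..<N + k} {..<N + k}" by simp
  qed (simp add: s_def)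
  have "{\<sigma>. \<sigma> permutes {..<N + k} \<and> (\<lambda>i\<in>{..<k}. \<sigma> (N + i)) = l} =
     {\<sigma>. \<sigma> permutes {..<N + k} \<and> (\<forall>i\<in>{N..<N + k}. \<sigma> i = s i)}"
  proof (intro Collect_cong conj_cong refl iffI ballI)
    fix \<sigma> i assume e: "(\<lambda>i\<in>{..<k}. \<sigma> (N + i)) = l" and i: "i \<in> {N..<N + k}"
    then show "\<sigma> i = s i" using fun_cong[OF e, of "i - N"] by (auto simp: s_def)
  next
    fix \<sigma> assume a: "\<forall>i\<in>{N..<N + k}. \<sigma> i = s i"
    show "(\<lambda>i\<in>{..<k}. \<sigma> (N + i)) = l"
    proof
      fix i
      show "(\<lambda>i\<in>{..<k}. \<sigma> (N + i)) i = l i"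
        using a l by (cases "i < k") (auto simp: s_def PiE_def extensional_def)
    qed
  qed
  also have "\<dots> = (\<lambda>\<rho>. s \<circ> \<rho>) ` {\<rho>. \<rho> permutes {..<N + k} - {N..<N + k}}"
    by (rule permutes_agreeing[OF s]) auto
  also have "{..<N + k} - {N..<N + k} = {..<N}" by auto
  also have "card ((\<lambda>\<rho>. s \<circ> \<rho>) ` {\<rho>. \<rho> permutes {..<N}}) = card {\<rho>. \<rho> permutes {..<N}}"
    using permutes_inj[OF s] by (intro card_image) (auto simp: inj_on_def fun_eq_iff)
  also have "card {\<rho>. \<rho> permutes {..<N}} = fact N" by (rule card_permutations) auto
  finally show ?thesis .
qed

text \<open>Summation over \<tau> yields the determinant in G. What remains depends on \<sigma> only
  through its last k values, each list of which occurs N! times; sorting that list separates \<eta>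
  from a permutation, and the sum over the latter is the determinant in F.\<close>

lemma sum_coef_partitions:
  "(\<Sum>\<sigma> | \<sigma> permutes {..<N + k}. \<Sum>\<tau> | \<tau> permutes {..<N + k}.
     coef N \<sigma> \<tau> * ((\<Prod>i<k. F i (\<sigma> (N + i))) * (\<Prod>i<k. G i (\<tau> (N + i))))) =
   fact N * (\<Prod>m<N + k. fact m) * (\<Sum>\<eta> | \<eta> \<in> partitions k \<and> \<eta> 1 \<le> N.
     pdet k (\<lambda>i j. F i (exps k \<eta> j)) * pdet k (\<lambda>i j. G i (exps k \<eta> j)) / (\<Prod>j<k. fact (exps k \<eta> j)))"
proof -
  define g where "g l = (\<Prod>i<k. F i (l i)) * pdet k (\<lambda>i j. G i (l j)) / (\<Prod>i<k. fact (l i))" for l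
  define r where "r \<sigma> = (\<lambda>i\<in>{..<k}. \<sigma> (N + i))" for \<sigma> :: "nat \<Rightarrow> nat"
  let ?S = "{\<sigma>. \<sigma> permutes {..<N + k}}"
  let ?Fac = "\<Prod>m<N + k. fact m :: complex"
  have gr: "g (r \<sigma>) = g (\<lambda>i. \<sigma> (N + i))" for \<sigma>
    unfolding g_def r_def by (intro arg_cong2[of _ _ _ _ "(/)"] arg_cong2[of _ _ _ _ "(*)"] prod.cong pdet_cong) auto
  have "(\<Sum>\<sigma>\<in>?S. \<Sum>\<tau> | \<tau> permutes {..<N + k}.
     coef N \<sigma> \<tau> * ((\<Prod>i<k. F i (\<sigma> (N + i))) * (\<Prod>i<k. G i (\<tau> (N + i))))) = (\<Sum>\<sigma>\<in>?S. ?Fac * g (r \<sigma>))"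
  proof (rule sum.cong[OF refl])
    fix \<sigma> assume "\<sigma> \<in> ?S"
    then have s: "\<sigma> permutes {..<N + k}" by simp
    have "(\<Prod>m<N + k. fact (\<sigma> m)) = ?Fac"
      using prod.permute[OF s, of "fact :: nat \<Rightarrow> complex"] by (simp add: comp_def)
    \<comment> \<open>The factorials over the first N places are the full product divided by those
      over the last k, which is where the denominators come from.\<close>
    then have F: "(\<Prod>i<N. fact (\<sigma> i)) * (\<Prod>i<k. fact (\<sigma> (N + i))) = ?Fac" by (simp add: prod_lessThan_add)
    have "(\<Sum>\<tau> | \<tau> permutes {..<N + k}. coef N \<sigma> \<tau> * ((\<Prod>i<k. F i (\<sigma> (N + i))) * (\<Prod>i<k. G i (\<tau> (N + i)))))
      = (\<Prod>i<k. F i (\<sigma> (N + i))) * (\<Sum>\<tau> | \<tau> permutes {..<N + k}. coef N \<sigma> \<tau> * (\<Prod>i<k. G i (\<tau> (N + i))))"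
      by (simp add: sum_distrib_left mult_ac)
    also have "\<dots> = (\<Prod>i<k. F i (\<sigma> (N + i))) * ((\<Prod>i<N. fact (\<sigma> i)) * pdet k (\<lambda>i j. G i (\<sigma> (N + j))))"
      by (simp add: sum_coef[OF s])
    also have "\<dots> = ?Fac * g (\<lambda>i. \<sigma> (N + i))"
      unfolding g_def F[symmetric] by (simp add: field_simps)
    finally show "(\<Sum>\<tau> | \<tau> permutes {..<N + k}. coef N \<sigma> \<tau> * ((\<Prod>i<k. F i (\<sigma> (N + i))) * (\<Prod>i<k. G i (\<tau> (N + i)))))
       = ?Fac * g (r \<sigma>)" by (simp add: gr)
  qed
  also have "\<dots> = ?Fac * (\<Sum>\<sigma>\<in>?S. g (r \<sigma>))" by (simp add: sum_distrib_left)
  also have "(\<Sum>\<sigma>\<in>?S. g (r \<sigma>)) = (\<Sum>l\<in>injseqs k (N + k). \<Sum>\<sigma>\<in>{\<sigma>\<in>?S. r \<sigma> = l}. g (r \<sigma>))"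
  proof (rule sum.group[symmetric])
    show "finite ?S" by (rule finite_permutations) simp
    show "finite (injseqs k (N + k))" by (rule finite_injseqs)
    show "r ` ?S \<subseteq> injseqs k (N + k)"
    proof (rule image_subsetI)
      fix \<sigma> assume "\<sigma> \<in> ?S"
      then have s: "\<sigma> permutes {..<N + k}" by simp
      have "inj_on (r \<sigma>) {..<k}"
        by (rule inj_onI) (auto simp: r_def dest: injD[OF permutes_inj[OF s]])
      moreover have "\<sigma> (N + i) < N + k" if "i < k" for i using permutes_in_image[OF s, of "N + i"] that by simp
      ultimately show "r \<sigma> \<in> injseqs k (N + k)" by (auto simp: injseqs_def r_def)
    qed
  qed
  also have "\<dots> = (\<Sum>l\<in>injseqs k (N + k). fact N * g l)"
  proof (rule sum.cong[OF refl])
    fix l assume l: "l \<in> injseqs k (N + k)"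
    have "(\<Sum>\<sigma>\<in>{\<sigma>\<in>?S. r \<sigma> = l}. g (r \<sigma>)) = of_nat (card {\<sigma>\<in>?S. r \<sigma> = l}) * g l"
      by simp
    also have "card {\<sigma>\<in>?S. r \<sigma> = l} = fact N"
      using card_extensions[OF l] by (simp add: r_def)
    finally show "(\<Sum>\<sigma>\<in>{\<sigma>\<in>?S. r \<sigma> = l}. g (r \<sigma>)) = fact N * g l" by simp
  qed
  also have "\<dots> = fact N * (\<Sum>l\<in>injseqs k (N + k). g l)" by (simp add: sum_distrib_left)
  also have "(\<Sum>l\<in>injseqs k (N + k). g l) = (\<Sum>x\<in>{\<eta>. \<eta> \<in> partitions k \<and> \<eta> 1 \<le> N} \<times> {\<pi>. \<pi> permutes {..<k}}.
      g ((\<lambda>(\<eta>, \<pi>). \<lambda>i\<in>{..<k}. exps k \<eta> (\<pi> i)) x))"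
    by (rule sum.reindex_bij_betw[OF bij_betw_injseqs, symmetric])
  also have "\<dots> = (\<Sum>\<eta> | \<eta> \<in> partitions k \<and> \<eta> 1 \<le> N. \<Sum>\<pi> | \<pi> permutes {..<k}. g (\<lambda>i\<in>{..<k}. exps k \<eta> (\<pi> i)))"
    by (simp add: sum.cartesian_product split_def)
  also have "\<dots> = (\<Sum>\<eta> | \<eta> \<in> partitions k \<and> \<eta> 1 \<le> N.
     pdet k (\<lambda>i j. F i (exps k \<eta> j)) * pdet k (\<lambda>i j. G i (exps k \<eta> j)) / (\<Prod>j<k. fact (exps k \<eta> j)))"
  proof (rule sum.cong[OF refl])
    fix \<eta> :: "nat \<Rightarrow> nat"
    let ?P = "\<Prod>j<k. fact (exps k \<eta> j) :: complex"
    have "(\<Sum>\<pi> | \<pi> permutes {..<k}. g (\<lambda>i\<in>{..<k}. exps k \<eta> (\<pi> i))) =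
       (\<Sum>\<pi> | \<pi> permutes {..<k}. (of_int (sign \<pi>) * (\<Prod>i<k. F i (exps k \<eta> (\<pi> i)))) *
          (pdet k (\<lambda>i j. G i (exps k \<eta> j)) / ?P))"
    proof (rule sum.cong[OF refl])
      fix \<pi> assume "\<pi> \<in> {\<pi>. \<pi> permutes {..<k}}"
      then have p: "\<pi> permutes {..<k}" by simp
      have "g (\<lambda>i\<in>{..<k}. exps k \<eta> (\<pi> i)) = g (\<lambda>i. exps k \<eta> (\<pi> i))"
        unfolding g_def by (intro arg_cong2[of _ _ _ _ "(/)"] arg_cong2[of _ _ _ _ "(*)"] prod.cong pdet_cong) auto
      moreover have "(\<Prod>i<k. fact (exps k \<eta> (\<pi> i))) = ?P"
        using prod.permute[OF p, of "\<lambda>i. fact (exps k \<eta> i) :: complex"] by (simp add: comp_def)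
      moreover have "pdet k (\<lambda>i j. G i (exps k \<eta> (\<pi> j))) = of_int (sign \<pi>) * pdet k (\<lambda>i j. G i (exps k \<eta> j))"
        by (rule pdet_permute_columns[OF p])
      ultimately show "g (\<lambda>i\<in>{..<k}. exps k \<eta> (\<pi> i)) = (of_int (sign \<pi>) * (\<Prod>i<k. F i (exps k \<eta> (\<pi> i)))) *
          (pdet k (\<lambda>i j. G i (exps k \<eta> j)) / ?P)"
        by (simp add: g_def mult_ac)
    qed
    also have "\<dots> = pdet k (\<lambda>i j. F i (exps k \<eta> j)) * (pdet k (\<lambda>i j. G i (exps k \<eta> j)) / ?P)"
      by (simp only: sum_distrib_right[symmetric] pdet_def[of k "\<lambda>i j. F i (exps k \<eta> j)"])
    finally show "(\<Sum>\<pi> | \<pi> permutes {..<k}. g (\<lambda>i\<in>{..<k}. exps k \<eta> (\<pi> i))) =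
      pdet k (\<lambda>i j. F i (exps k \<eta> j)) * pdet k (\<lambda>i j. G i (exps k \<eta> j)) / ?P" by simp
  qed
  finally show ?thesis by (simp add: mult_ac)
qed

subsection \<open>Solving the heat equation\<close>

context matrix_flow
begin

definition heat :: "((nat \<Rightarrow> complex) \<Rightarrow> complex) \<Rightarrow> bool" where
  "heat f \<longleftrightarrow> polyfun {..m} f \<and>
     pd 0 f = (\<lambda>p. \<Sum>v\<in>{1..m}. - rate (v - 1) (v - 1) p * pd v (pd v f) p)"

lemma heat_vdm_mean: "heat (vdm_mean TYPE('n::finite))"
  unfolding heat_def using polyfun_vdm_mean vdm_mean_heat by blast

lemma heat_cmult:
  assumes "heat f"
  shows "heat (\<lambda>p. c * f p)"
proof -
  have pf: "polyfun {..m} f" using assms by (simp add: heat_def)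
  show ?thesis using assms unfolding heat_def
    by (auto simp: pd_cmult[OF pf] pd_cmult[OF polyfun_pd[OF pf]] sum_distrib_left mult.left_commute
        intro: polyfun_cmult)
qed

lemma heat_add:
  assumes "heat f" "heat g"
  shows "heat (\<lambda>p. f p + g p)"
proof -
  have pf: "polyfun {..m} f" "polyfun {..m} g" using assms by (simp_all add: heat_def)
  show ?thesis using assms unfolding heat_def
    by (auto simp: pd_add[OF pf] pd_add[OF polyfun_pd[OF pf(1)] polyfun_pd[OF pf(2)]] sum_subtractf sum_negf distrib_left
        intro: polyfun.add)
qed

lemma heat_sum:
  assumes "\<And>i. i \<in> S \<Longrightarrow> heat (f i)"
  shows "heat (\<lambda>p. \<Sum>i\<in>S. f i p)"
proof -
  have "heat (\<lambda>p. 0)" by (auto simp: heat_def intro: polyfun.const)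
  then show ?thesis using assms
    by (induction S rule: infinite_finite_induct) (auto intro: heat_add)
qed

lemma heat_eqI:
  assumes f: "heat f" and g: "heat g" and s: "\<And>p. p 0 = s \<Longrightarrow> f p = g p"
  shows "f p = g p"
proof -
  have d: "heat (\<lambda>p. f p + - 1 * g p)" by (intro heat_add heat_cmult f g)
  have "f p + - 1 * g p = 0"
  proof (rule heat_unique[where V = "{..m}" and Z = "{1..m}" and t = 0 and s = s
        and f = "\<lambda>p. f p + - 1 * g p" and \<rho> = "\<lambda>v p. - rate (v - 1) (v - 1) p"])
    show "pd 0 (\<lambda>p. f p + - 1 * g p) =
       (\<lambda>p. \<Sum>v\<in>{1..m}. - rate (v - 1) (v - 1) p * pd v (pd v (\<lambda>p. f p + - 1 * g p)) p)"
      using d unfolding heat_def by blast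
    show "polyfun {..m} (\<lambda>p. f p + - 1 * g p)" using d unfolding heat_def by blast
    show "polyfun {0} (\<lambda>p. - rate (v - 1) (v - 1) p)" for v by (intro polyfun_minus polyfun_rate)
    show "f p + - 1 * g p = 0" if "p 0 = s" for p using s[of p] that by simp
  qed auto
  then show ?thesis by simp
qed

text \<open>The second moment of entries (r, c) and (c, r) of a G + b G* is 2 a b.\<close>

definition variance_at :: "nat \<Rightarrow> (nat \<Rightarrow> complex) \<Rightarrow> complex" where
  "variance_at j p = 2 * (C j False p * C j True p)"

definition herm :: "nat \<Rightarrow> nat \<Rightarrow> (nat \<Rightarrow> complex) \<Rightarrow> complex" where
  "herm j l p = He l (variance_at j p) (p (Suc j))"

lemma polyfun_herm: "j < m \<Longrightarrow> polyfun {..m} (herm j l)"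
  unfolding herm_def[abs_def] variance_at_def
  by (intro polyfun_He polyfun.mult polyfun.const polyfun.var polyfun_mono[OF polyfun_C]) auto

lemma pd_t_herm: "pd 0 (herm j l) p = - rate j j p * (of_nat l * of_nat (l - 1) * herm j (l - 2) p)"
proof (rule pd_eqI)
  have "((\<lambda>t. variance_at j (p(0 := t))) has_field_derivative 2 * rate j j p) (at (p 0))"
    unfolding variance_at_def rate_def C_def UNIV_bool
    by (auto intro!: derivative_eq_intros simp: algebra_simps)
  then have "((\<lambda>t. He l (variance_at j (p(0 := t))) (p (Suc j))) has_field_derivative
     - (of_nat l * of_nat (l - 1) / 2) * He (l - 2) (variance_at j (p(0 := p 0))) (p (Suc j)) * (2 * rate j j p)) (at (p 0))"
    by (rule DERIV_chain2[OF He_deriv_s])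
  then show "((\<lambda>t. herm j l (p(0 := t))) has_field_derivative
     - rate j j p * (of_nat l * of_nat (l - 1) * herm j (l - 2) p)) (at (p 0))"
    by (simp add: herm_def mult_ac)
qed

lemma variance_at_update: "variance_at j (p(Suc i := t)) = variance_at j p"
  by (simp add: variance_at_def C_def)

lemma pd_u_herm: "pd (Suc i) (herm j l) = (\<lambda>p. if i = j then of_nat l * herm j (l - 1) p else 0)"
proof (rule ext, rule pd_eqI)
  fix p
  show "((\<lambda>t. herm j l (p(Suc i := t))) has_field_derivative (if i = j then of_nat l * herm j (l - 1) p else 0)) (at (p (Suc i)))"
    using He_deriv_z[of l "variance_at j p" "p (Suc j)"] by (auto simp: herm_def variance_at_update)
qed

lemma pd_uu_herm:
  assumes "j < m"
  shows "pd (Suc j) (pd (Suc j) (herm j l)) = (\<lambda>p. of_nat l * of_nat (l - 1) * herm j (l - 2) p)"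
proof -
  have "pd (Suc j) (herm j l) = (\<lambda>p. of_nat l * herm j (l - 1) p)" by (simp add: pd_u_herm)
  then show ?thesis by (simp add: pd_cmult[OF polyfun_herm[OF assms]] pd_u_herm diff_diff_add numeral_2_eq_2 mult.assoc)
qed

definition herm_prod :: "(nat \<Rightarrow> nat) \<Rightarrow> (nat \<Rightarrow> complex) \<Rightarrow> complex" where
  "herm_prod ls p = (\<Prod>j<m. herm j (ls j) p)"

text \<open>Each factor depends on the time and on its own coordinate u, and its variance changes at
  the speed 2 \<open>rate j j\<close>, matching the backward heat equation of
  \<open>He\<close>.\<close>

lemma heat_herm_prod: "heat (herm_prod ls)"
  unfolding heat_def
proof
  show "polyfun {..m} (herm_prod ls)"
    unfolding herm_prod_def[abs_def] by (intro polyfun_prod polyfun_herm) auto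
  define R where "R j p = (\<Prod>i\<in>{..<m} - {j}. herm i (ls i) p)" for j p
  have pR: "polyfun {..m} (R j)" for j
    unfolding R_def[abs_def] by (intro polyfun_prod polyfun_herm) auto
  have pdR: "pd (Suc j) (R j) = (\<lambda>p. 0)" for j
  proof
    fix p
    have "pd (Suc j) (R j) p = (\<Sum>i\<in>{..<m} - {j}. pd (Suc j) (herm i (ls i)) p * (\<Prod>l\<in>{..<m} - {j} - {i}. herm l (ls l) p))"
      unfolding R_def[abs_def] by (subst pd_prod[where V = "{..m}"]) (auto intro: polyfun_herm)
    also have "\<dots> = 0" by (intro sum.neutral) (auto simp: pd_u_herm)
    finally show "pd (Suc j) (R j) p = 0" .
  qed
  have herm_prod_R: "herm_prod ls = (\<lambda>p. herm j (ls j) p * R j p)" if "j < m" for j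
    using that by (simp add: herm_prod_def[abs_def] R_def fun_eq_iff prod.remove[of "{..<m}" j])
  have uu: "pd (Suc j) (pd (Suc j) (herm_prod ls)) p = pd (Suc j) (pd (Suc j) (herm j (ls j))) p * R j p" if j: "j < m" for j p
  proof -
    have "pd (Suc j) (herm_prod ls) = (\<lambda>p. pd (Suc j) (herm j (ls j)) p * R j p)"
      unfolding herm_prod_R[OF j] pd_mult[OF polyfun_herm[OF j] pR] by (simp add: pdR)
    then show ?thesis
      by (simp add: pd_mult[OF polyfun_pd[OF polyfun_herm[OF j]] pR] pdR)
  qed
  show "pd 0 (herm_prod ls) = (\<lambda>p. \<Sum>v\<in>{1..m}. - rate (v - 1) (v - 1) p * pd v (pd v (herm_prod ls)) p)"
  proof
    fix p
    have "pd 0 (herm_prod ls) p = (\<Sum>j<m. pd 0 (herm j (ls j)) p * R j p)"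
      unfolding herm_prod_def[abs_def] R_def by (subst pd_prod[where V = "{..m}"]) (auto intro: polyfun_herm)
    also have "\<dots> = (\<Sum>j<m. - rate j j p * pd (Suc j) (pd (Suc j) (herm_prod ls)) p)"
      by (intro sum.cong refl) (simp add: uu pd_uu_herm pd_t_herm)
    also have "\<dots> = (\<Sum>v\<in>{1..m}. - rate (v - 1) (v - 1) p * pd v (pd v (herm_prod ls)) p)"
      by (rule sum.reindex_bij_witness[of _ "\<lambda>v. v - 1" Suc]) auto
    finally show "pd 0 (herm_prod ls) p = (\<Sum>v\<in>{1..m}. - rate (v - 1) (v - 1) p * pd v (pd v (herm_prod ls)) p)" .
  qed
qed

lemma group_vdm_one_group:
  assumes "\<And>i j. i < m \<Longrightarrow> j < m \<Longrightarrow> grp i = grp j"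
  shows "group_vdm p = vdm m (\<lambda>i. p (Suc i))"
proof -
  obtain c where g: "\<And>i. i < m \<Longrightarrow> grp i = c" using assms by blast
  have "vdm m (\<lambda>i. p (Suc i)) = (\<Prod>q\<in>Sigma {..<m} (\<lambda>j. {..<j}). p (Suc (fst q)) - p (Suc (snd q)))"
    unfolding vdm_def by (subst prod.Sigma) (auto simp: split_def)
  also have "\<dots> = group_vdm p"
    unfolding group_vdm_def
    by (rule prod.reindex_bij_witness[of _ "\<lambda>(a, b). (b, a)" "\<lambda>(a, b). (b, a)"])
      (auto simp: pairs_def g)
  finally show ?thesis ..
qed

lemma group_vdm_two_groups:
  assumes m: "m = k + k" and grp: "\<And>i. grp i \<longleftrightarrow> i < k"
  shows "group_vdm p = vdm k (\<lambda>i. p (Suc i)) * vdm k (\<lambda>i. p (Suc (k + i)))"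
proof -
  let ?d = "\<lambda>q. p (Suc (snd q)) - p (Suc (fst q))"
  have mk: "i < m \<longleftrightarrow> i < k + k" for i by (simp add: m)
  have split: "pairs = {q \<in> pairs. snd q < k} \<union> {q \<in> pairs. \<not> snd q < k}" by auto
  have "group_vdm p = prod ?d {q \<in> pairs. snd q < k} * prod ?d {q \<in> pairs. \<not> snd q < k}"
    unfolding group_vdm_def by (subst split, rule prod.union_disjoint) (auto simp: finite_pairs)
  also have "prod ?d {q \<in> pairs. snd q < k} = (\<Prod>q\<in>Sigma {..<k} (\<lambda>j. {..<j}). p (Suc (fst q)) - p (Suc (snd q)))"
    by (rule prod.reindex_bij_witness[of _ "\<lambda>(a, b). (b, a)" "\<lambda>(a, b). (b, a)"])
      (auto simp: pairs_def grp mk)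
  also have "\<dots> = vdm k (\<lambda>i. p (Suc i))"
    unfolding vdm_def by (subst prod.Sigma) (auto simp: split_def)
  also have "prod ?d {q \<in> pairs. \<not> snd q < k} =
     (\<Prod>q\<in>Sigma {..<k} (\<lambda>j. {..<j}). p (Suc (k + fst q)) - p (Suc (k + snd q)))"
    by (rule prod.reindex_bij_witness[of _ "\<lambda>(a, b). (k + b, k + a)" "\<lambda>(a, b). (b - k, a - k)"])
      (auto simp: pairs_def grp mk)
  also have "\<dots> = vdm k (\<lambda>i. p (Suc (k + i)))"
    unfolding vdm_def by (subst prod.Sigma) (auto simp: split_def)
  finally show ?thesis .
qed

end

lemma mdet_scalar: "mdet (\<lambda>r c :: 'n::finite. if r = c then a else 0) = a ^ CARD('n)"
  using det_diagonal[of "\<chi> r c. if r = c then a else 0 :: complex^'n^'n"] by (simp add: mdet_eq)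

text \<open>The first k factors form one group, the last k another. Path A moves the first group from G to
  X = G + G*/2 and then path B moves the second group from G* to X; both keep the covariance 1 of the
  two groups. Path C scales X up from 0.\<close>

definition c0A :: "nat \<Rightarrow> nat \<Rightarrow> bool \<Rightarrow> complex" where
  "c0A k j b = (if j < k then (if b then 0 else 1) else (if b then 1 else 0))"
definition c1A :: "nat \<Rightarrow> nat \<Rightarrow> bool \<Rightarrow> complex" where
  "c1A k j b = (if j < k then (if b then 1 else 0) else 0)"
definition c0B :: "nat \<Rightarrow> nat \<Rightarrow> bool \<Rightarrow> complex" where
  "c0B k j b = (if j < k then (if b then 1 / 2 else 1) else (if b then 1 else 0))"
definition c1B :: "nat \<Rightarrow> nat \<Rightarrow> bool \<Rightarrow> complex" where
  "c1B k j b = (if j < k then 0 else (if b then - 1 / 2 else 1))"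
definition c1C :: "nat \<Rightarrow> bool \<Rightarrow> complex" where
  "c1C j b = (if b then 1 / 2 else 1)"

section \<open>Solutions along the three paths\<close>

context
  fixes k N :: nat
begin

interpretation A: matrix_flow "k + k" "c0A k" "c1A k" "\<lambda>j. j < k"
  by unfold_locales (auto simp: c0A_def c1A_def UNIV_bool fun_eq_iff)

interpretation B: matrix_flow "k + k" "c0B k" "c1B k" "\<lambda>j. j < k"
  by unfold_locales (auto simp: c0B_def c1B_def UNIV_bool fun_eq_iff)

interpretation C: matrix_flow "k + k" "\<lambda>_ _. 0" c1C "\<lambda>j. True"
  by unfold_locales (auto simp: c1C_def)

text \<open>The claimed sum before sorting into partitions, normalized by the constant of
  \<open>hermite_identity\<close>. \<open>H\<close> is a parameter so that the same combination
  serves on paths A and B.\<close>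

definition hermite_sum :: "((nat \<Rightarrow> nat) \<Rightarrow> (nat \<Rightarrow> complex) \<Rightarrow> complex) \<Rightarrow> (nat \<Rightarrow> complex) \<Rightarrow> complex" where
  "hermite_sum H p = 1 / (fact N * (\<Prod>i<N. fact i)) *
     (\<Sum>\<sigma> | \<sigma> permutes {..<N + k}. \<Sum>\<tau> | \<tau> permutes {..<N + k}.
        coef N \<sigma> \<tau> * H (\<lambda>j. if j < k then \<sigma> (N + j) else \<tau> (N + (j - k))) p)"

text \<open>At time 0 the matrices are - u_j times the identity, and \<Delta>(u) times the N-th
  powers of all u_j is the determinant of the powers u_i^(N + j). The flow replaces powers by
  Hermite polynomials, whose variance at time 1 is 1.\<close>

lemma C_solution:
  assumes N: "N = CARD('n::finite)" and p0: "p 0 = 1"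
  shows "C.vdm_mean TYPE('n) p = pdet (k + k) (\<lambda>i j. He (N + j) 1 (p (Suc i)))"
proof -
  let ?S = "\<lambda>p. \<Sum>\<pi> | \<pi> permutes {..<k + k}. of_int (sign \<pi>) * C.herm_prod (\<lambda>i. N + \<pi> i) p"
  have "C.vdm_mean TYPE('n) p = ?S p"
  proof (rule C.heat_eqI[OF C.heat_vdm_mean, where s = 0])
    show "C.heat ?S" by (intro C.heat_sum C.heat_cmult C.heat_herm_prod)
    fix p :: "nat \<Rightarrow> complex" assume p: "p 0 = 0"
    have "C.det_at j e p = (- p (Suc j)) ^ N" for j and e :: "'n \<times> 'n \<times> bool \<Rightarrow> complex"
    proof -
      have "C.mat_at j e p r c = (if r = c then - p (Suc j) else 0)" for r c
        by (simp add: C.mat_at_def C.C_def p)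
      then show ?thesis by (simp add: C.det_at_def mdet_scalar N)
    qed
    then have "C.mean_prod TYPE('n) p = (\<Prod>j<k + k. (- p (Suc j)) ^ N)"
      by (simp add: C.mean_prod_def C.rest_def ginibre_const)
    also have "\<dots> = (\<Prod>j<k + k. p (Suc j) ^ N)"
    proof -
      have "(\<Prod>j<k + k. (- p (Suc j)) ^ N) = (\<Prod>j<k + k. (- 1) ^ N * p (Suc j) ^ N)"
        by (intro prod.cong refl) (rule power_minus)
      also have "\<dots> = ((- 1) ^ N) ^ (k + k) * (\<Prod>j<k + k. p (Suc j) ^ N)"
        by (simp add: prod.distrib)
      \<comment> \<open>The signs cancel because the number of factors is even.\<close>
      also have "((- 1) ^ N) ^ (k + k) = (1 :: complex)"
        by (simp add: power_mult[symmetric] mult_2[symmetric] power_even_eq[symmetric])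
      finally show ?thesis by simp
    qed
    finally have Q: "C.mean_prod TYPE('n) p = (\<Prod>j<k + k. p (Suc j) ^ N)" .
    have "C.vdm_mean TYPE('n) p = (\<Prod>j<k + k. p (Suc j) ^ N) * pdet (k + k) (\<lambda>i j. p (Suc i) ^ j)"
      by (simp add: C.vdm_mean_def C.group_vdm_one_group Q pdet_power[where y = "\<lambda>i. p (Suc i)"])
    also have "\<dots> = pdet (k + k) (\<lambda>i j. p (Suc i) ^ N * p (Suc i) ^ j)"
      by (simp add: pdet_row_scale)
    also have "\<dots> = ?S p"
      unfolding pdet_def C.herm_prod_def C.herm_def
      by (simp add: C.variance_at_def C.C_def p He_0_var power_add)
    finally show "C.vdm_mean TYPE('n) p = ?S p" .
  qed
  also have "?S p = pdet (k + k) (\<lambda>i j. He (N + j) 1 (p (Suc i)))"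
    unfolding pdet_def C.herm_prod_def C.herm_def by (simp add: C.variance_at_def C.C_def c1C_def p0)
  finally show ?thesis .
qed

lemma B_heat_hermite_sum: "B.heat (hermite_sum B.herm_prod)"
  unfolding hermite_sum_def by (intro B.heat_sum B.heat_cmult B.heat_herm_prod)

lemma A_heat_hermite_sum: "A.heat (hermite_sum A.herm_prod)"
  unfolding hermite_sum_def by (intro A.heat_sum A.heat_cmult A.heat_herm_prod)

lemma inj_update: "inj_on p {1..k + k} \<Longrightarrow> inj_on (p(0 := t)) {1..k + k}"
  by (subst inj_on_cong[of _ _ p]) auto

text \<open>At time 1 path B has the matrices of path C at time 1, so only the Vandermonde products
  differ, by the differences w_j - z_i. Dividing by these uses distinct coordinates.\<close>

lemma B_solution_inj:
  assumes N: "N = CARD('n::finite)" and p0: "p 0 = 1" and inj: "inj_on p {1..k + k}"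
  shows "B.vdm_mean TYPE('n) p = hermite_sum B.herm_prod p"
proof -
  define z where "z i = p (Suc i)" for i
  define w where "w i = p (Suc (k + i))" for i
  let ?D = "\<Prod>j<k. \<Prod>i<k. w j - z i"
  have u: "p (Suc i) = join k z w i" for i by (simp add: join_def z_def w_def)
  have D: "?D \<noteq> 0"
  proof -
    have "w j \<noteq> z i" if "j < k" "i < k" for i j
      using inj_onD[OF inj, of "Suc (k + j)" "Suc i"] that by (auto simp: z_def w_def)
    then show ?thesis by simp
  qed
  have "B.mat_at j e p r c = C.mat_at j e p r c" for j e and r c :: 'n
    by (simp add: B.mat_at_def C.mat_at_def B.C_def C.C_def c0B_def c1B_def c1C_def p0)
  then have Q: "B.mean_prod TYPE('n) p = C.mean_prod TYPE('n) p"
    by (simp add: B.mean_prod_def C.mean_prod_def B.rest_def C.rest_def B.det_at_def C.det_at_def)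
  have V: "C.group_vdm p = B.group_vdm p * ?D"
    by (simp add: C.group_vdm_one_group B.group_vdm_two_groups vdm_add z_def w_def)
  have "B.vdm_mean TYPE('n) p * ?D = C.vdm_mean TYPE('n) p"
    by (simp add: B.vdm_mean_def C.vdm_mean_def Q V mult_ac)
  also have "\<dots> = pdet (k + k) (\<lambda>i j. He (N + j) 1 (join k z w i))"
    by (simp add: C_solution[where p = p, OF N p0] u)
  also have "\<dots> = hermite_sum B.herm_prod p * ?D"
  proof -
    have herm_prod: "B.herm_prod (\<lambda>j. if j < k then \<sigma> (N + j) else \<tau> (N + (j - k))) p =
       (\<Prod>i<k. He (\<sigma> (N + i)) 1 (z i)) * (\<Prod>i<k. He (\<tau> (N + i)) 1 (w i))" for \<sigma> \<tau>
      unfolding B.herm_prod_def B.herm_def prod_lessThan_add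
      by (simp add: B.variance_at_def B.C_def c0B_def c1B_def p0 z_def w_def)
    have "fact N * (\<Prod>i<N. fact i) \<noteq> (0 :: complex)" by simp
    then show ?thesis
      using hermite_identity[where N = N and k = k and z = z and w = w] by (simp add: hermite_sum_def herm_prod)
  qed
  finally show ?thesis using D by simp
qed

lemma B_solution:
  assumes N: "N = CARD('n::finite)"
  shows "B.vdm_mean TYPE('n) p = hermite_sum B.herm_prod p"
proof (rule B.heat_eqI[OF B.heat_vdm_mean B_heat_hermite_sum, where s = 1])
  fix p :: "nat \<Rightarrow> complex" assume p: "p 0 = 1"
  \<comment> \<open>Freezing the time keeps the function polynomial, and distinctness concerns only
    coordinates 1, ..., 2k, so coinciding ones can be reached within the slice.\<close>
  have upd: "polyfun {..k + k} (\<lambda>p. f (p(0 := 1)))" if "polyfun {..k + k} f" for f :: "(nat \<Rightarrow> complex) \<Rightarrow> complex"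
    by (rule polyfun_compose[OF that]) (auto simp: fun_upd_apply intro!: polyfun_intros)
  have "B.vdm_mean TYPE('n) (p(0 := 1)) = hermite_sum B.herm_prod (p(0 := 1))"
  proof (rule polyfun_eq_if_eq_on_inj[where S = "{1..k + k}" and f = "\<lambda>p. B.vdm_mean TYPE('n) (p(0 := 1))"
        and g = "\<lambda>p. hermite_sum B.herm_prod (p(0 := 1))"])
    show "polyfun {..k + k} (\<lambda>p. B.vdm_mean TYPE('n) (p(0 := 1)))" by (rule upd[OF B.polyfun_vdm_mean])
    show "polyfun {..k + k} (\<lambda>p. hermite_sum B.herm_prod (p(0 := 1)))"
      using B_heat_hermite_sum by (intro upd) (simp add: B.heat_def)
    show "B.vdm_mean TYPE('n) (p(0 := 1)) = hermite_sum B.herm_prod (p(0 := 1))" if "inj_on p {1..k + k}" for p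
      by (rule B_solution_inj[OF N]) (use inj_update[OF that] in auto)
  qed simp
  moreover have "p(0 := 1) = p" using p by auto
  ultimately show "B.vdm_mean TYPE('n) p = hermite_sum B.herm_prod p" by simp
qed

text \<open>Path A at time 1/2 is path B at time 0; from there uniqueness carries the identity back
  to time 0 of path A, the pair of G and its adjoint.\<close>

lemma A_solution:
  assumes N: "N = CARD('n::finite)"
  shows "A.vdm_mean TYPE('n) p = hermite_sum A.herm_prod p"
proof (rule A.heat_eqI[OF A.heat_vdm_mean A_heat_hermite_sum, where s = "1 / 2"])
  fix p :: "nat \<Rightarrow> complex" assume p: "p 0 = 1 / 2"
  have "A.mat_at j e p r c = B.mat_at j e (p(0 := 0)) r c" for j e and r c :: 'n
    by (simp add: A.mat_at_def B.mat_at_def A.C_def B.C_def c0A_def c1A_def c0B_def c1B_def p)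
  then have "A.mean_prod TYPE('n) p = B.mean_prod TYPE('n) (p(0 := 0))"
    by (simp add: A.mean_prod_def B.mean_prod_def A.rest_def B.rest_def A.det_at_def B.det_at_def)
  then have "A.vdm_mean TYPE('n) p = B.vdm_mean TYPE('n) (p(0 := 0))"
    by (simp add: A.vdm_mean_def B.vdm_mean_def A.group_vdm_two_groups B.group_vdm_two_groups)
  moreover have "A.herm j l p = B.herm j l (p(0 := 0))" for j l
    by (simp add: A.herm_def B.herm_def A.variance_at_def B.variance_at_def A.C_def B.C_def c0A_def c1A_def c0B_def c1B_def p)
  then have "hermite_sum A.herm_prod p = hermite_sum B.herm_prod (p(0 := 0))"
    by (simp add: hermite_sum_def A.herm_prod_def B.herm_prod_def)
  ultimately show "A.vdm_mean TYPE('n) p = hermite_sum A.herm_prod p" by (simp add: B_solution[OF N])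
qed

section \<open>From the Hermite sum at time 0 to Schur polynomials\<close>

lemma dvdm_vdm: "dvdm n y * dvdm n y' = vdm n y * vdm n y'" for y y' :: "nat \<Rightarrow> complex"
proof -
  define s :: complex where "s = (\<Prod>j<n. \<Prod>i<j. - 1)"
  have d: "dvdm n y = s * vdm n y" for y :: "nat \<Rightarrow> complex"
  proof -
    have "dvdm n y = (\<Prod>j<n. \<Prod>i<j. - 1 * (y j - y i))" by (simp add: dvdm_def)
    then show ?thesis by (simp only: prod.distrib vdm_def s_def)
  qed
  have "s * s = 1"
    by (simp add: s_def prod.distrib[symmetric] power_mult_distrib[symmetric])
  moreover have "dvdm n y * dvdm n y' = (s * s) * (vdm n y * vdm n y')"
    unfolding d by (simp only: mult_ac)
  ultimately show ?thesis by simp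
qed

definition zw_vars :: "(nat \<Rightarrow> complex) \<Rightarrow> (nat \<Rightarrow> complex) \<Rightarrow> nat \<Rightarrow> complex" where
  "zw_vars z w i = (if i = 0 then 0 else if i \<le> k then z i else w (i - k))"

text \<open>At time 0 of path A both variances vanish, so the Hermite polynomials are powers and the
  determinants over \<eta> are alternants. The Vandermonde products cancel at distinct
  coordinates.\<close>

lemma ginibre_exp_partitions_inj:
  assumes N: "N = CARD('n::finite)" and inj: "inj_on p {1..k + k}" and p0: "p 0 = 0"
  shows "A.mean_prod TYPE('n) p = (\<Sum>\<eta> | \<eta> \<in> partitions k \<and> \<eta> 1 \<le> N.
     schur k \<eta> p * schur k \<eta> (\<lambda>i. p (k + i)) * (\<Prod>j=1..k. fact (N + j - 1) / fact (\<eta> j + k - j)))"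
proof -
  define z where "z i = p (Suc i)" for i
  define w where "w i = p (Suc (k + i))" for i
  have hermite_sum: "hermite_sum A.herm_prod p = 1 / (fact N * (\<Prod>i<N. fact i)) *
     (\<Sum>\<sigma> | \<sigma> permutes {..<N + k}. \<Sum>\<tau> | \<tau> permutes {..<N + k}.
        coef N \<sigma> \<tau> * ((\<Prod>i<k. z i ^ \<sigma> (N + i)) * (\<Prod>i<k. w i ^ \<tau> (N + i))))"
    unfolding hermite_sum_def A.herm_prod_def A.herm_def prod_lessThan_add
    by (simp add: A.variance_at_def A.C_def c0A_def c1A_def p0 z_def w_def He_0_var)
  have "(\<Prod>m<N + k. fact m) = (\<Prod>i<N. fact i) * (\<Prod>i<k. fact (N + i) :: complex)"
    by (rule prod_lessThan_add)
  then have const: "1 / (fact N * (\<Prod>i<N. fact i)) * (fact N * (\<Prod>m<N + k. fact m)) = (\<Prod>i<k. fact (N + i) :: complex)"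
    by simp
  have "vdm k z * vdm k w * A.mean_prod TYPE('n) p = A.vdm_mean TYPE('n) p"
    by (simp add: A.vdm_mean_def A.group_vdm_two_groups z_def[abs_def] w_def[abs_def])
  also have "\<dots> = (\<Prod>i<k. fact (N + i)) * (\<Sum>\<eta> | \<eta> \<in> partitions k \<and> \<eta> 1 \<le> N.
     pdet k (\<lambda>i j. z i ^ exps k \<eta> j) * pdet k (\<lambda>i j. w i ^ exps k \<eta> j) / (\<Prod>j<k. fact (exps k \<eta> j)))"
    unfolding A_solution[OF N] hermite_sum
      sum_coef_partitions[where F = "\<lambda>i m. z i ^ m" and G = "\<lambda>i m. w i ^ m" and N = N and k = k] const[symmetric]
    by (simp only: mult.assoc)
  also have "\<dots> = (\<Sum>\<eta> | \<eta> \<in> partitions k \<and> \<eta> 1 \<le> N. vdm k z * vdm k w *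
     (schur k \<eta> p * schur k \<eta> (\<lambda>i. p (k + i)) * (\<Prod>j=1..k. fact (N + j - 1) / fact (\<eta> j + k - j))))"
    unfolding sum_distrib_left
  proof (rule sum.cong[OF refl])
    fix \<eta> assume "\<eta> \<in> {\<eta>. \<eta> \<in> partitions k \<and> \<eta> 1 \<le> N}"
    then have \<eta>: "\<eta> \<in> partitions k" by simp
    have 1: "pdet k (\<lambda>i j. z i ^ exps k \<eta> j) = dvdm k z * schur k \<eta> p"
      using alternant_branching[OF \<eta>, of p] by (simp add: alternant_eq schur_branching[OF \<eta>] z_def[abs_def])
    have 2: "pdet k (\<lambda>i j. w i ^ exps k \<eta> j) = dvdm k w * schur k \<eta> (\<lambda>i. p (k + i))"
      using alternant_branching[OF \<eta>, of "\<lambda>i. p (k + i)"] by (simp add: alternant_eq schur_branching[OF \<eta>] w_def[abs_def])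
    have 3: "(\<Prod>j=1..k. fact (N + j - 1) / fact (\<eta> j + k - j)) =
       (\<Prod>i<k. fact (N + i)) / (\<Prod>j<k. fact (exps k \<eta> j) :: complex)"
      unfolding prod_dividef[symmetric] exps_def
      by (rule prod.reindex_bij_witness[of _ Suc "\<lambda>j. j - 1"]) auto
    show "(\<Prod>i<k. fact (N + i)) * (pdet k (\<lambda>i j. z i ^ exps k \<eta> j) * pdet k (\<lambda>i j. w i ^ exps k \<eta> j) / (\<Prod>j<k. fact (exps k \<eta> j))) =
       vdm k z * vdm k w * (schur k \<eta> p * schur k \<eta> (\<lambda>i. p (k + i)) * (\<Prod>j=1..k. fact (N + j - 1) / fact (\<eta> j + k - j)))"
      unfolding 1 2 3 dvdm_vdm[symmetric] by simp
  qed
  also have "\<dots> = vdm k z * vdm k w * (\<Sum>\<eta> | \<eta> \<in> partitions k \<and> \<eta> 1 \<le> N.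
     schur k \<eta> p * schur k \<eta> (\<lambda>i. p (k + i)) * (\<Prod>j=1..k. fact (N + j - 1) / fact (\<eta> j + k - j)))"
    by (simp add: sum_distrib_left)
  finally have eq: "vdm k z * vdm k w * A.mean_prod TYPE('n) p = \<dots>" .
  have "z i \<noteq> z j" if "i < j" "j < k" for i j
    using inj_onD[OF inj, of "Suc i" "Suc j"] that by (auto simp: z_def)
  moreover have "w i \<noteq> w j" if "i < j" "j < k" for i j
    using inj_onD[OF inj, of "Suc (k + i)" "Suc (k + j)"] that by (auto simp: w_def)
  ultimately have "vdm k z * vdm k w \<noteq> 0" by (auto simp: vdm_def) metis+
  with eq show ?thesis by simp
qed

lemma ginibre_exp_partitions:
  assumes N: "N = CARD('n::finite)" and p0: "p 0 = 0"
  shows "A.mean_prod TYPE('n) p = (\<Sum>\<eta> | \<eta> \<in> partitions k \<and> \<eta> 1 \<le> N.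
     schur k \<eta> p * schur k \<eta> (\<lambda>i. p (k + i)) * (\<Prod>j=1..k. fact (N + j - 1) / fact (\<eta> j + k - j)))"
    (is "_ = ?R p")
proof -
  have upd: "polyfun UNIV (\<lambda>p. f (p(0 := 0)))" if "polyfun V f" for V and f :: "(nat \<Rightarrow> complex) \<Rightarrow> complex"
    by (rule polyfun_compose[OF that]) (auto simp: fun_upd_apply intro!: polyfun_intros)
  have "polyfun UNIV (\<lambda>p. schur k \<eta> (\<lambda>i. p (a + i)) :: complex)" if "\<eta> \<in> partitions k" for \<eta> a
    unfolding schur_branching[OF that]
    by (rule polyfun_compose[OF polyfun_branching]) (auto intro!: polyfun.var)
  from this[of _ 0] this[of _ k] have R: "polyfun UNIV ?R"
    by (intro polyfun_sum polyfun.mult polyfun.const) auto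
  have "A.mean_prod TYPE('n) (p(0 := 0)) = ?R (p(0 := 0))"
  proof (rule polyfun_eq_if_eq_on_inj[where S = "{1..k + k}" and f = "\<lambda>p. A.mean_prod TYPE('n) (p(0 := 0))"
        and g = "\<lambda>p. ?R (p(0 := 0))"])
    show "polyfun UNIV (\<lambda>p. A.mean_prod TYPE('n) (p(0 := 0)))" by (rule upd[OF A.polyfun_mean_prod])
    show "polyfun UNIV (\<lambda>p. ?R (p(0 := 0)))" by (rule upd[OF R])
    show "A.mean_prod TYPE('n) (p(0 := 0)) = ?R (p(0 := 0))" if "inj_on p {1..k + k}" for p
      by (rule ginibre_exp_partitions_inj[OF N]) (use inj_update[OF that] in auto)
  qed simp
  moreover have "p(0 := 0) = p" using p0 by auto
  ultimately show ?thesis by simp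
qed

lemma charpoly_product_rest:
  "charpoly_product k z w A = A.rest {} (entries A) (zw_vars z w)"
proof -
  have "Determinants.det (A - Finite_Cartesian_Product.mat (z (Suc j))) = A.det_at j (entries A) (zw_vars z w)" if "j < k" for j
    unfolding mdet_eq A.det_at_def
    by (intro arg_cong[of _ _ mdet] ext)
      (use that in \<open>simp add: A.mat_at_def A.C_def c0A_def c1A_def zw_vars_def entries_def Finite_Cartesian_Product.mat_def\<close>)
  moreover have "Determinants.det (conj_transpose A - Finite_Cartesian_Product.mat (w (Suc j))) =
      A.det_at (k + j) (entries A) (zw_vars z w)" for j
    unfolding mdet_eq A.det_at_def
    by (intro arg_cong[of _ _ mdet] ext)
      (simp add: A.mat_at_def A.C_def c0A_def c1A_def zw_vars_def entries_def Finite_Cartesian_Product.mat_def)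
  moreover have "charpoly_product k z w A = (\<Prod>j<k. Determinants.det (A - Finite_Cartesian_Product.mat (z (Suc j))) *
      Determinants.det (conj_transpose A - Finite_Cartesian_Product.mat (w (Suc j))))"
    unfolding charpoly_product_def by (rule prod.reindex_bij_witness[of _ Suc "\<lambda>j. j - 1"]) auto
  ultimately show ?thesis
    by (simp add: A.rest_def prod_lessThan_add prod.distrib)
qed

lemma charpoly_expectation:
  fixes G :: "'a \<Rightarrow> complex^'n^'n"
  assumes N: "N = CARD('n)" and G: "ginibre_matrix M G"
  shows "integrable M (\<lambda>\<omega>. charpoly_product k z w (G \<omega>))"
    and "R_N M G k z w = (\<Sum>\<eta> | \<eta> \<in> partitions k \<and> \<eta> 1 \<le> N.
     schur k \<eta> z * schur k \<eta> w * (\<Prod>j=1..k. fact (N + j - 1) / fact (\<eta> j + k - j)))"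
proof -
  have pf: "polyfun UNIV (\<lambda>e :: 'n \<times> 'n \<times> bool \<Rightarrow> complex. A.rest {} e (zw_vars z w))"
    by (rule sep_imp_polyfun_left[OF A.sep_rest])
  show "integrable M (\<lambda>\<omega>. charpoly_product k z w (G \<omega>))"
    unfolding charpoly_product_rest by (rule ginibre_integral(1)[OF G pf])
  have "R_N M G k z w = A.mean_prod TYPE('n) (zw_vars z w)"
    unfolding R_N_def charpoly_product_rest A.mean_prod_def by (rule ginibre_integral(2)[OF G pf])
  also have "\<dots> = (\<Sum>\<eta> | \<eta> \<in> partitions k \<and> \<eta> 1 \<le> N.
     schur k \<eta> (zw_vars z w) * schur k \<eta> (\<lambda>i. zw_vars z w (k + i)) * (\<Prod>j=1..k. fact (N + j - 1) / fact (\<eta> j + k - j)))"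
    by (rule ginibre_exp_partitions[OF N]) (simp add: zw_vars_def)
  also have "\<dots> = (\<Sum>\<eta> | \<eta> \<in> partitions k \<and> \<eta> 1 \<le> N.
     schur k \<eta> z * schur k \<eta> w * (\<Prod>j=1..k. fact (N + j - 1) / fact (\<eta> j + k - j)))"
  proof (rule sum.cong[OF refl])
    fix \<eta> assume "\<eta> \<in> {\<eta>. \<eta> \<in> partitions k \<and> \<eta> 1 \<le> N}"
    then have \<eta>: "\<eta> \<in> partitions k" by simp
    have "schur k \<eta> (zw_vars z w) = schur k \<eta> z" "schur k \<eta> (\<lambda>i. zw_vars z w (k + i)) = schur k \<eta> w"
      unfolding schur_branching[OF \<eta>]
      by (rule polyfun_cong[OF polyfun_branching], simp add: zw_vars_def)+
    then show "schur k \<eta> (zw_vars z w) * schur k \<eta> (\<lambda>i. zw_vars z w (k + i)) * (\<Prod>j=1..k. fact (N + j - 1) / fact (\<eta> j + k - j)) =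
      schur k \<eta> z * schur k \<eta> w * (\<Prod>j=1..k. fact (N + j - 1) / fact (\<eta> j + k - j))" by simp
  qed
  finally show "R_N M G k z w = (\<Sum>\<eta> | \<eta> \<in> partitions k \<and> \<eta> 1 \<le> N.
     schur k \<eta> z * schur k \<eta> w * (\<Prod>j=1..k. fact (N + j - 1) / fact (\<eta> j + k - j)))" .
qed

end

subsection \<open>The probability measure on partitions\<close>

lemma schur_nonneg:
  fixes x :: "nat \<Rightarrow> real"
  assumes "\<eta> \<in> partitions k" "\<And>j. j \<in> {1..k} \<Longrightarrow> 0 < x j"
  shows "0 \<le> schur k \<eta> x"
  unfolding schur_branching[OF assms(1)]
  by (rule branching_nonneg) (use assms(2) in \<open>auto intro: less_imp_le\<close>)

text \<open>\<open>schur\<close> is characterized separately over each field; the branching sum,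
  with integer coefficients, commutes with the embedding of the reals.\<close>

lemma schur_of_real:
  assumes "\<eta> \<in> partitions k" "\<And>j. j \<in> {1..k} \<Longrightarrow> z j = complex_of_real (x j)"
  shows "schur k \<eta> z = complex_of_real (schur k \<eta> x)"
proof -
  have *: "branching k l (\<lambda>i. complex_of_real (y i)) = complex_of_real (branching k l y)" for k l y
    by (induction k arbitrary: l) simp_all
  have "schur k \<eta> z = branching k (exps k \<eta>) (\<lambda>i. complex_of_real (x (Suc i)))"
    unfolding schur_branching[OF assms(1)]
    by (rule polyfun_cong[OF polyfun_branching]) (use assms(2) in auto)
  then show ?thesis by (simp add: * schur_branching[OF assms(1)])
qed

text \<open>Schur polynomials are monotone on the positive orthant, so distinct larger arguments reduce the
  bound to one for the alternant.\<close>

lemma schur_bound: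
  fixes x :: "nat \<Rightarrow> real"
  assumes x: "\<And>j. j \<in> {1..k} \<Longrightarrow> 0 < x j \<and> x j \<le> b"
  shows "\<exists>c\<ge>0. \<forall>\<eta>\<in>partitions k. schur k \<eta> x \<le> c * (\<Prod>j<k. (max 0 b + real k + 1) ^ exps k \<eta> j)"
proof -
  define M where "M = max 0 b + real k + 1"
  define X where "X i = max 0 b + real i" for i :: nat
  define D where "D = dvdm k (\<lambda>i. X (Suc i))"
  have "inj_on X {1..k}" by (auto simp: inj_on_def X_def)
  then have D: "D \<noteq> 0" unfolding D_def by (rule dvdm_nonzero)
  have X: "0 \<le> X (Suc i)" "X (Suc i) \<le> M" if "i < k" for i using that by (auto simp: X_def M_def)
  show ?thesis unfolding M_def[symmetric]
  proof (intro exI[of _ "fact k / \<bar>D\<bar>"] conjI ballI)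
    fix \<eta> assume \<eta>: "\<eta> \<in> partitions k"
    have "schur k \<eta> x \<le> branching k (exps k \<eta>) (\<lambda>i. X (Suc i))"
      unfolding schur_branching[OF \<eta>]
    proof (rule branching_mono)
      fix i assume "i < k"
      then show "0 \<le> x (Suc i) \<and> x (Suc i) \<le> X (Suc i)" using x[of "Suc i"] by (auto simp: X_def)
    qed
    also have "\<dots> \<le> \<bar>branching k (exps k \<eta>) (\<lambda>i. X (Suc i))\<bar>" by simp
    also have "\<dots> = \<bar>pdet k (\<lambda>i j. X (Suc i) ^ exps k \<eta> j)\<bar> / \<bar>D\<bar>"
      using D alternant_branching[OF \<eta>, of X] by (simp add: alternant_eq D_def abs_mult)
    also have "\<bar>pdet k (\<lambda>i j. X (Suc i) ^ exps k \<eta> j)\<bar> \<le>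
       (\<Sum>\<pi> | \<pi> permutes {..<k}. \<bar>of_int (sign \<pi>) * (\<Prod>i<k. X (Suc i) ^ exps k \<eta> (\<pi> i))\<bar>)"
      unfolding pdet_def by (rule sum_abs)
    also have "\<dots> \<le> (\<Sum>\<pi> | \<pi> permutes {..<k}. \<Prod>j<k. M ^ exps k \<eta> j)"
    proof (rule sum_mono)
      fix \<pi> assume "\<pi> \<in> {\<pi>. \<pi> permutes {..<k}}"
      then have p: "\<pi> permutes {..<k}" by simp
      have "\<bar>of_int (sign \<pi>) * (\<Prod>i<k. X (Suc i) ^ exps k \<eta> (\<pi> i))\<bar> = (\<Prod>i<k. X (Suc i) ^ exps k \<eta> (\<pi> i))"
      proof -
        have "\<bar>real_of_int (sign \<pi>)\<bar> = 1" by (simp add: sign_def)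
        then show ?thesis using X by (simp add: abs_mult abs_prod power_abs)
      qed
      also have "\<dots> \<le> (\<Prod>i<k. M ^ exps k \<eta> (\<pi> i))"
        using X by (intro prod_mono) (auto intro: power_mono)
      also have "\<dots> = (\<Prod>j<k. M ^ exps k \<eta> j)"
        using prod.permute[OF p, of "\<lambda>i. M ^ exps k \<eta> i"] by (simp add: comp_def)
      finally show "\<bar>of_int (sign \<pi>) * (\<Prod>i<k. X (Suc i) ^ exps k \<eta> (\<pi> i))\<bar> \<le> (\<Prod>j<k. M ^ exps k \<eta> j)" .
    qed
    also have "\<dots> = fact k * (\<Prod>j<k. M ^ exps k \<eta> j)" by (simp add: card_permutations[OF refl])
    finally show "schur k \<eta> x \<le> fact k / \<bar>D\<bar> * (\<Prod>j<k. M ^ exps k \<eta> j)"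
      by (simp add: divide_right_mono)
  qed simp
qed

lemma schur_weight_exps:
  "schur_weight k x y \<eta> = schur k \<eta> x * schur k \<eta> y / (\<Prod>j<k. fact (exps k \<eta> j))"
proof -
  have "(\<Prod>j=1..k. 1 / fact (\<eta> j + k - j)) = (\<Prod>j<k. 1 / fact (exps k \<eta> j) :: real)"
    unfolding exps_def by (rule prod.reindex_bij_witness[of _ Suc "\<lambda>j. j - 1"]) auto
  then show ?thesis by (simp add: schur_weight_def prod_dividef)
qed

text \<open>The exponents determine the partition, so every partial sum is part of a sum over all
  k-tuples, which is bounded by the k-th power of the exponential series.\<close>

lemma exp_product_summable:
  fixes r :: real
  assumes "0 \<le> r"
  shows "(\<lambda>\<eta>. \<Prod>j<k. r ^ exps k \<eta> j / fact (exps k \<eta> j)) summable_on partitions k"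
proof (rule nonneg_bdd_above_summable_on)
  define a where "a n = r ^ n / fact n" for n :: nat
  have a0: "0 \<le> a n" for n using assms by (simp add: a_def)
  have sa: "summable a" using summable_exp[of r] by (simp add: a_def[abs_def] divide_inverse mult.commute)
  show "0 \<le> (\<Prod>j<k. r ^ exps k \<eta> j / fact (exps k \<eta> j))" for \<eta>
    using assms by (intro prod_nonneg) auto
  show "bdd_above (sum (\<lambda>\<eta>. \<Prod>j<k. r ^ exps k \<eta> j / fact (exps k \<eta> j)) ` {F. F \<subseteq> partitions k \<and> finite F})"
  proof (rule bdd_aboveI2)
    fix F assume "F \<in> {F. F \<subseteq> partitions k \<and> finite F}"
    then have F: "F \<subseteq> partitions k" "finite F" by auto
    \<comment> \<open>A common strict bound for the exponents occurring in the finite set F, so that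
      the tuples fill a finite box.\<close>
    define n where "n = Suc (Max (insert 0 ((\<lambda>(\<eta>, j). exps k \<eta> j) ` (F \<times> {..<k}))))"
    have n: "exps k \<eta> j < n" if "\<eta> \<in> F" "j < k" for \<eta> j
      unfolding n_def less_Suc_eq_le using that F(2) by (intro Max_ge) auto
    define e where "e \<eta> = (\<lambda>j\<in>{..<k}. exps k \<eta> j)" for \<eta>
    have eP: "e \<eta> \<in> PiE {..<k} (\<lambda>_. {..<n})" if "\<eta> \<in> F" for \<eta>
      using n[OF that] by (simp add: e_def restrict_PiE_iff)
    have inj: "inj_on e F"
    proof (rule inj_onI)
      fix \<eta> \<eta>' assume h: "\<eta> \<in> F" "\<eta>' \<in> F" "e \<eta> = e \<eta>'"
      have "exps k \<eta> j = exps k \<eta>' j" if "j < k" for j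
        using fun_cong[OF h(3), of j] that by (simp add: e_def)
      then show "\<eta> = \<eta>'" using F(1) h by (intro exps_determine[of \<eta> k \<eta>']) auto
    qed
    have "(\<Sum>\<eta>\<in>F. \<Prod>j<k. r ^ exps k \<eta> j / fact (exps k \<eta> j)) = (\<Sum>l\<in>e ` F. \<Prod>j<k. a (l j))"
      by (subst sum.reindex[OF inj]) (simp add: e_def a_def)
    also have "\<dots> \<le> (\<Sum>l\<in>PiE {..<k} (\<lambda>_. {..<n}). \<Prod>j<k. a (l j))"
      using eP by (intro sum_mono2 finite_PiE image_subsetI prod_nonneg a0) auto
    also have "\<dots> = (\<Prod>j<k. \<Sum>i<n. a i)" by (rule prod_sum_PiE[symmetric]) auto
    also have "\<dots> \<le> (\<Prod>j<k. suminf a)"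
      using sum_le_suminf[OF sa, of "{..<n}"] a0 by (intro prod_mono) (auto intro: sum_nonneg)
    finally show "(\<Sum>\<eta>\<in>F. \<Prod>j<k. r ^ exps k \<eta> j / fact (exps k \<eta> j)) \<le> (\<Prod>j<k. suminf a)" .
  qed
qed

context
  fixes k :: nat and x y :: "nat \<Rightarrow> real"
  assumes pos: "\<And>j. j \<in> {1..k} \<Longrightarrow> 0 < x j \<and> 0 < y j"
begin

lemma schur_weight_nonneg: "\<eta> \<in> partitions k \<Longrightarrow> 0 \<le> schur_weight k x y \<eta>"
  unfolding schur_weight_exps using pos
  by (intro divide_nonneg_nonneg mult_nonneg_nonneg schur_nonneg prod_nonneg) auto

text \<open>Both Schur factors are bounded by geometric growth in the exponents, so the factorials
  in the weight leave exponential series at M^2.\<close>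

lemma schur_weight_summable: "schur_weight k x y summable_on partitions k"
proof -
  define b where "b = Max (insert 0 (x ` {1..k} \<union> y ` {1..k}))"
  have b: "x j \<le> b" "y j \<le> b" if "j \<in> {1..k}" for j
    unfolding b_def by (rule Max_ge; use that in auto)+
  define M where "M = max 0 b + real k + 1"
  have M: "0 \<le> M" by (simp add: M_def)
  obtain c where c: "0 \<le> c" "\<And>\<eta>. \<eta> \<in> partitions k \<Longrightarrow> schur k \<eta> x \<le> c * (\<Prod>j<k. M ^ exps k \<eta> j)"
    using schur_bound[of k x b] pos b unfolding M_def by blast
  obtain d where d: "0 \<le> d" "\<And>\<eta>. \<eta> \<in> partitions k \<Longrightarrow> schur k \<eta> y \<le> d * (\<Prod>j<k. M ^ exps k \<eta> j)"
    using schur_bound[of k y b] pos b unfolding M_def by blast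
  have "(\<lambda>\<eta>. (c * d) * (\<Prod>j<k. (M * M) ^ exps k \<eta> j / fact (exps k \<eta> j))) summable_on partitions k"
    by (intro summable_on_cmult_right exp_product_summable) (simp add: M)
  then show ?thesis
  proof (rule summable_on_comparison_test)
    fix \<eta> assume \<eta>: "\<eta> \<in> partitions k"
    have "schur k \<eta> x * schur k \<eta> y \<le> (c * (\<Prod>j<k. M ^ exps k \<eta> j)) * (d * (\<Prod>j<k. M ^ exps k \<eta> j))"
      using c d \<eta> M pos by (intro mult_mono schur_nonneg mult_nonneg_nonneg prod_nonneg) auto
    also have "\<dots> = (c * d) * (\<Prod>j<k. (M * M) ^ exps k \<eta> j)"
      by (simp add: power_mult_distrib prod.distrib)
    finally show "schur_weight k x y \<eta> \<le> (c * d) * (\<Prod>j<k. (M * M) ^ exps k \<eta> j / fact (exps k \<eta> j))"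
      unfolding schur_weight_exps prod_dividef by (simp add: divide_right_mono prod_nonneg)
  qed (rule schur_weight_nonneg)
qed

text \<open>The empty partition alone contributes a positive weight, since its Schur polynomial is
  1.\<close>

lemma schur_Z_pos: "0 < schur_Z k x y"
proof -
  have z: "(\<lambda>_. 0) \<in> partitions k" by (simp add: partitions_def)
  have "schur k (\<lambda>_. 0) v = 1" for v :: "nat \<Rightarrow> real"
    unfolding schur_branching[OF z] by (rule branching_staircase) (simp add: exps_def)
  then have "0 < schur_weight k x y (\<lambda>_. 0)"
    by (simp add: schur_weight_exps prod_pos)
  also have "\<dots> = sum (schur_weight k x y) {\<lambda>_. 0}" by simp
  also have "\<dots> \<le> schur_Z k x y"
    unfolding schur_Z_def
    by (rule finite_sum_le_infsum[OF schur_weight_summable]) (use z in \<open>auto intro: schur_weight_nonneg\<close>)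
  finally show ?thesis .
qed

lemma schur_p_nonneg: "\<eta> \<in> partitions k \<Longrightarrow> 0 \<le> schur_p k x y \<eta>"
  using schur_weight_nonneg schur_Z_pos by (simp add: schur_p_def)

lemma schur_p_has_sum: "(schur_p k x y has_sum 1) (partitions k)"
proof -
  have "(schur_weight k x y has_sum schur_Z k x y) (partitions k)"
    unfolding schur_Z_def by (rule has_sum_infsum[OF schur_weight_summable])
  then have "((\<lambda>\<eta>. 1 / schur_Z k x y * schur_weight k x y \<eta>) has_sum (1 / schur_Z k x y * schur_Z k x y)) (partitions k)"
    by (rule has_sum_cmult_right)
  then show ?thesis using schur_Z_pos by (simp add: schur_p_def[abs_def])
qed

lemma prob_space_schur_measure: "prob_space (schur_measure k x y)"
proof
  have s0: "Infinite_Sum.abs_summable_on (schur_p k x y) (partitions k)"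
    using schur_p_nonneg has_sum_imp_summable[OF schur_p_has_sum]
    by (subst summable_on_cong[of _ _ "schur_p k x y"]) auto
  note s = abs_summable_equivalent[THEN iffD1, OF s0]
  then have "(\<integral>\<^sup>+\<eta>. ennreal (schur_p k x y \<eta>) \<partial>count_space (partitions k)) = ennreal (infsetsum (schur_p k x y) (partitions k))"
    by (intro nn_integral_conv_infsetsum schur_p_nonneg)
  also have "infsetsum (schur_p k x y) (partitions k) = 1"
    using infsetsum_infsum[OF s] infsumI[OF schur_p_has_sum] by simp
  also have "(\<integral>\<^sup>+\<eta>. ennreal (schur_p k x y \<eta>) \<partial>count_space (partitions k)) =
      (\<integral>\<^sup>+\<eta>\<in>partitions k. ennreal (schur_p k x y \<eta>) \<partial>count_space (partitions k))"
    by (rule nn_integral_cong) simp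
  finally show "emeasure (schur_measure k x y) (space (schur_measure k x y)) = 1"
    unfolding schur_measure_def space_point_measure point_measure_def
    by (subst emeasure_density) simp_all
qed

lemma measure_schur_measure:
  assumes "finite S" "S \<subseteq> partitions k"
  shows "measure (schur_measure k x y) S = (\<Sum>\<eta>\<in>S. schur_p k x y \<eta>)"
proof -
  have "emeasure (schur_measure k x y) S = ennreal (\<Sum>\<eta>\<in>S. schur_p k x y \<eta>)"
    unfolding schur_measure_def
    using assms schur_p_nonneg by (subst emeasure_point_measure_finite2) (auto intro!: sum_ennreal)
  then show ?thesis
    using assms schur_p_nonneg by (simp add: measure_def sum_nonneg subset_iff)
qed

end

theorem theorem1p2:
  fixes M :: "'a measure"
    and G :: "'a \<Rightarrow> complex^'n^'n"
    and N k :: nat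
    and z w :: "nat \<Rightarrow> complex"
  assumes "N = CARD('n)" and "1 \<le> k" and "ginibre_matrix M G"
  shows "integrable M (\<lambda>\<omega>. charpoly_product k z w (G \<omega>)) \<and>
    R_N M G k z w =
      (\<Sum>\<eta> | \<eta> \<in> partitions k \<and> \<eta> 1 \<le> N.
         schur k \<eta> z * schur k \<eta> w *
         (\<Prod>j=1..k. fact (N + j - 1) / fact (\<eta> j + k - j))) \<and>
    (\<forall>x y :: nat \<Rightarrow> real.
       (\<forall>j\<in>{1..k}. 0 < x j \<and> 0 < y j \<and>
          z j = complex_of_real (x j) \<and> w j = complex_of_real (y j)) \<longrightarrow>
       (\<forall>\<eta>\<in>partitions k. 0 \<le> schur_p k x y \<eta>) \<and>
       (schur_p k x y has_sum 1) (partitions k) \<and>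
       prob_space (schur_measure k x y) \<and>
       R_N M G k z w =
         complex_of_real (schur_Z k x y * (\<Prod>j=1..k. fact (N + j - 1)) *
           measure (schur_measure k x y) {\<eta> \<in> partitions k. \<eta> 1 \<le> N}))"
proof (intro conjI allI impI)
  note R = charpoly_expectation(2)[OF assms(1,3), of k z w]
  show "integrable M (\<lambda>\<omega>. charpoly_product k z w (G \<omega>))"
    using assms(1,3) by (rule charpoly_expectation(1))
  show "R_N M G k z w = (\<Sum>\<eta> | \<eta> \<in> partitions k \<and> \<eta> 1 \<le> N. schur k \<eta> z * schur k \<eta> w *
         (\<Prod>j=1..k. fact (N + j - 1) / fact (\<eta> j + k - j)))"
    by (rule R)
  fix x y :: "nat \<Rightarrow> real"
  assume xy: "\<forall>j\<in>{1..k}. 0 < x j \<and> 0 < y j \<and> z j = complex_of_real (x j) \<and> w j = complex_of_real (y j)"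
  then have pos: "\<And>j. j \<in> {1..k} \<Longrightarrow> 0 < x j \<and> 0 < y j" by blast
  show "\<forall>\<eta>\<in>partitions k. 0 \<le> schur_p k x y \<eta>" using schur_p_nonneg[of k x y, OF pos] by blast
  show "(schur_p k x y has_sum 1) (partitions k)" using pos by (rule schur_p_has_sum)
  show "prob_space (schur_measure k x y)" using pos by (rule prob_space_schur_measure)
  let ?S = "{\<eta> \<in> partitions k. \<eta> 1 \<le> N}"
  let ?F = "\<Prod>j=1..k. fact (N + j - 1) :: real"
  have Z: "schur_Z k x y \<noteq> 0" using schur_Z_pos[of k x y, OF pos] by simp
  have "R_N M G k z w = (\<Sum>\<eta>\<in>?S. complex_of_real (?F * schur_weight k x y \<eta>))"
    unfolding R
  proof (rule sum.cong)
    fix \<eta> assume "\<eta> \<in> ?S"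
    then have \<eta>: "\<eta> \<in> partitions k" by simp
    have "schur k \<eta> z = complex_of_real (schur k \<eta> x)" "schur k \<eta> w = complex_of_real (schur k \<eta> y)"
      using xy by (auto intro: schur_of_real[OF \<eta>])
    then show "schur k \<eta> z * schur k \<eta> w * (\<Prod>j=1..k. fact (N + j - 1) / fact (\<eta> j + k - j)) =
       complex_of_real (?F * schur_weight k x y \<eta>)"
      by (simp add: schur_weight_def prod_dividef)
  qed auto
  also have "\<dots> = complex_of_real (\<Sum>\<eta>\<in>?S. schur_Z k x y * ?F * schur_p k x y \<eta>)"
    using Z by (simp add: schur_p_def mult_ac)
  also have "(\<Sum>\<eta>\<in>?S. schur_Z k x y * ?F * schur_p k x y \<eta>) =
      schur_Z k x y * ?F * measure (schur_measure k x y) ?S"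
    using finite_partitions_le[of k N]
    by (subst measure_schur_measure[of k x y, OF pos]) (auto simp: sum_distrib_left)
  finally show "R_N M G k z w = complex_of_real (schur_Z k x y * ?F * measure (schur_measure k x y) ?S)" .
qed

end
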